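(* For every $\mu\in\Lambda$ and $m=1,\dots,n$, $$\mathbf e_m(z)\,\overline R_\mu(z)=\sum_I[\psi'_{\lambda/\mu}]_{\rm even}\,\overline R_\lambda(z).$$ Here $\lambda=\mu+\epsilon_I$ and $I$ runs through all subsets of $\{1,\dots,n\}$ consisting of $\lceil m/2\rceil$ odd numbers and $\lfloor m/2\rfloor$ even numbers such that $\lambda\in\Lambda$.
   Context: Let $k$ be a field of characteristic zero, $n\ge 1$, $\mathcal P=k[z_1,\dots,z_n]$, and let $W\subseteq S_n$ be the group of permutations $\pi$ with $\pi(i)\equiv i \bmod 2$ for all $i$, acting by permuting variables. $\Lambda$ is the set of integer tuples $\lambda=(\lambda_1\ge\dots\ge\lambda_n\ge 0)$ and $|\lambda|_{\rm odd}=\sum_{i\text{ odd}}\lambda_i$. Fix $r\in k$ which is not a negative rational number and put $\rho=((n-1)r,(n-2)r,\dots,r,0)$. For $\lambda\in\Lambda$ let $[\lambda]_m=\lambda_m-\lambda_{m+1}+\dots+(-1)^{n-m}\lambda_n$. $R_\lambda(z;r)\in\mathcal P^W$ is the unique $W$-invariant polynomial of degree $|\lambda|_{\rm odd}$ which satisfies $R_\lambda(\rho+\mu)=0$ for all $\mu\in\Lambda$ with $|\mu|_{\rm odd}\le|\lambda|_{\rm odd}$, $\mu\ne\lambda$, and in which the monomial $z^{[\lambda]}$ has coefficient $1$ (it is known that this exists and is unique). $\overline R_\lambda$ is its homogeneous component of highest degree $|\lambda|_{\rm odd}$. $\mathbf e_m(z)=\overline R_{(1^m)}(z)$; explicitly,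 with $z_{\rm odd}=(z_1,z_3,\dots)$, $z_{\rm even}=(z_2,z_4,\dots)$ and $e_p$ the usual elementary symmetric polynomials, $\mathbf e_{2p-1}(z)=e_p(z_{\rm odd})-e_p(z_{\rm even})$ and $\mathbf e_{2p}(z)=e_p(z_{\rm even})$. $\epsilon_I\in\mathbb Z^n$ is the indicator vector of $I$, and for $\lambda=\mu+\epsilon_I\in\Lambda$, $$[\psi'_{\lambda/\mu}]_{\rm even}=\frac{\prod_{i\notin I,\,j\in I,\ i<j,\ j-i\text{ odd}}\big(\mu_i-\mu_j+(j-i-1)r\big)\big(\lambda_i-\lambda_j+(j-i+1)r\big)}{\prod_{i\notin I,\,j\in I,\ i<j,\ j-i\text{ even}}\big(\mu_i-\mu_j+(j-i)r\big)\big(\lambda_i-\lambda_j+(j-i)r\big)},\qquad i,j\in\{1,\dots,n\}.$$ For $r=0$ this is understood as the limit $r\to0$, i.e. the value at $0$ of this expression viewed as a rational function of $r$. *)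

theory Defs
  imports
    "HOL-Library.Poly_Mapping"
    "HOL-Combinatorics.Permutations"
    "HOL-Computational_Algebra.Polynomial"
    "HOL-Computational_Algebra.Fraction_Field"
begin

text \<open>
  A monomial is a finitely supported exponent function and a polynomial a finitely supported
  coefficient function on monomials; multiplication is the convolution product of
  \<^type>\<open>poly_mapping\<close>. The variables are indexed by natural numbers, and
  \<open>poly_ring n\<close> below singles out the polynomials in \<open>z\<^sub>1, \<dots>, z\<^sub>n\<close>.
\<close>

type_synonym 'a mpoly = "(nat \<Rightarrow>\<^sub>0 nat) \<Rightarrow>\<^sub>0 'a"

definition poly_ring :: "nat \<Rightarrow> 'a::zero mpoly set" where
  "poly_ring n = {p. \<forall>m\<in>Poly_Mapping.keys p. Poly_Mapping.keys m \<subseteq> {1..n}}"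

definition eval_mpoly :: "(nat \<Rightarrow> 'a) \<Rightarrow> 'a::comm_semiring_1 mpoly \<Rightarrow> 'a" where
  "eval_mpoly x p = (\<Sum>m\<in>Poly_Mapping.keys p.
     Poly_Mapping.lookup p m * (\<Prod>i\<in>Poly_Mapping.keys m. x i ^ Poly_Mapping.lookup m i))"

definition mono_degree :: "(nat \<Rightarrow>\<^sub>0 nat) \<Rightarrow> nat" where
  "mono_degree m = (\<Sum>i\<in>Poly_Mapping.keys m. Poly_Mapping.lookup m i)"

text \<open>The zero polynomial gets degree 0.\<close>

definition total_degree :: "'a::zero mpoly \<Rightarrow> nat" where
  "total_degree p = Max (insert 0 (mono_degree ` Poly_Mapping.keys p))"

definition hom_component :: "nat \<Rightarrow> 'a::comm_monoid_add mpoly \<Rightarrow> 'a mpoly" where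
  "hom_component d p =
     (\<Sum>m\<in>{m \<in> Poly_Mapping.keys p. mono_degree m = d}.
        Poly_Mapping.single m (Poly_Mapping.lookup p m))"

text \<open>The substitution \<open>z\<^sub>i \<mapsto> z\<^bsub>\<pi>(i)\<^esub>\<close>, on monomials and on polynomials.\<close>

definition permute_mono :: "(nat \<Rightarrow> nat) \<Rightarrow> (nat \<Rightarrow>\<^sub>0 nat) \<Rightarrow> (nat \<Rightarrow>\<^sub>0 nat)" where
  "permute_mono \<pi> m =
     (\<Sum>i\<in>Poly_Mapping.keys m. Poly_Mapping.single (\<pi> i) (Poly_Mapping.lookup m i))"

definition permute_vars :: "(nat \<Rightarrow> nat) \<Rightarrow> 'a::comm_monoid_add mpoly \<Rightarrow> 'a mpoly" where
  "permute_vars \<pi> p =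
     (\<Sum>m\<in>Poly_Mapping.keys p.
        Poly_Mapping.single (permute_mono \<pi> m) (Poly_Mapping.lookup p m))"

definition parity_group :: "nat \<Rightarrow> (nat \<Rightarrow> nat) set" where
  "parity_group n = {\<pi>. \<pi> permutes {1..n} \<and> (\<forall>i\<in>{1..n}. \<pi> i mod 2 = i mod 2)}"

definition semisymmetric :: "nat \<Rightarrow> 'a::comm_monoid_add mpoly set" where
  "semisymmetric n =
     {p \<in> poly_ring n. \<forall>\<pi>\<in>parity_group n. permute_vars \<pi> p = p}"

text \<open>
  A tuple \<open>(\<lambda>\<^sub>1, \<dots>, \<lambda>\<^sub>n)\<close> is a function on \<open>nat\<close> that vanishes outside \<open>{1..n}\<close>,
  so that equality of tuples is equality of functions.
\<close>

definition Lam :: "nat \<Rightarrow> (nat \<Rightarrow> nat) set" where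
  "Lam n = {l. (\<forall>i j. 1 \<le> i \<longrightarrow> i \<le> j \<longrightarrow> j \<le> n \<longrightarrow> l j \<le> l i) \<and> (\<forall>i. i \<notin> {1..n} \<longrightarrow> l i = 0)}"

definition odd_size :: "nat \<Rightarrow> (nat \<Rightarrow> nat) \<Rightarrow> nat" where
  "odd_size n l = (\<Sum>i\<in>{i\<in>{1..n}. odd i}. l i)"

text \<open>The alternating sum is nonnegative for \<open>l \<in> Lam n\<close>, so \<^const>\<open>nat\<close> does not truncate.\<close>

definition alt_tail :: "nat \<Rightarrow> (nat \<Rightarrow> nat) \<Rightarrow> nat \<Rightarrow> nat" where
  "alt_tail n l m = nat (\<Sum>j=m..n. (-1) ^ (j - m) * int (l j))"

definition alt_mono :: "nat \<Rightarrow> (nat \<Rightarrow> nat) \<Rightarrow> (nat \<Rightarrow>\<^sub>0 nat)" where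
  "alt_mono n l = (\<Sum>i=1..n. Poly_Mapping.single i (alt_tail n l i))"

definition rho :: "nat \<Rightarrow> 'a::semiring_1 \<Rightarrow> nat \<Rightarrow> 'a" where
  "rho n r i = of_nat (n - i) * r"

definition is_R :: "nat \<Rightarrow> 'a::field_char_0 \<Rightarrow> (nat \<Rightarrow> nat) \<Rightarrow> 'a mpoly \<Rightarrow> bool" where
  "is_R n r l p \<longleftrightarrow>
     p \<in> semisymmetric n \<and>
     total_degree p = odd_size n l \<and>
     (\<forall>\<mu>\<in>Lam n. odd_size n \<mu> \<le> odd_size n l \<longrightarrow> \<mu> \<noteq> l \<longrightarrow>
        eval_mpoly (\<lambda>i. rho n r i + of_nat (\<mu> i)) p = 0) \<and>
     Poly_Mapping.lookup p (alt_mono n l) = 1"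

definition R_poly :: "nat \<Rightarrow> 'a::field_char_0 \<Rightarrow> (nat \<Rightarrow> nat) \<Rightarrow> 'a mpoly" where
  "R_poly n r l = (THE p. is_R n r l p)"

definition Rbar :: "nat \<Rightarrow> 'a::field_char_0 \<Rightarrow> (nat \<Rightarrow> nat) \<Rightarrow> 'a mpoly" where
  "Rbar n r l = hom_component (odd_size n l) (R_poly n r l)"

definition column :: "nat \<Rightarrow> nat \<Rightarrow> nat" where
  "column m = (\<lambda>i. if i \<in> {1..m} then 1 else 0)"

definition e_poly :: "nat \<Rightarrow> 'a::field_char_0 \<Rightarrow> nat \<Rightarrow> 'a mpoly" where
  "e_poly n r m = Rbar n r (column m)"

definition add_eps :: "(nat \<Rightarrow> nat) \<Rightarrow> nat set \<Rightarrow> nat \<Rightarrow> nat" where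
  "add_eps \<mu> I = (\<lambda>i. \<mu> i + (if i \<in> I then 1 else 0))"

definition psi_pairs :: "nat \<Rightarrow> nat set \<Rightarrow> (nat \<times> nat) set" where
  "psi_pairs n I = {(i, j). i \<in> {1..n} \<and> j \<in> {1..n} \<and> i \<notin> I \<and> j \<in> I \<and> i < j}"

text \<open>
  The formula is polymorphic in the field so that it can be instantiated both at \<open>r \<in> k\<close> and
  at the indeterminate of \<open>k(t)\<close>.
\<close>

definition psi_formula :: "nat \<Rightarrow> 'b::field \<Rightarrow> (nat \<Rightarrow> nat) \<Rightarrow> nat set \<Rightarrow> 'b" where
  "psi_formula n r \<mu> I =
     (let l = add_eps \<mu> I in
      (\<Prod>(i, j)\<in>{(i, j) \<in> psi_pairs n I. odd (j - i)}.
         (of_nat (\<mu> i) - of_nat (\<mu> j) + of_nat (j - i - 1) * r) *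
         (of_nat (l i) - of_nat (l j) + of_nat (j - i + 1) * r)) /
      (\<Prod>(i, j)\<in>{(i, j) \<in> psi_pairs n I. even (j - i)}.
         (of_nat (\<mu> i) - of_nat (\<mu> j) + of_nat (j - i) * r) *
         (of_nat (l i) - of_nat (l j) + of_nat (j - i) * r)))"

text \<open>The value at \<open>a\<close> of a rational function that is regular at \<open>a\<close>.\<close>

definition ratfun_value :: "'a::field poly fract \<Rightarrow> 'a \<Rightarrow> 'a" where
  "ratfun_value f a =
     (THE c. \<exists>p q. poly q a \<noteq> 0 \<and> f = Fract p q \<and> c = poly p a / poly q a)"

text \<open>
  For \<open>r = 0\<close> numerator and denominator may both vanish, and the coefficient is the value at 0
  of the expression viewed as a rational function of \<open>r\<close>.
\<close>

definition psi_even :: "nat \<Rightarrow> 'a::field_char_0 \<Rightarrow> (nat \<Rightarrow> nat) \<Rightarrow> nat set \<Rightarrow> 'a" where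
  "psi_even n r \<mu> I =
     (if r = 0 then ratfun_value (psi_formula n (Fract [:0, 1:] 1) \<mu> I) 0
      else psi_formula n r \<mu> I)"

definition pieri_sets :: "nat \<Rightarrow> (nat \<Rightarrow> nat) \<Rightarrow> nat \<Rightarrow> nat set set" where
  "pieri_sets n \<mu> m =
     {I. I \<subseteq> {1..n} \<and> card {i \<in> I. odd i} = (m + 1) div 2 \<and> card {i \<in> I. even i} = m div 2 \<and>
         add_eps \<mu> I \<in> Lam n}"

end

theory Submission
  imports Defs
begin

text \<open>
  For \<open>I \<subseteq> {1..n}\<close> consider the rational function
  \<open>a\<^sub>I(z) = (\<Prod>i\<in>I, i \<equiv> n. z\<^sub>i) (\<Prod>i\<in>I, j\<notin>I, i - j odd. z\<^sub>i - z\<^sub>j - r) / (\<Prod>i\<in>I, j\<notin>I, i - j even. z\<^sub>i - z\<^sub>j)\<close>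
  and the difference operator \<open>M f (z) = \<Sum>\<^sub>I a\<^sub>I(z) f(z - \<epsilon>\<^sub>I)\<close>, where \<open>I\<close> runs through the sets of
  \<open>\<lceil>m/2\<rceil>\<close> odd and \<open>\<lfloor>m/2\<rfloor>\<close> even numbers. By symmetry the poles cancel, so \<open>M\<close> acts on the \<open>W\<close>-invariant
  polynomials, and on highest components it is the multiplication by that of \<open>M 1\<close>. The function
  \<open>a\<^sub>I\<close> vanishes at \<open>\<rho> + \<nu>\<close> unless \<open>\<nu> - \<epsilon>\<^sub>I \<in> \<Lambda>\<close>. Hence \<open>M R\<^sub>\<mu>\<close> vanishes at all \<open>\<rho> + \<nu>\<close> with
  \<open>|\<nu>|\<^sub>o\<^sub>d\<^sub>d \<le> |\<mu>|\<^sub>o\<^sub>d\<^sub>d + \<lceil>m/2\<rceil>\<close> except the points \<open>\<nu> = \<mu> + \<epsilon>\<^sub>I\<close>, that is, \<open>M R\<^sub>\<mu>\<close> is a combination of the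
  \<open>R\<^sub>\<lambda>\<close> with \<open>\<lambda> = \<mu> + \<epsilon>\<^sub>I\<close> and coefficients \<open>a\<^sub>I(\<rho> + \<lambda>) R\<^sub>\<mu>(\<rho> + \<mu>) / R\<^sub>\<lambda>(\<rho> + \<lambda>)\<close>. In particular
  \<open>M 1 = R\<^bsub>(1\<^sup>m)\<^esub>\<close>.

  In the lexicographic order the leading exponent of \<open>M f\<close> exceeds that of \<open>f\<close> by \<open>[(1\<^sup>m)]\<close>, with the
  same coefficient. So \<open>R\<^sub>\<lambda>\<close> is obtained from \<open>M R\<^sub>\<mu>\<close>, \<open>\<lambda> = \<mu> + (1\<^sup>m)\<close>, by subtracting multiples of
  polynomials \<open>R\<^sub>\<nu>\<close> with smaller leading exponent, and its leading term is \<open>z\<^bsup>[\<lambda>]\<^esup>\<close>. This gives existence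
  and uniqueness of \<open>R\<^sub>\<lambda>\<close>, and a product formula for \<open>R\<^sub>\<lambda>(\<rho> + \<lambda>)\<close> that turns the coefficients above
  into \<open>[\<psi>'\<^bsub>\<lambda>/\<mu>\<^esub>]\<^sub>e\<^sub>v\<^sub>e\<^sub>n\<close>.
\<close>

section \<open>Substitution homomorphisms\<close>

text \<open>The numerator of a_I is dictated by the points \<rho> + \<nu>. There z_k - z_(k+1) - r
  vanishes when \<nu>_k = \<nu>_(k+1), because consecutive entries of \<rho> differ by r, and z_n
  vanishes when \<nu>_n = 0. Equivariance under the parity group then asks for all pairs of opposite
  parity and for all z_i with i congruent to n. With the equal-parity denominators every a_I has the
  same degree, the ceiling of m/2, and this is why the shifts disappear on highest components.

  The obstacle is division. The numerator of the operator must be divisible by the square of each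
  z_i - z_j of equal parity: one factor sits in every summand, the second comes from antisymmetry.
  Even so, for r = 0 these differences may vanish at the points, so values are compared over k(t)
  and then specialised; powers of t have to be counted to see that the coefficients have no pole.

  The value at \<rho> + \<lambda> is carried along in the same induction as existence. The induction
  removes the first column {1..m} of \<lambda>, and the set I = {1..m} has coefficient 1.\<close>

abbreviation lookup :: "('b \<Rightarrow>\<^sub>0 'a::zero) \<Rightarrow> 'b \<Rightarrow> 'a" where
  "lookup \<equiv> Poly_Mapping.lookup"

abbreviation keys :: "('b \<Rightarrow>\<^sub>0 'a::zero) \<Rightarrow> 'b set" where
  "keys \<equiv> Poly_Mapping.keys"

abbreviation single :: "'b \<Rightarrow> 'a \<Rightarrow> 'b \<Rightarrow>\<^sub>0 'a::zero" where
  "single \<equiv> Poly_Mapping.single"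

locale ring_morphism =
  fixes \<phi> :: "'a::comm_ring_1 \<Rightarrow> 'b::comm_ring_1"
  assumes map_one [simp]: "\<phi> 1 = 1"
    and map_add: "\<phi> (x + y) = \<phi> x + \<phi> y"
    and map_mult: "\<phi> (x * y) = \<phi> x * \<phi> y"
begin

lemma map_zero [simp]: "\<phi> 0 = 0"
  using map_add[of 0 0] by simp

lemma map_uminus: "\<phi> (- x) = - \<phi> x"
  using map_add[of x "- x"] by (simp add: eq_neg_iff_add_eq_0 add.commute)

lemma map_diff: "\<phi> (x - y) = \<phi> x - \<phi> y"
  using map_add[of x "- y"] by (simp add: map_uminus)

lemma map_sum: "\<phi> (sum f A) = (\<Sum>x\<in>A. \<phi> (f x))"
  by (induction A rule: infinite_finite_induct) (auto simp: map_add)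

lemma map_prod: "\<phi> (prod f A) = (\<Prod>x\<in>A. \<phi> (f x))"
  by (induction A rule: infinite_finite_induct) (auto simp: map_mult)

lemma map_power: "\<phi> (x ^ k) = \<phi> x ^ k"
  by (induction k) (auto simp: map_mult)

lemma map_of_nat: "\<phi> (of_nat k) = of_nat k"
  by (induction k) (auto simp: map_add)

lemma map_dvd: "x dvd y \<Longrightarrow> \<phi> x dvd \<phi> y"
  by (auto simp: dvd_def map_mult)

end

lemma ring_morphism_comp:
  assumes "ring_morphism \<phi>" "ring_morphism \<psi>"
  shows "ring_morphism (\<lambda>x. \<phi> (\<psi> x))"
  using assms by (auto simp: ring_morphism_def)

lemma ring_morphism_id: "ring_morphism (\<lambda>x. x)"
  by (auto simp: ring_morphism_def)

abbreviation mconst :: "'a::zero \<Rightarrow> 'a mpoly" where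
  "mconst \<equiv> single 0"

definition mvar :: "nat \<Rightarrow> 'a::zero_neq_one mpoly" where
  "mvar i = single (single i 1) 1"

definition mono_eval :: "(nat \<Rightarrow> 'b::comm_semiring_1) \<Rightarrow> (nat \<Rightarrow>\<^sub>0 nat) \<Rightarrow> 'b" where
  "mono_eval \<sigma> m = (\<Prod>i\<in>keys m. \<sigma> i ^ lookup m i)"

text \<open>Coefficients and variables are mapped independently, so that evaluation, permutation of
  variables, shifts, restriction of variables and change of the coefficient ring are all instances
  of one homomorphism.\<close>

definition subst :: "('a::comm_ring_1 \<Rightarrow> 'b::comm_ring_1) \<Rightarrow> (nat \<Rightarrow> 'b) \<Rightarrow> 'a mpoly \<Rightarrow> 'b" where
  "subst h \<sigma> p = (\<Sum>m\<in>keys p. h (lookup p m) * mono_eval \<sigma> m)"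

lemma ring_morphism_mconst: "ring_morphism (mconst :: 'a::comm_ring_1 \<Rightarrow> _)"
  by standard (auto simp: single_add mult_single)

lemma mono_eval_superset:
  assumes "finite A" "keys m \<subseteq> A"
  shows "mono_eval \<sigma> m = (\<Prod>i\<in>A. \<sigma> i ^ lookup m i)"
  unfolding mono_eval_def
  by (rule prod.mono_neutral_left) (use assms in \<open>auto simp: in_keys_iff\<close>)

lemma mono_eval_add: "mono_eval \<sigma> (a + b) = mono_eval \<sigma> a * mono_eval \<sigma> b"
proof -
  let ?A = "keys a \<union> keys b"
  have "mono_eval \<sigma> (a + b) = (\<Prod>i\<in>?A. \<sigma> i ^ lookup (a + b) i)"
    by (rule mono_eval_superset) (simp_all add: keys_add)
  also have "\<dots> = mono_eval \<sigma> a * mono_eval \<sigma> b"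
    by (simp add: mono_eval_superset[of ?A a] mono_eval_superset[of ?A b]
        lookup_add power_add prod.distrib)
  finally show ?thesis .
qed

lemma mono_eval_zero [simp]: "mono_eval \<sigma> 0 = 1"
  by (simp add: mono_eval_def)

lemma mono_eval_single [simp]: "mono_eval \<sigma> (single i k) = \<sigma> i ^ k"
  by (simp add: mono_eval_def)

lemma sum_singles:
  "(\<Sum>m\<in>keys p. single m (lookup p m)) = p"
  by (rule poly_mapping_eqI) (simp add: lookup_sum lookup_single when_def in_keys_iff)

lemma mpoly_induct [case_names single add]:
  assumes "\<And>m c. P (single m c)" "\<And>p q. P p \<Longrightarrow> P q \<Longrightarrow> P (p + q)"
  shows "P (p :: 'a::comm_monoid_add mpoly)"
proof -
  have "P (\<Sum>m\<in>A. single m (lookup p m))" for A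
  proof (induction A rule: infinite_finite_induct)
    case (insert m A)
    then show ?case using assms(2)[OF assms(1)] by simp
  qed (use assms(1)[of 0 0] in simp_all)
  from this[of "keys p"] show ?thesis by (simp add: sum_singles)
qed

lemma subst_superset:
  assumes "h 0 = 0" "finite A" "keys p \<subseteq> A"
  shows "subst h \<sigma> p = (\<Sum>m\<in>A. h (lookup p m) * mono_eval \<sigma> m)"
  unfolding subst_def
  by (rule sum.mono_neutral_left) (use assms in \<open>auto simp: in_keys_iff\<close>)

lemma subst_single:
  assumes "h 0 = 0"
  shows "subst h \<sigma> (single m c) = h c * mono_eval \<sigma> m"
  using assms by (simp add: subst_def)

lemma subst_add:
  assumes "ring_morphism h"
  shows "subst h \<sigma> (p + q) = subst h \<sigma> p + subst h \<sigma> q"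
proof -
  interpret ring_morphism h by fact
  let ?A = "keys p \<union> keys q"
  have "subst h \<sigma> (p + q) =
      (\<Sum>m\<in>?A. h (lookup (p + q) m) * mono_eval \<sigma> m)"
    by (rule subst_superset) (simp_all add: keys_add)
  also have "\<dots> = subst h \<sigma> p + subst h \<sigma> q"
    by (simp add: subst_superset[of h ?A p] subst_superset[of h ?A q]
        lookup_add map_add sum.distrib distrib_right)
  finally show ?thesis .
qed

lemma subst_morphism:
  assumes "ring_morphism h"
  shows "ring_morphism (subst h \<sigma>)"
proof
  interpret ring_morphism h by fact
  show "subst h \<sigma> 1 = 1"
    using subst_single[of h \<sigma> 0 1] by simp
  show add: "subst h \<sigma> (p + q) = subst h \<sigma> p + subst h \<sigma> q" for p q
    by (rule subst_add) fact
  show "subst h \<sigma> (p * q) = subst h \<sigma> p * subst h \<sigma> q" for p q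
  proof (induction p rule: mpoly_induct)
    case (single m c)
    show ?case
      by (induction q rule: mpoly_induct)
        (auto simp: mult_single subst_single mono_eval_add map_mult algebra_simps add)
  qed (simp add: add distrib_right)
qed

lemma subst_mconst [simp]:
  assumes "ring_morphism h"
  shows "subst h \<sigma> (mconst c) = h c"
  using assms ring_morphism.map_zero[OF assms] by (simp add: subst_single)

lemma subst_mvar [simp]:
  assumes "ring_morphism h"
  shows "subst h \<sigma> (mvar i) = \<sigma> i"
  using ring_morphism.map_zero[OF assms] ring_morphism.map_one[OF assms]
  by (simp add: mvar_def subst_single)

lemma mono_eval_mvar_comp:
  "mono_eval (\<lambda>i. mvar (\<pi> i)) m = (single (permute_mono \<pi> m) 1 :: 'a::comm_ring_1 mpoly)"
proof -
  have pow: "mvar i ^ k = single (single i k) (1::'a)" for i k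
    by (induction k) (auto simp: mvar_def mult_single single_add[symmetric])
  have pr: "(\<Prod>i\<in>A. single (f i) (1::'a)) =
      (single (\<Sum>i\<in>A. f i) 1 :: 'a mpoly)" for A :: "nat set" and f
    by (induction A rule: infinite_finite_induct) (auto simp: mult_single)
  show ?thesis
    by (simp add: mono_eval_def pow pr permute_mono_def)
qed

lemma single_eq_mono_eval:
  "single m (c::'a::comm_ring_1) = mconst c * mono_eval mvar m"
  using mono_eval_mvar_comp[of "\<lambda>i. i" m, where ?'a = 'a]
  by (simp add: permute_mono_def sum_singles mult_single)

text \<open>Every polynomial is a sum of products of constants and variables. The commutation laws
  between the operations below are therefore checked on \<open>mconst c\<close> and
  \<open>mvar i\<close> only.\<close>

lemma morphism_eqI:
  assumes "ring_morphism \<phi>" "ring_morphism \<psi>"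
    and "\<And>c. \<phi> (mconst c) = \<psi> (mconst c)" "\<And>i. \<phi> (mvar i) = \<psi> (mvar i)"
  shows "\<phi> p = \<psi> (p :: 'a::comm_ring_1 mpoly)"
proof -
  interpret f: ring_morphism \<phi> by fact
  interpret g: ring_morphism \<psi> by fact
  show ?thesis
  proof (induction p rule: mpoly_induct)
    case (single m c)
    show ?case
      by (subst (1 2) single_eq_mono_eval)
        (simp add: mono_eval_def f.map_mult g.map_mult f.map_prod g.map_prod
          f.map_power g.map_power assms(3,4))
  qed (simp add: f.map_add g.map_add)
qed

lemma subst_comp:
  assumes "ring_morphism \<phi>" "ring_morphism h"
  shows "\<phi> (subst h \<sigma> p) = subst (\<lambda>c. \<phi> (h c)) (\<lambda>i. \<phi> (\<sigma> i)) p"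
proof (rule morphism_eqI[of "\<lambda>p. \<phi> (subst h \<sigma> p)"])
  have h: "ring_morphism (\<lambda>c. \<phi> (h c))"
    using assms by (rule ring_morphism_comp)
  show "ring_morphism (\<lambda>p. \<phi> (subst h \<sigma> p))"
    by (rule ring_morphism_comp[OF assms(1) subst_morphism[OF assms(2)]])
  show "ring_morphism (subst (\<lambda>c. \<phi> (h c)) (\<lambda>i. \<phi> (\<sigma> i)))"
    by (rule subst_morphism[OF h])
  show "\<phi> (subst h \<sigma> (mconst c)) = subst (\<lambda>c. \<phi> (h c)) (\<lambda>i. \<phi> (\<sigma> i)) (mconst c)" for c
    using assms(2) h by simp
  show "\<phi> (subst h \<sigma> (mvar i)) = subst (\<lambda>c. \<phi> (h c)) (\<lambda>i. \<phi> (\<sigma> i)) (mvar i)" for i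
    using assms(2) h by simp
qed

lemma eval_mpoly_subst: "eval_mpoly x p = subst (\<lambda>c. c) x p"
  by (simp add: eval_mpoly_def subst_def mono_eval_def)

lemma permute_vars_subst: "permute_vars \<pi> p = subst mconst (\<lambda>i. mvar (\<pi> i)) p"
  by (simp add: permute_vars_def subst_def mono_eval_mvar_comp mult_single)

definition cmap :: "('a::comm_ring_1 \<Rightarrow> 'b::comm_ring_1) \<Rightarrow> 'a mpoly \<Rightarrow> 'b mpoly" where
  "cmap h = subst (\<lambda>c. mconst (h c)) mvar"

lemma ring_morphism_mconst_comp:
  "ring_morphism h \<Longrightarrow> ring_morphism (\<lambda>c. mconst (h c))"
  by (rule ring_morphism_comp[OF ring_morphism_mconst])

lemma cmap_morphism: "ring_morphism h \<Longrightarrow> ring_morphism (cmap h)"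
  unfolding cmap_def by (intro subst_morphism ring_morphism_mconst_comp)

lemma eval_cmap:
  assumes "ring_morphism h"
  shows "eval_mpoly x (cmap h p) = subst h x p"
  unfolding eval_mpoly_subst cmap_def
  by (simp add: subst_comp[of "subst (\<lambda>c. c) x"] assms subst_morphism ring_morphism_mconst_comp
      ring_morphism_id)

lemma map_eval_mpoly:
  assumes "ring_morphism h"
  shows "h (eval_mpoly x p) = eval_mpoly (\<lambda>i. h (x i)) (cmap h p)"
  using assms by (simp add: eval_cmap) (simp add: eval_mpoly_subst subst_comp ring_morphism_id)

text \<open>Turns membership in \<open>poly_ring n\<close> into invariance under an endomorphism, so
  that it is handled in the same way as invariance under permutations.\<close>

definition restrict_vars :: "nat \<Rightarrow> 'a::comm_ring_1 mpoly \<Rightarrow> 'a mpoly" where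
  "restrict_vars n = subst mconst (\<lambda>i. if i \<in> {1..n} then mvar i else 0)"

lemma restrict_vars_morphism: "ring_morphism (restrict_vars n)"
  unfolding restrict_vars_def by (intro subst_morphism ring_morphism_mconst)

interpretation restrict_hom: ring_morphism "restrict_vars n" for n
  by (rule restrict_vars_morphism)

lemma restrict_vars_single:
  "restrict_vars n (single m c) =
     (if keys m \<subseteq> {1..n} then single m c else (0::'a::comm_ring_1 mpoly))"
proof (cases "keys m \<subseteq> {1..n}")
  case True
  then have "mono_eval (\<lambda>i. if i \<in> {1..n} then mvar i else (0::'a mpoly)) m = mono_eval mvar m"
    unfolding mono_eval_def by (intro prod.cong) auto
  then have "restrict_vars n (single m c) = mconst c * mono_eval mvar m"
    unfolding restrict_vars_def by (subst subst_single) simp_all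
  with True show ?thesis
    by (simp only: single_eq_mono_eval[symmetric] if_True)
next
  case False
  then obtain i where i: "i \<in> keys m" "i \<notin> {1..n}" by blast
  then have "(if i \<in> {1..n} then mvar i else (0::'a mpoly)) ^ lookup m i = 0"
    by (simp only: if_False in_keys_iff zero_power_eq) simp
  then have "mono_eval (\<lambda>i. if i \<in> {1..n} then mvar i else (0::'a mpoly)) m = 0"
    unfolding mono_eval_def by (intro prod_zero[OF finite_keys] bexI[OF _ i(1)])
  then have "restrict_vars n (single m c) = 0"
    unfolding restrict_vars_def by (subst subst_single) simp_all
  with False show ?thesis
    by simp
qed

lemma lookup_restrict_vars:
  "lookup (restrict_vars n p) m =
     (if keys m \<subseteq> {1..n} then lookup p m else 0)"
proof (induction p rule: mpoly_induct)
  case (single m' c)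
  show ?case by (cases "m' = m") (simp_all add: restrict_vars_single lookup_single)
next
  case (add p q)
  then show ?case
    by (simp add: restrict_hom.map_add lookup_add)
qed

lemma poly_ring_iff: "p \<in> poly_ring n \<longleftrightarrow> restrict_vars n p = p"
proof -
  have "restrict_vars n p = p \<longleftrightarrow>
      (\<forall>m. keys m \<subseteq> {1..n} \<or> lookup p m = 0)"
    unfolding poly_mapping_eq_iff fun_eq_iff lookup_restrict_vars by metis
  then show ?thesis
    by (auto simp: poly_ring_def in_keys_iff)
qed

section \<open>Degree and leading terms\<close>

lemma mono_degree_superset:
  assumes "finite A" "keys m \<subseteq> A"
  shows "mono_degree m = (\<Sum>i\<in>A. lookup m i)"
  unfolding mono_degree_def
  by (rule sum.mono_neutral_left) (use assms in \<open>auto simp: in_keys_iff\<close>)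

lemma mono_degree_add: "mono_degree (a + b) = mono_degree a + mono_degree b"
proof -
  let ?A = "keys a \<union> keys b"
  have "mono_degree (a + b) = (\<Sum>i\<in>?A. lookup (a + b) i)"
    by (rule mono_degree_superset) (simp_all add: keys_add)
  also have "\<dots> = mono_degree a + mono_degree b"
    by (simp add: mono_degree_superset[of ?A a] mono_degree_superset[of ?A b]
        lookup_add sum.distrib)
  finally show ?thesis .
qed

lemma mono_degree_zero [simp]: "mono_degree 0 = 0"
  by (simp add: mono_degree_def)

lemma mono_degree_single [simp]: "mono_degree (single i k) = k"
  by (simp add: mono_degree_def)

lemma mono_degree_sum: "mono_degree (\<Sum>x\<in>A. f x) = (\<Sum>x\<in>A. mono_degree (f x))"
  by (induction A rule: infinite_finite_induct) (auto simp: mono_degree_add)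

lemma lookup_mult_keys:
  fixes p q :: "'a::comm_ring_1 mpoly"
  shows "lookup (p * q) m =
    (\<Sum>k\<in>keys p. \<Sum>l\<in>keys q.
       if k + l = m then lookup p k * lookup q l else 0)"
proof -
  have "p * q = (\<Sum>k\<in>keys p. single k (lookup p k)) *
      (\<Sum>l\<in>keys q. single l (lookup q l))"
    by (simp only: sum_singles)
  also have "\<dots> = (\<Sum>k\<in>keys p. \<Sum>l\<in>keys q.
      single (k + l) (lookup p k * lookup q l))"
    by (simp add: sum_product mult_single)
  finally show ?thesis
    by (simp add: lookup_sum lookup_single when_def)
qed

lemma lookup_hom_component:
  "lookup (hom_component d p) m =
     (if mono_degree m = d then lookup p m else 0)"
proof -
  have "lookup (hom_component d p) m =
      (\<Sum>k\<in>{k \<in> keys p. mono_degree k = d}.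
        if k = m then lookup p k else 0)"
    by (simp add: hom_component_def lookup_sum lookup_single when_def)
  also have "\<dots> = (if mono_degree m = d then lookup p m else 0)"
    by (subst sum.delta) (auto simp: in_keys_iff)
  finally show ?thesis .
qed

lemma hom_component_add: "hom_component d (p + q) = hom_component d p + hom_component d q"
  by (rule poly_mapping_eqI) (simp add: lookup_hom_component lookup_add)

lemma hom_component_diff:
  "hom_component d (p - q) = hom_component d p - hom_component d (q :: 'a::ab_group_add mpoly)"
  by (rule poly_mapping_eqI) (simp add: lookup_hom_component lookup_minus)

lemma hom_component_zero [simp]: "hom_component d 0 = 0"
  by (rule poly_mapping_eqI) (simp add: lookup_hom_component)

lemma hom_component_sum: "hom_component d (\<Sum>x\<in>A. f x) = (\<Sum>x\<in>A. hom_component d (f x))"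
  by (induction A rule: infinite_finite_induct) (auto simp: hom_component_add)

lemma lookup_mconst_mult:
  "lookup (mconst c * p) m = (c::'a::comm_ring_1) * lookup p m"
proof (cases "c = 0")
  case False
  then have "keys (mconst c :: 'a mpoly) = {0}" by (simp only: keys_single if_False)
  then have "lookup (mconst c * p) m =
      (\<Sum>l\<in>keys p. if l = m then c * lookup p l else 0)"
    by (simp add: lookup_mult_keys)
  then show ?thesis by (simp add: in_keys_iff)
qed simp

lemma hom_component_mconst_mult:
  "hom_component d (mconst c * p) = mconst (c::'a::comm_ring_1) * hom_component d p"
  by (rule poly_mapping_eqI) (simp add: lookup_hom_component lookup_mconst_mult)

definition deg_le :: "nat \<Rightarrow> 'a::zero mpoly \<Rightarrow> bool" where
  "deg_le d p \<longleftrightarrow> (\<forall>m. lookup p m \<noteq> 0 \<longrightarrow> mono_degree m \<le> d)"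

lemma deg_le_mono: "deg_le d p \<Longrightarrow> d \<le> e \<Longrightarrow> deg_le e p"
  by (auto simp: deg_le_def)

lemma deg_le_total_degree: "total_degree p \<le> d \<longleftrightarrow> deg_le d p"
  by (auto simp: total_degree_def deg_le_def in_keys_iff)

lemma deg_le_zero [simp]: "deg_le d 0"
  by (simp add: deg_le_def)

lemma deg_le_add: "deg_le d p \<Longrightarrow> deg_le d q \<Longrightarrow> deg_le d (p + q)"
  unfolding deg_le_def lookup_add by (metis add.right_neutral)

lemma deg_le_diff: "deg_le d p \<Longrightarrow> deg_le d q \<Longrightarrow> deg_le d (p - q :: 'a::ab_group_add mpoly)"
  unfolding deg_le_def lookup_minus by (metis diff_zero)

lemma deg_le_sum: "(\<And>x. x \<in> A \<Longrightarrow> deg_le d (f x)) \<Longrightarrow> deg_le d (\<Sum>x\<in>A. f x)"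
  by (induction A rule: infinite_finite_induct) (auto simp: deg_le_add)

lemma deg_le_mconst_mult: "deg_le d p \<Longrightarrow> deg_le d (mconst (c::'a::comm_ring_1) * p)"
  unfolding deg_le_def lookup_mconst_mult by (metis mult_zero_right)

lemma deg_le_mult:
  fixes p q :: "'a::comm_ring_1 mpoly"
  assumes "deg_le a p" "deg_le b q"
  shows "deg_le (a + b) (p * q)"
  unfolding deg_le_def
proof (intro allI impI)
  fix m assume "lookup (p * q) m \<noteq> 0"
  then have "m \<in> keys (p * q)" by (simp add: in_keys_iff)
  then obtain k l where "m = k + l" "k \<in> keys p" "l \<in> keys q"
    using keys_mult[of p q] by auto
  then show "mono_degree m \<le> a + b"
    using assms by (auto simp: deg_le_def in_keys_iff mono_degree_add intro: add_mono)
qed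

text \<open>If two monomials have degrees at most a and b, their product has degree a + b only when
  both bounds are attained.\<close>

lemma hom_component_mult:
  fixes p q :: "'a::comm_ring_1 mpoly"
  assumes "deg_le a p" "deg_le b q"
  shows "hom_component (a + b) (p * q) = hom_component a p * hom_component b q"
proof (rule poly_mapping_eqI)
  fix m
  let ?P = "lookup p" and ?Q = "lookup q"
  let ?K = "keys p" and ?L = "keys q"
  let ?hp = "hom_component a p" and ?hq = "hom_component b q"
  have *: "(mono_degree k = a \<and> mono_degree l = b) \<longleftrightarrow> mono_degree (k + l) = a + b"
    if "k \<in> ?K" "l \<in> ?L" for k l
  proof -
    have "mono_degree k \<le> a" "mono_degree l \<le> b"
      using that assms by (auto simp: deg_le_def in_keys_iff)
    then show ?thesis by (auto simp: mono_degree_add)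
  qed
  have K: "keys ?hp \<subseteq> ?K" "keys ?hq \<subseteq> ?L"
    by (auto simp: in_keys_iff lookup_hom_component split: if_splits)
  have "lookup (?hp * ?hq) m =
      (\<Sum>k\<in>?K. \<Sum>l\<in>keys ?hq.
        if k + l = m then lookup ?hp k * lookup ?hq l else 0)"
    unfolding lookup_mult_keys
    by (rule sum.mono_neutral_left) (use K in \<open>auto simp: in_keys_iff intro!: sum.neutral\<close>)
  also have "\<dots> = (\<Sum>k\<in>?K. \<Sum>l\<in>?L.
        if k + l = m then lookup ?hp k * lookup ?hq l else 0)"
    by (intro sum.cong sum.mono_neutral_left) (use K in \<open>auto simp: in_keys_iff\<close>)
  also have "\<dots> = (\<Sum>k\<in>?K. \<Sum>l\<in>?L.
        if mono_degree m = a + b then if k + l = m then ?P k * ?Q l else 0 else 0)"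
    by (intro sum.cong refl) (use * in \<open>auto simp: lookup_hom_component\<close>)
  also have "\<dots> = lookup (hom_component (a + b) (p * q)) m"
    by (simp add: lookup_hom_component lookup_mult_keys)
  finally show "lookup (hom_component (a + b) (p * q)) m =
      lookup (?hp * ?hq) m" ..
qed

text \<open>The order of \<^type>\<open>poly_mapping\<close> on exponents is the lexicographic one in which the
  variable with the smallest index is the largest.\<close>

definition grless :: "(nat \<Rightarrow>\<^sub>0 nat) \<Rightarrow> (nat \<Rightarrow>\<^sub>0 nat) \<Rightarrow> bool" where
  "grless a b \<longleftrightarrow> mono_degree a < mono_degree b \<or> mono_degree a = mono_degree b \<and> a < b"

definition grle :: "(nat \<Rightarrow>\<^sub>0 nat) \<Rightarrow> (nat \<Rightarrow>\<^sub>0 nat) \<Rightarrow> bool" where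
  "grle a b \<longleftrightarrow> grless a b \<or> a = b"

lemma mono_less_iff:
  fixes a b :: "nat \<Rightarrow>\<^sub>0 nat"
  shows "a < b \<longleftrightarrow> (\<exists>k. lookup a k < lookup b k \<and>
     (\<forall>k'<k. lookup a k' = lookup b k'))"
  by transfer (simp add: less_fun_def)

lemma grless_irrefl [simp]: "\<not> grless a a"
  by (simp add: grless_def)

lemma grle_refl [simp]: "grle a a"
  by (simp add: grle_def)

lemma grless_trans: "grless a b \<Longrightarrow> grless b c \<Longrightarrow> grless a c"
  by (auto simp: grless_def)

lemma grle_trans: "grle a b \<Longrightarrow> grle b c \<Longrightarrow> grle a c"
  by (auto simp: grle_def intro: grless_trans)

lemma grless_grle: "grless a b \<Longrightarrow> grle a b"
  by (simp add: grle_def)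

lemma not_grle: "\<not> grle a b \<longleftrightarrow> grless b a"
  by (auto simp: grle_def grless_def)

lemma grless_add_left: "grless a b \<longleftrightarrow> grless (c + a) (c + b)"
  by (auto simp: grless_def mono_degree_add)

lemma grle_add_left: "grle a b \<longleftrightarrow> grle (c + a) (c + b)"
  unfolding grle_def grless_add_left[of a b c, symmetric] by (simp only: add_left_cancel)

lemma grless_add_right: "grless a b \<longleftrightarrow> grless (a + c) (b + c)"
  unfolding add.commute[of _ c] by (rule grless_add_left)

lemma grle_add_mono: "grle a b \<Longrightarrow> grle c d \<Longrightarrow> grle (a + c) (b + d)"
  using grle_trans[of "a + c" "b + c" "b + d"] grle_add_left[of a b c] grle_add_left[of c d b]
  by (simp only: add.commute[of c])

lemma grle_add_eqD:
  assumes "grle k a" "grle l b" "k + l = a + b"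
  shows "k = a" "l = b"
proof -
  have "\<not> grless k a"
  proof
    assume "grless k a"
    then have "grless (k + l) (a + l)" using grless_add_right by blast
    moreover have "grle (a + l) (a + b)" using assms(2) grle_add_left by blast
    ultimately show False using assms(3) by (auto simp: grle_def dest: grless_trans)
  qed
  then show "k = a" using assms(1) by (simp add: grle_def)
  then show "l = b" using assms(3) by simp
qed

text \<open>The coefficient \<open>c\<close> may vanish, so \<open>a\<close> is only an upper bound for the leading exponent.\<close>

definition lead :: "'a::zero mpoly \<Rightarrow> (nat \<Rightarrow>\<^sub>0 nat) \<Rightarrow> 'a \<Rightarrow> bool" where
  "lead p a c \<longleftrightarrow> (\<forall>m. lookup p m \<noteq> 0 \<longrightarrow> grle m a) \<and> lookup p a = c"

lemma lead_single: "lead (single a c) a c"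
  by (auto simp: lead_def lookup_single when_def)

lemma lead_one: "lead 1 0 1"
  by (metis lead_single single_one)

lemma lead_zero: "lead 0 a 0"
  by (auto simp: lead_def)

lemma lead_add: "lead p a c \<Longrightarrow> lead q a d \<Longrightarrow> lead (p + q) a (c + d)"
  unfolding lead_def lookup_add by (metis add.right_neutral)

lemma lead_uminus: "lead p a c \<Longrightarrow> lead (- p) a (- c :: 'a::ab_group_add)"
  by (auto simp: lead_def)

lemma lead_diff: "lead p a c \<Longrightarrow> lead q a d \<Longrightarrow> lead (p - q) a (c - d :: 'a::ab_group_add)"
  using lead_add[of p a c "- q" "- d"] lead_uminus[of q a d] by simp

lemma lead_sum:
  "(\<And>x. x \<in> A \<Longrightarrow> lead (f x) a (c x)) \<Longrightarrow> lead (\<Sum>x\<in>A. f x) a (\<Sum>x\<in>A. c x)"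
  by (induction A rule: infinite_finite_induct) (auto simp: lead_add lead_zero)

lemma lead_grless: "lead p b c \<Longrightarrow> grless b a \<Longrightarrow> lead p a 0"
  unfolding lead_def using grle_trans[OF _ grless_grle] not_grle[of a b] by blast

lemma lead_mconst_mult: "lead p a d \<Longrightarrow> lead (mconst c * p) a (c * d :: 'a::comm_ring_1)"
  unfolding lead_def lookup_mconst_mult by (metis mult_zero_right)

lemma lead_mult:
  fixes p q :: "'a::comm_ring_1 mpoly"
  assumes "lead p a c" "lead q b d"
  shows "lead (p * q) (a + b) (c * d)"
  unfolding lead_def
proof (intro conjI allI impI)
  fix m assume "lookup (p * q) m \<noteq> 0"
  then have "m \<in> keys (p * q)" by (simp add: in_keys_iff)
  then obtain k l where "m = k + l" "k \<in> keys p" "l \<in> keys q"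
    using keys_mult[of p q] by auto
  moreover from this have "grle k a" "grle l b"
    using assms by (auto simp: lead_def in_keys_iff)
  ultimately show "grle m (a + b)"
    by (simp add: grle_add_mono)
next
  have *: "k + l = a + b \<longleftrightarrow> k = a \<and> l = b"
    if "k \<in> keys p" "l \<in> keys q" for k l
    using that assms grle_add_eqD[of k a l b] by (auto simp: lead_def in_keys_iff)
  have l: "lookup p a = c" "lookup q b = d"
    using assms by (auto simp: lead_def)
  have "lookup (p * q) (a + b) =
      (\<Sum>k\<in>keys p. \<Sum>l\<in>keys q.
        if k = a then if l = b then c * d else 0 else 0)"
    unfolding lookup_mult_keys by (intro sum.cong refl) (auto simp: * l)
  also have "\<dots> = (\<Sum>k\<in>keys p. if k = a then
      (\<Sum>l\<in>keys q. if l = b then c * d else 0) else 0)"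
    by (intro sum.cong refl) auto
  also have "\<dots> = c * d"
    using l by (simp add: sum.delta in_keys_iff)
  finally show "lookup (p * q) (a + b) = c * d" .
qed

lemma lead_prod:
  fixes f :: "'b \<Rightarrow> 'a::comm_ring_1 mpoly"
  assumes "\<And>x. x \<in> A \<Longrightarrow> lead (f x) (a x) (c x)"
  shows "lead (\<Prod>x\<in>A. f x) (\<Sum>x\<in>A. a x) (\<Prod>x\<in>A. c x)"
  using assms by (induction A rule: infinite_finite_induct) (auto simp: lead_one lead_mult)

lemma lead_exists:
  assumes "p \<noteq> 0"
  obtains a where "lead p a (lookup p a)" "lookup p a \<noteq> 0"
proof -
  let ?K = "keys p"
  have ne: "?K \<noteq> {}" using assms by simp
  define D where "D = Max (mono_degree ` ?K)"
  define A where "A = {m \<in> ?K. mono_degree m = D}"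
  have D: "mono_degree m \<le> D" if "m \<in> ?K" for m
    using that by (simp add: D_def)
  have "D \<in> mono_degree ` ?K" unfolding D_def by (rule Max_in) (use ne in auto)
  then have A: "A \<noteq> {}" "finite A" by (auto simp: A_def)
  define a where "a = Max A"
  have "a \<in> A" using A by (simp add: a_def)
  moreover have "grle m a" if "m \<in> ?K" for m
  proof (cases "m \<in> A")
    case True
    then have "m \<le> a" using A by (simp add: a_def)
    with True \<open>a \<in> A\<close> show ?thesis by (auto simp: grle_def grless_def A_def)
  next
    case False
    with that D[OF that] \<open>a \<in> A\<close> show ?thesis by (auto simp: grle_def grless_def A_def)
  qed
  ultimately show thesis
    by (intro that[of a]) (auto simp: lead_def A_def in_keys_iff)
qed

text \<open>Multiplication by the leading term of \<open>p\<close> preserves the order, so the true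
  leading exponent of \<open>q\<close> cannot exceed \<open>b\<close>; if it is smaller,
  \<open>d\<close> is 0. In this way leading terms pass from \<open>pieri_num\<close> to its
  quotient \<open>pieri_op\<close>.\<close>

lemma lead_cancel:
  fixes p q :: "'a::idom mpoly"
  assumes "lead p a u" "u \<noteq> 0" "lead (p * q) (a + b) (u * d)"
  shows "lead q b d"
proof (cases "q = 0")
  case True
  then show ?thesis using assms(2,3) by (auto simp: lead_def)
next
  case False
  then obtain b' where b': "lead q b' (lookup q b')" "lookup q b' \<noteq> 0"
    by (rule lead_exists)
  have l: "lead (p * q) (a + b') (u * lookup q b')"
    using lead_mult[OF assms(1) b'(1)] .
  then have "grle (a + b') (a + b)"
    using assms(2,3) b'(2) by (auto simp: lead_def)
  then have "grle b' b" using grle_add_left by blast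
  show ?thesis
  proof (cases "b' = b")
    case True
    have "u * lookup q b' = u * d"
      using l assms(3) True by (simp add: lead_def)
    with b' True assms(2) show ?thesis by simp
  next
    case False
    with \<open>grle b' b\<close> have *: "grless b' b" by (simp add: grle_def)
    then have "lead (p * q) (a + b) 0"
      using l lead_grless grless_add_left by blast
    then have "d = 0" using assms(2,3) by (simp add: lead_def)
    then show ?thesis using lead_grless[OF b'(1) *] by simp
  qed
qed

lemma lead_deg_le: "lead p a c \<Longrightarrow> deg_le (mono_degree a) p"
  unfolding lead_def deg_le_def grle_def grless_def by (metis less_or_eq_imp_le)

lemma lead_total_degree:
  assumes "lead p a c" "c \<noteq> 0"
  shows "total_degree p = mono_degree a"
proof (rule antisym)
  show "total_degree p \<le> mono_degree a"
    using assms(1) by (simp add: deg_le_total_degree lead_deg_le)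
  have "mono_degree a \<in> mono_degree ` keys p"
    using assms by (auto simp: lead_def in_keys_iff)
  then show "mono_degree a \<le> total_degree p"
    by (simp add: total_degree_def)
qed

lemma deg_le_cancel:
  fixes p q :: "'a::idom mpoly"
  assumes "lead p a u" "u \<noteq> 0" "deg_le (mono_degree a + d) (p * q)"
  shows "deg_le d q"
proof (cases "q = 0")
  case False
  then obtain b where b: "lead q b (lookup q b)" "lookup q b \<noteq> 0"
    by (rule lead_exists)
  have "lead (p * q) (a + b) (u * lookup q b)"
    using lead_mult[OF assms(1) b(1)] .
  then have "lookup (p * q) (a + b) \<noteq> 0"
    using assms(2) b(2) by (simp add: lead_def)
  then have "mono_degree (a + b) \<le> mono_degree a + d"
    using assms(3) by (simp add: deg_le_def)
  then have "mono_degree b \<le> d" by (simp add: mono_degree_add)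
  then show ?thesis using lead_deg_le[OF b(1)] deg_le_mono by blast
qed auto

text \<open>The degree bound and the component are kept together because only the pair is
  multiplicative.\<close>

definition top_part :: "nat \<Rightarrow> 'a::comm_monoid_add mpoly \<Rightarrow> 'a mpoly \<Rightarrow> bool" where
  "top_part d p q \<longleftrightarrow> deg_le d p \<and> hom_component d p = q"

lemma top_part_one: "top_part 0 1 (1::'a::comm_ring_1 mpoly)"
  by (auto simp: top_part_def deg_le_def lookup_one when_def lookup_hom_component
      intro!: poly_mapping_eqI)

lemma top_part_mult:
  "top_part a p p' \<Longrightarrow> top_part b q q' \<Longrightarrow> top_part (a + b) (p * q) (p' * q' :: 'a::comm_ring_1 mpoly)"
  by (auto simp: top_part_def deg_le_mult hom_component_mult)

lemma top_part_power:
  "top_part a p p' \<Longrightarrow> top_part (k * a) (p ^ k) (p' ^ k :: 'a::comm_ring_1 mpoly)"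
  by (induction k) (auto simp: top_part_one top_part_mult)

lemma top_part_prod:
  fixes f g :: "'b \<Rightarrow> 'a::comm_ring_1 mpoly"
  assumes "\<And>x. x \<in> A \<Longrightarrow> top_part (d x) (f x) (g x)"
  shows "top_part (\<Sum>x\<in>A. d x) (\<Prod>x\<in>A. f x) (\<Prod>x\<in>A. g x)"
  using assms by (induction A rule: infinite_finite_induct) (auto simp: top_part_one top_part_mult)

lemma top_part_mvar_diff:
  "top_part 1 (mvar i - mconst c) (mvar i :: 'a::comm_ring_1 mpoly)"
proof -
  have l: "lookup (mvar i - mconst c) m =
      (if m = single i 1 then 1 else 0) - (if m = 0 then c else 0)" for m
    by (simp add: mvar_def lookup_minus lookup_single when_def)
  have z: "mono_degree m = 1 \<Longrightarrow> m \<noteq> 0" for m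
    by auto
  have v: "lookup (mvar i :: 'a mpoly) m = (if m = single i 1 then 1 else 0)" for m
    by (simp add: mvar_def lookup_single when_def)
  have "hom_component 1 (mvar i - mconst c) = mvar i"
    by (rule poly_mapping_eqI) (simp add: lookup_hom_component l v z)
  moreover have "deg_le 1 (mvar i - mconst c)"
    by (auto simp: deg_le_def l split: if_splits)
  ultimately show ?thesis
    by (simp add: top_part_def)
qed

section \<open>Shifts of the variables\<close>

definition shift :: "(nat \<Rightarrow> 'a) \<Rightarrow> 'a::comm_ring_1 mpoly \<Rightarrow> 'a mpoly" where
  "shift c = subst mconst (\<lambda>i. mvar i - mconst (c i))"

lemma shift_morphism: "ring_morphism (shift c)"
  unfolding shift_def by (intro subst_morphism ring_morphism_mconst)

interpretation shift_hom: ring_morphism "shift c" for c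
  by (rule shift_morphism)

text \<open>Each factor z_i - c_i has top part z_i, so by multiplicativity a shifted monomial
  differs from the monomial only in lower degrees.\<close>

lemma top_part_shift:
  fixes f :: "'a::comm_ring_1 mpoly"
  assumes "deg_le d f"
  shows "top_part d (shift c f) (hom_component d f)"
proof -
  let ?\<sigma> = "\<lambda>i. mvar i - mconst (c i)"
  have *: "top_part (mono_degree m) (mono_eval ?\<sigma> m) (single m 1)" for m
  proof -
    have "top_part (\<Sum>i\<in>keys m. lookup m i * 1) (mono_eval ?\<sigma> m)
        (mono_eval mvar m)"
      unfolding mono_eval_def by (intro top_part_prod top_part_power top_part_mvar_diff)
    then show ?thesis
      using single_eq_mono_eval[of m "1::'a"] by (simp add: mono_degree_def)
  qed
  have **: "top_part d (mconst b * mono_eval ?\<sigma> m) (hom_component d (single m b))"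
    if "mono_degree m \<le> d" for m b
  proof (cases "mono_degree m = d")
    case True
    then have "hom_component d (mconst b * mono_eval ?\<sigma> m) = single m b"
      using *[of m] by (simp add: top_part_def hom_component_mconst_mult mult_single)
    also have "\<dots> = hom_component d (single m b)"
      using True by (auto simp: lookup_hom_component lookup_single when_def intro!: poly_mapping_eqI)
    finally show ?thesis
      using *[of m] True by (auto simp: top_part_def intro: deg_le_mconst_mult)
  next
    case False
    with that have lt: "mono_degree m < d" by simp
    have dl: "deg_le (mono_degree m) (mconst b * mono_eval ?\<sigma> m)"
      using *[of m] by (auto simp: top_part_def intro: deg_le_mconst_mult)
    then have "hom_component d (mconst b * mono_eval ?\<sigma> m) = 0"
      using lt by (fastforce simp: lookup_hom_component deg_le_def intro!: poly_mapping_eqI)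
    moreover have "hom_component d (single m b) = 0"
      using lt by (auto simp: lookup_hom_component lookup_single when_def intro!: poly_mapping_eqI)
    ultimately show ?thesis
      using dl lt by (auto simp: top_part_def intro: deg_le_mono)
  qed
  have "deg_le d (shift c f)"
    unfolding shift_def subst_def
    by (intro deg_le_sum) (use ** assms in \<open>auto simp: top_part_def deg_le_def in_keys_iff\<close>)
  moreover have "hom_component d (shift c f) = hom_component d f"
  proof -
    have "hom_component d (shift c f) =
        (\<Sum>m\<in>keys f. hom_component d (single m (lookup f m)))"
      unfolding shift_def subst_def hom_component_sum
      by (intro sum.cong refl) (use ** assms in \<open>auto simp: top_part_def deg_le_def in_keys_iff\<close>)
    also have "\<dots> = hom_component d f"
      unfolding hom_component_sum[symmetric] by (simp add: sum_singles)
    finally show ?thesis .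
  qed
  ultimately show ?thesis by (simp add: top_part_def)
qed

lemma lead_shift:
  fixes f :: "'a::comm_ring_1 mpoly"
  assumes "lead f a b"
  shows "lead (shift c f) a b"
proof -
  define d where "d = mono_degree a"
  have t: "deg_le d (shift c f)" "hom_component d (shift c f) = hom_component d f"
    using top_part_shift[of d f c] lead_deg_le[OF assms] by (auto simp: top_part_def d_def)
  have eq: "lookup (shift c f) m = lookup f m" if "mono_degree m = d" for m
    using arg_cong[OF t(2), of "\<lambda>p. lookup p m"] that
    by (simp add: lookup_hom_component)
  show ?thesis
    unfolding lead_def
  proof (intro conjI allI impI)
    fix m assume m: "lookup (shift c f) m \<noteq> 0"
    then have "mono_degree m \<le> d" using t(1) by (auto simp: deg_le_def)
    then show "grle m a"
      using m eq[of m] assms by (cases "mono_degree m = d") (auto simp: lead_def grle_def grless_def d_def)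
  next
    show "lookup (shift c f) a = b"
      using eq[of a] assms by (auto simp: lead_def d_def)
  qed
qed

lemma lookup_permute_mono:
  assumes "bij \<pi>"
  shows "lookup (permute_mono \<pi> m) (\<pi> i) = lookup m i"
proof -
  have "\<pi> j = \<pi> i \<longleftrightarrow> j = i" for j
    using assms by (auto dest: bij_is_inj injD)
  then show ?thesis
    by (simp add: permute_mono_def lookup_sum lookup_single when_def in_keys_iff)
qed

lemma lookup_permute_vars:
  assumes "bij \<pi>"
  shows "lookup (permute_vars \<pi> p) (permute_mono \<pi> m) = lookup p m"
proof -
  have "permute_mono \<pi> k = permute_mono \<pi> m \<longleftrightarrow> k = m" for k
    by (metis assms lookup_permute_mono poly_mapping_eqI)
  then show ?thesis
    by (simp add: permute_vars_def lookup_sum lookup_single when_def in_keys_iff)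
qed

lemma mono_degree_permute_mono: "mono_degree (permute_mono \<pi> m) = mono_degree m"
  by (simp add: permute_mono_def mono_degree_sum) (simp add: mono_degree_def)

lemma permute_vars_morphism: "ring_morphism (permute_vars \<pi> :: 'a::comm_ring_1 mpoly \<Rightarrow> _)"
proof -
  have "permute_vars \<pi> = (subst mconst (\<lambda>i. mvar (\<pi> i)) :: 'a mpoly \<Rightarrow> _)"
    by (rule ext) (rule permute_vars_subst)
  then show ?thesis by (simp add: subst_morphism ring_morphism_mconst)
qed

interpretation permute_hom: ring_morphism "permute_vars \<pi>" for \<pi>
  by (rule permute_vars_morphism)

section \<open>The difference operators\<close>

lemma mpoly_ring_induct [case_names const var add mult]:
  fixes p :: "'a::comm_ring_1 mpoly"
  assumes const: "\<And>c. P (mconst c)" and var: "\<And>i. P (mvar i)"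
    and add: "\<And>p q. P p \<Longrightarrow> P q \<Longrightarrow> P (p + q)" and mult: "\<And>p q. P p \<Longrightarrow> P q \<Longrightarrow> P (p * q)"
  shows "P p"
proof (induction p rule: mpoly_induct)
  case (single m c)
  have one: "P 1" using const[of 1] by simp
  have pow: "P (mvar i ^ k)" for i k
    by (induction k) (simp_all add: one mult var)
  have "P (\<Prod>i\<in>A. mvar i ^ lookup m i)" for A
    by (induction A rule: infinite_finite_induct) (simp_all add: one mult pow)
  then show ?case
    by (subst single_eq_mono_eval) (simp add: mono_eval_def mult const)
qed (fact add)

lemma mvar_eq_iff [simp]: "mvar i = (mvar j :: 'a::comm_ring_1 mpoly) \<longleftrightarrow> i = j"
proof
  assume "mvar i = (mvar j :: 'a mpoly)"
  then have "eval_mpoly (\<lambda>k. if k = i then 1 else 0) (mvar i :: 'a mpoly) =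
      eval_mpoly (\<lambda>k. if k = i then 1 else 0) (mvar j)" by simp
  then show "i = j"
    by (simp add: eval_mpoly_subst ring_morphism_id split: if_splits)
qed simp

section \<open>Divisibility by differences of variables\<close>

definition identify :: "nat \<Rightarrow> nat \<Rightarrow> 'a::comm_ring_1 mpoly \<Rightarrow> 'a mpoly" where
  "identify i j = subst mconst (mvar(i := mvar j))"

lemma identify_morphism: "ring_morphism (identify i j)"
  unfolding identify_def by (intro subst_morphism ring_morphism_mconst)

lemma identify_mvar: "identify i j (mvar k) = (if k = i then mvar j else mvar k)"
  by (simp add: identify_def ring_morphism_mconst)

text \<open>Modulo \<open>mvar i - mvar j\<close> every polynomial is congruent to its image under
  \<open>identify i j\<close>; the congruence holds for generators and passes to sums and products.
  Over an integral domain the difference therefore behaves like a prime.\<close>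

lemma mvar_diff_dvd_iff:
  fixes p :: "'a::comm_ring_1 mpoly"
  shows "mvar i - mvar j dvd p \<longleftrightarrow> identify i j p = 0"
proof
  interpret ring_morphism "identify i j :: 'a mpoly \<Rightarrow> _" by (rule identify_morphism)
  let ?d = "mvar i - mvar j :: 'a mpoly"
  show "identify i j p = 0" if "?d dvd p"
  proof -
    have "identify i j ?d = 0" by (simp add: map_diff identify_mvar)
    then show ?thesis using map_dvd[OF that] by simp
  qed
  have "?d dvd p - identify i j p"
  proof (induction p rule: mpoly_ring_induct)
    case (const c)
    then show ?case by (simp add: identify_def ring_morphism_mconst)
  next
    case (var k)
    then show ?case by (simp add: identify_mvar)
  next
    case (add p q)
    then have "?d dvd (p - identify i j p) + (q - identify i j q)" by (rule dvd_add)
    then show ?case by (simp add: map_add algebra_simps)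
  next
    case (mult p q)
    then have "?d dvd (p - identify i j p) * q + identify i j p * (q - identify i j q)"
      by (intro dvd_add dvd_mult dvd_mult2)
    then show ?case by (simp add: map_mult algebra_simps)
  qed
  then show "?d dvd p" if "identify i j p = 0"
    using that by simp
qed

text \<open>Each difference is tested by a homomorphism into an integral domain that does not kill
  the other differences, so the squares can be split off one after another.\<close>

lemma prod_mvar_diff_square_dvd:
  fixes N :: "'a::idom mpoly"
  assumes "finite F" "\<And>i j. (i, j) \<in> F \<Longrightarrow> i < j"
    and "\<And>i j. (i, j) \<in> F \<Longrightarrow> (mvar i - mvar j)\<^sup>2 dvd N"
  shows "(\<Prod>(i, j)\<in>F. (mvar i - mvar j)\<^sup>2) dvd N"
  using assms
proof (induction F rule: finite_induct)
  case (insert x F)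
  obtain i j where x: "x = (i, j)" by (cases x)
  interpret ring_morphism "identify i j :: 'a mpoly \<Rightarrow> _" by (rule identify_morphism)
  let ?d = "mvar i - mvar j :: 'a mpoly"
  let ?P = "\<Prod>(i, j)\<in>F. (mvar i - mvar j :: 'a mpoly)\<^sup>2"
  \<comment> \<open>Setting z_i = z_j kills z_k - z_l only if {k, l} = {i, j}. Since all pairs have
    the smaller index first, no remaining pair in \<open>F\<close> is of this kind.\<close>
  have nz: "identify i j ?P \<noteq> 0"
  proof -
    have "identify i j (mvar k - mvar l) \<noteq> (0 :: 'a mpoly)" if "(k, l) \<in> F" for k l
      using insert.prems(1)[of i j] insert.prems(1)[of k l] that insert.hyps(2)
      by (auto simp: map_diff identify_mvar x)
    then show ?thesis
      using \<open>finite F\<close> by (fastforce simp: map_prod map_power split_beta prod_zero_iff)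
  qed
  have cancel: "?d dvd q" if "?d dvd ?P * q" for q
    using that nz by (simp add: mvar_diff_dvd_iff map_mult)
  have "?P dvd N" using insert by auto
  then obtain q where q: "N = ?P * q" by (auto simp: dvd_def)
  have sq: "?d\<^sup>2 dvd ?P * q" using insert.prems(2)[of i j] q by (simp add: x)
  then have "?d dvd ?P * q" by (rule dvd_trans[rotated]) (simp add: power2_eq_square)
  then obtain q' where q': "q = ?d * q'" using cancel by (auto simp: dvd_def)
  have "i < j" using insert.prems(1) by (simp add: x)
  then have "?d \<noteq> 0" by simp
  moreover have "?d * ?d dvd ?d * (?P * q')"
    using sq unfolding q' by (simp only: power2_eq_square mult_ac)
  ultimately have "?d dvd ?P * q'" by (simp only: dvd_mult_cancel_left) simp
  then obtain q'' where q'': "q' = ?d * q''" using cancel by (auto simp: dvd_def)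
  have "N = ?d\<^sup>2 * ?P * q''" unfolding q q' q'' by (simp only: power2_eq_square mult_ac)
  then show ?case using insert.hyps by (simp add: x)
qed simp

section \<open>Operator coefficients with cleared denominators, and their symmetry\<close>

definition same_pairs :: "nat \<Rightarrow> (nat \<times> nat) set" where
  "same_pairs n = {(i, j). i \<in> {1..n} \<and> j \<in> {1..n} \<and> i \<noteq> j \<and> even (i + j)}"

definition cross_pairs :: "nat \<Rightarrow> nat set \<Rightarrow> (nat \<times> nat) set" where
  "cross_pairs n I = {(i, j). i \<in> I \<and> j \<in> {1..n} \<and> j \<notin> I}"

text \<open>Running through ordered pairs, the product is (up to sign) the square of a product of two
  Vandermonde determinants. It is invariant under \<^const>\<open>parity_group\<close>, so no signs occur when
  denominators are cleared.\<close>

definition discr :: "nat \<Rightarrow> (nat \<Rightarrow> 'a) \<Rightarrow> 'a::comm_ring_1" where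
  "discr n x = (\<Prod>(i, j)\<in>same_pairs n. x i - x j)"

definition shift_num :: "nat \<Rightarrow> 'a::comm_ring_1 \<Rightarrow> nat set \<Rightarrow> (nat \<Rightarrow> 'a) \<Rightarrow> 'a" where
  "shift_num n r I x =
     (\<Prod>i\<in>{i \<in> I. even (n + i)}. x i) * (\<Prod>(i, j)\<in>{(i, j) \<in> cross_pairs n I. odd (i + j)}. x i - x j - r)"

text \<open>\<^term>\<open>discr n x\<close> times the coefficient
  \<open>shift_num n r I x / (\<Prod>(i, j). x i - x j)\<close> of the shift by \<open>\<epsilon>\<^sub>I\<close>, where \<open>(i, j)\<close> runs through the
  pairs of \<^term>\<open>cross_pairs n I\<close> of equal parity.\<close>

definition shift_coeff :: "nat \<Rightarrow> 'a::comm_ring_1 \<Rightarrow> nat set \<Rightarrow> (nat \<Rightarrow> 'a) \<Rightarrow> 'a" where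
  "shift_coeff n r I x = shift_num n r I x * (\<Prod>(i, j)\<in>same_pairs n - cross_pairs n I. x i - x j)"

lemma finite_same_pairs [simp]: "finite (same_pairs n)"
  by (rule finite_subset[of _ "{1..n} \<times> {1..n}"]) (auto simp: same_pairs_def)

lemma finite_cross_pairs: "I \<subseteq> {1..n} \<Longrightarrow> finite (cross_pairs n I)"
  by (rule finite_subset[of _ "{1..n} \<times> {1..n}"]) (auto simp: cross_pairs_def)

lemma map_discr: "ring_morphism h \<Longrightarrow> h (discr n x) = discr n (\<lambda>i. h (x i))"
  by (simp add: discr_def ring_morphism.map_prod ring_morphism.map_diff split_beta)

lemma map_shift_coeff:
  "ring_morphism h \<Longrightarrow> h (shift_coeff n r I x) = shift_coeff n (h r) I (\<lambda>i. h (x i))"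
  by (simp add: shift_coeff_def shift_num_def ring_morphism.map_prod ring_morphism.map_diff
      ring_morphism.map_mult split_beta)

lemma parity_groupD:
  assumes "\<pi> \<in> parity_group n"
  shows "bij \<pi>" "\<pi> i \<in> {1..n} \<longleftrightarrow> i \<in> {1..n}" "i \<in> {1..n} \<Longrightarrow> even (\<pi> i) \<longleftrightarrow> even i"
    "\<pi> i = \<pi> j \<longleftrightarrow> i = j"
proof -
  have p: "\<pi> permutes {1..n}" and e: "\<And>i. i \<in> {1..n} \<Longrightarrow> \<pi> i mod 2 = i mod 2"
    using assms by (auto simp: parity_group_def)
  show "bij \<pi>" using p by (rule permutes_bij)
  show "\<pi> i = \<pi> j \<longleftrightarrow> i = j" using permutes_inj[OF p] by (auto dest: injD)
  show "\<pi> i \<in> {1..n} \<longleftrightarrow> i \<in> {1..n}" using p by (rule permutes_in_image)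
  show "even (\<pi> i) \<longleftrightarrow> even i" if "i \<in> {1..n}" using e[OF that] by presburger
qed

lemma bij_betw_of_bij:
  assumes "bij f" "\<And>x. f x \<in> B \<longleftrightarrow> x \<in> A"
  shows "bij_betw f A B"
proof -
  have "f ` A = B"
    using assms by (auto simp: image_iff) (metis bij_pointE)
  then show ?thesis
    using assms(1) bij_betw_subset by blast
qed

lemma bij_map_prod: "bij \<pi> \<Longrightarrow> bij (map_prod \<pi> \<pi>)"
  by (intro bijI prod.inj_map) (auto intro: bij_is_inj simp: bij_is_surj map_prod_surj)

lemma same_pairs_permute:
  assumes "\<pi> \<in> parity_group n"
  shows "map_prod \<pi> \<pi> p \<in> same_pairs n \<longleftrightarrow> p \<in> same_pairs n"
proof -
  note P = parity_groupD[OF assms]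
  obtain i j where p: "p = (i, j)" by (cases p)
  show ?thesis
  proof (cases "i \<in> {1..n} \<and> j \<in> {1..n}")
    case True
    then have "even (\<pi> i) \<longleftrightarrow> even i" "even (\<pi> j) \<longleftrightarrow> even j" using P(3) by blast+
    then show ?thesis
      unfolding p same_pairs_def map_prod_simp mem_Collect_eq prod.case P(2) P(4) even_add by blast
  next
    case False
    then show ?thesis
      unfolding p same_pairs_def map_prod_simp mem_Collect_eq prod.case P(2) by blast
  qed
qed

lemma cross_pairs_permute:
  assumes "\<pi> \<in> parity_group n"
  shows "map_prod \<pi> \<pi> p \<in> cross_pairs n (\<pi> ` I) \<longleftrightarrow> p \<in> cross_pairs n I"
proof -
  note P = parity_groupD[OF assms]
  obtain i j where p: "p = (i, j)" by (cases p)
  have "\<pi> i \<in> \<pi> ` I \<longleftrightarrow> i \<in> I" for i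
    using P(1) by (simp add: bij_is_inj inj_image_mem_iff)
  then show ?thesis
    unfolding p cross_pairs_def map_prod_simp mem_Collect_eq prod.case P(2) by simp
qed

lemma discr_permute:
  assumes "\<pi> \<in> parity_group n"
  shows "discr n (\<lambda>i. x (\<pi> i)) = discr n x"
proof -
  have "bij_betw (map_prod \<pi> \<pi>) (same_pairs n) (same_pairs n)"
    by (rule bij_betw_of_bij[OF bij_map_prod[OF parity_groupD(1)[OF assms]]])
      (rule same_pairs_permute[OF assms])
  from prod.reindex_bij_betw[OF this, of "\<lambda>(i, j). x i - x j"] show ?thesis
    by (simp add: discr_def split_beta)
qed

text \<open>The parity group preserves the parities of n + i and i + j and carries each index set
  for I onto the one for its image. So it only permutes the summands of
  \<open>pieri_num\<close>.\<close>

lemma shift_coeff_permute: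
  assumes "\<pi> \<in> parity_group n" "I \<subseteq> {1..n}"
  shows "shift_coeff n r (\<pi> ` I) x = shift_coeff n r I (\<lambda>i. x (\<pi> i))"
proof -
  note P = parity_groupD[OF assms(1)]
  have mem: "\<pi> i \<in> \<pi> ` I \<longleftrightarrow> i \<in> I" for i
    using P(1) by (simp add: bij_is_inj inj_image_mem_iff)
  have par: "i \<in> I \<Longrightarrow> even (\<pi> i) \<longleftrightarrow> even i" for i using assms(2) P(3) by blast
  have "bij_betw \<pi> {i \<in> I. even (n + i)} {i \<in> \<pi> ` I. even (n + i)}"
    by (rule bij_betw_of_bij[OF P(1)])
      (unfold mem_Collect_eq mem even_add, use par in blast)
  note 1 = prod.reindex_bij_betw[OF this, of x]
  have odd: "odd (\<pi> i + \<pi> j) \<longleftrightarrow> odd (i + j)" if "(i, j) \<in> cross_pairs n I" for i j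
  proof -
    have "i \<in> {1..n}" "j \<in> {1..n}" using that assms(2) by (auto simp: cross_pairs_def)
    then show ?thesis using P(3) by simp
  qed
  have "bij_betw (map_prod \<pi> \<pi>) {(i, j) \<in> cross_pairs n I. odd (i + j)}
      {(i, j) \<in> cross_pairs n (\<pi> ` I). odd (i + j)}"
  proof (rule bij_betw_of_bij[OF bij_map_prod[OF P(1)]])
    fix p :: "nat \<times> nat"
    obtain i j where p: "p = (i, j)" by (cases p)
    show "map_prod \<pi> \<pi> p \<in> {(i, j) \<in> cross_pairs n (\<pi> ` I). odd (i + j)} \<longleftrightarrow>
        p \<in> {(i, j) \<in> cross_pairs n I. odd (i + j)}"
      using cross_pairs_permute[OF assms(1), of "(i, j)" I] odd[of i j]
      unfolding p map_prod_simp mem_Collect_eq prod.case by blast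
  qed
  note 2 = prod.reindex_bij_betw[OF this, of "\<lambda>(i, j). x i - x j - r"]
  have "bij_betw (map_prod \<pi> \<pi>) (same_pairs n - cross_pairs n I)
      (same_pairs n - cross_pairs n (\<pi> ` I))"
    by (rule bij_betw_of_bij[OF bij_map_prod[OF P(1)]])
      (simp only: Diff_iff same_pairs_permute[OF assms(1)] cross_pairs_permute[OF assms(1)])
  note 3 = prod.reindex_bij_betw[OF this, of "\<lambda>(i, j). x i - x j"]
  have c: "(case map_prod \<pi> \<pi> p of (i, j) \<Rightarrow> f i j) = (case p of (i, j) \<Rightarrow> f (\<pi> i) (\<pi> j))"
    for p and f :: "nat \<Rightarrow> nat \<Rightarrow> 'a"
    by (cases p) simp
  show ?thesis
    by (simp only: shift_coeff_def shift_num_def 1[symmetric] 2[symmetric, unfolded c] 3[symmetric, unfolded c])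
qed

definition shift_sets :: "nat \<Rightarrow> nat \<Rightarrow> nat set set" where
  "shift_sets n m =
     {I. I \<subseteq> {1..n} \<and> card {i \<in> I. odd i} = (m + 1) div 2 \<and> card {i \<in> I. even i} = m div 2}"

definition eps :: "nat set \<Rightarrow> nat \<Rightarrow> 'a::comm_ring_1" where
  "eps I i = (if i \<in> I then 1 else 0)"

text \<open>\<open>pieri_op\<close> below is the difference operator \<open>M\<close>, and \<open>pieri_num\<close> is its product
  with \<^const>\<open>discr\<close>.\<close>

definition pieri_num :: "nat \<Rightarrow> 'a::comm_ring_1 \<Rightarrow> nat \<Rightarrow> 'a mpoly \<Rightarrow> 'a mpoly" where
  "pieri_num n r m f =
     (\<Sum>I\<in>shift_sets n m. shift_coeff n (mconst r) I mvar * shift (eps I) f)"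

lemma finite_shift_sets [simp]: "finite (shift_sets n m)"
  by (rule finite_subset[of _ "Pow {1..n}"]) (auto simp: shift_sets_def)

lemma shift_sets_permute:
  assumes "\<pi> \<in> parity_group n" "I \<in> shift_sets n m"
  shows "\<pi> ` I \<in> shift_sets n m"
proof -
  note P = parity_groupD[OF assms(1)]
  have I: "I \<subseteq> {1..n}" using assms(2) by (auto simp: shift_sets_def)
  have e: "{i \<in> \<pi> ` I. odd i} = \<pi> ` {i \<in> I. odd i}" "{i \<in> \<pi> ` I. even i} = \<pi> ` {i \<in> I. even i}"
    using P(3) I by blast+
  have "inj_on \<pi> A" for A using P(4) by (auto simp: inj_on_def)
  then show ?thesis
    using assms(2) P(2) I unfolding shift_sets_def mem_Collect_eq e by (auto simp: card_image simp del: atLeastAtMost_iff)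
qed

lemma parity_group_inv: "\<pi> \<in> parity_group n \<Longrightarrow> inv \<pi> \<in> parity_group n"
  unfolding parity_group_def mem_Collect_eq
  by (metis permutes_inv permutes_in_image permutes_inverses(1))

lemma bij_betw_shift_sets:
  assumes "\<pi> \<in> parity_group n"
  shows "bij_betw ((`) \<pi>) (shift_sets n m) (shift_sets n m)"
proof (rule bij_betw_byWitness[where f' = "(`) (inv \<pi>)"])
  have b: "bij \<pi>" using parity_groupD(1)[OF assms] .
  show "\<forall>I\<in>shift_sets n m. inv \<pi> ` \<pi> ` I = I"
    using b by (simp add: bij_is_inj image_comp)
  show "\<forall>I\<in>shift_sets n m. \<pi> ` inv \<pi> ` I = I"
    using b by (simp add: bij_is_surj image_f_inv_f)
qed (use shift_sets_permute[OF assms] shift_sets_permute[OF parity_group_inv[OF assms]] in auto)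

lemma semisymmetricD:
  "f \<in> semisymmetric n \<Longrightarrow> \<pi> \<in> parity_group n \<Longrightarrow> permute_vars \<pi> f = f"
  "f \<in> semisymmetric n \<Longrightarrow> restrict_vars n f = f"
  by (auto simp: semisymmetric_def poly_ring_iff)

lemma permute_vars_mvar: "permute_vars \<pi> (mvar i) = (mvar (\<pi> i) :: 'a::comm_ring_1 mpoly)"
  by (simp add: permute_vars_subst ring_morphism_mconst)

lemma permute_vars_mconst: "permute_vars \<pi> (mconst c) = (mconst c :: 'a::comm_ring_1 mpoly)"
  by (simp add: permute_vars_subst ring_morphism_mconst)

lemma shift_mvar [simp]: "shift c (mvar i) = mvar i - mconst (c i)"
  by (simp add: shift_def ring_morphism_mconst)

lemma shift_mconst [simp]: "shift c (mconst a) = mconst a"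
  by (simp add: shift_def ring_morphism_mconst)

lemma permute_vars_shift:
  assumes "bij \<pi>"
  shows "permute_vars \<pi> (shift (eps I) f) = shift (eps (\<pi> ` I)) (permute_vars \<pi> f)"
proof -
  have [simp]: "eps (\<pi> ` I) (\<pi> i) = eps I i" for i
    using assms by (auto simp: eps_def bij_is_inj inj_image_mem_iff)
  show ?thesis
    by (rule morphism_eqI[of "\<lambda>f. permute_vars \<pi> (shift (eps I) f)" "\<lambda>f. shift (eps (\<pi> ` I)) (permute_vars \<pi> f)"])
      (simp_all add: ring_morphism_comp permute_vars_morphism shift_morphism permute_vars_mvar
        permute_vars_mconst permute_hom.map_diff)
qed

lemma pieri_num_permute:
  assumes "f \<in> semisymmetric n" "\<pi> \<in> parity_group n"
  shows "permute_vars \<pi> (pieri_num n r m f) = pieri_num n r m f"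
proof -
  have "permute_vars \<pi> (pieri_num n r m f) =
      (\<Sum>I\<in>shift_sets n m. shift_coeff n (mconst r) (\<pi> ` I) mvar * shift (eps (\<pi> ` I)) f)"
    unfolding pieri_num_def permute_hom.map_sum
  proof (rule sum.cong[OF refl])
    fix I assume "I \<in> shift_sets n m"
    then have I: "I \<subseteq> {1..n}" by (auto simp: shift_sets_def)
    show "permute_vars \<pi> (shift_coeff n (mconst r) I mvar * shift (eps I) f) =
        shift_coeff n (mconst r) (\<pi> ` I) mvar * shift (eps (\<pi> ` I)) f"
      by (simp add: permute_hom.map_mult map_shift_coeff[OF permute_vars_morphism] permute_vars_mvar
          permute_vars_mconst shift_coeff_permute[OF assms(2) I] semisymmetricD(1)[OF assms]
          permute_vars_shift[OF parity_groupD(1)[OF assms(2)]])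
  qed
  also have "\<dots> = pieri_num n r m f"
    unfolding pieri_num_def
    by (rule sum.reindex_bij_betw[OF bij_betw_shift_sets[OF assms(2)],
        of "\<lambda>I. shift_coeff n (mconst r) I mvar * shift (eps I) f"])
  finally show ?thesis .
qed

text \<open>At most one of (i, j) and (j, i) is a cross pair, so the other one leaves a factor z_i -
  z_j in every summand. The whole sum is invariant under the transposition of i and j, hence the
  quotient Q by this factor is antisymmetric. Its restriction to z_i = z_j satisfies 2 Q = 0, and a
  second factor splits off. Up to sign, \<open>discr\<close> is the product of these
  squares.\<close>

lemma discr_dvd_pieri_num:
  fixes f :: "'a::{idom, ring_char_0} mpoly"
  assumes "f \<in> semisymmetric n"
  shows "discr n mvar dvd pieri_num n r m f"
proof -
  let ?N = "pieri_num n r m f"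
  define F where "F = {(i, j) \<in> same_pairs n. i < j}"
  have sq: "(mvar i - mvar j)\<^sup>2 dvd ?N" if "(i, j) \<in> F" for i j
  proof -
    let ?d = "mvar i - mvar j :: 'a mpoly"
    have ij: "(i, j) \<in> same_pairs n" "(j, i) \<in> same_pairs n" "i \<noteq> j"
      using that by (auto simp: F_def same_pairs_def)
    have "?d dvd shift_coeff n (mconst r) I mvar" for I
    proof (cases "(i, j) \<in> cross_pairs n I")
      case False
      then show ?thesis
        unfolding shift_coeff_def using ij
        by (intro dvd_mult) (rule dvd_prod_eqI[of _ "(i, j)"], auto)
    next
      case True
      then have "(j, i) \<notin> cross_pairs n I" by (auto simp: cross_pairs_def)
      then have "mvar j - mvar i dvd shift_coeff n (mconst r) I (mvar :: nat \<Rightarrow> 'a mpoly)"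
        unfolding shift_coeff_def using ij
        by (intro dvd_mult) (rule dvd_prod_eqI[of _ "(j, i)"], auto)
      then show ?thesis by (metis minus_diff_eq minus_dvd_iff)
    qed
    then have "?d dvd ?N" unfolding pieri_num_def by (intro dvd_sum dvd_mult2)
    then obtain Q where Q: "?N = ?d * Q" by (auto simp: dvd_def)
    define \<tau> where "\<tau> = transpose i j"
    have \<tau>: "\<tau> \<in> parity_group n"
    proof -
      have r: "i \<in> {1..n}" "j \<in> {1..n}" and "even (i + j)" using ij(1) by (auto simp: same_pairs_def)
      then have "i mod 2 = j mod 2" by presburger
      then have "\<tau> k mod 2 = k mod 2" for k by (simp add: \<tau>_def transpose_def)
      then show ?thesis using permutes_swap_id[OF r] by (simp add: \<tau>_def parity_group_def)
    qed
    have "permute_vars \<tau> ?d = - ?d"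
      by (simp add: permute_hom.map_diff permute_vars_mvar) (simp add: \<tau>_def)
    then have "?d * Q = - ?d * permute_vars \<tau> Q"
      using pieri_num_permute[OF assms \<tau>, of r m] by (simp add: Q permute_hom.map_mult)
    then have "?d * (Q + permute_vars \<tau> Q) = 0" by (simp add: algebra_simps)
    then have "Q + permute_vars \<tau> Q = 0" using ij(3) by simp
    moreover have "identify i j (permute_vars \<tau> Q) = identify i j Q"
      by (rule morphism_eqI[of "\<lambda>Q. identify i j (permute_vars \<tau> Q)"])
        (auto simp: ring_morphism_comp identify_morphism permute_vars_morphism permute_vars_mvar
          permute_vars_mconst identify_mvar \<tau>_def transpose_def)
    ultimately have "identify i j Q + identify i j Q = 0"
      by (metis ring_morphism.map_add[OF identify_morphism] ring_morphism.map_zero[OF identify_morphism])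
    then have "2 * identify i j Q = 0" by (simp only: mult_2)
    then have "identify i j Q = 0" by simp
    then have "?d dvd Q" by (simp add: mvar_diff_dvd_iff)
    then show ?thesis by (auto simp: Q power2_eq_square)
  qed
  have fin: "finite F" by (rule finite_subset[of _ "same_pairs n"]) (auto simp: F_def)
  have "(\<Prod>(i, j)\<in>F. (mvar i - mvar j)\<^sup>2) dvd ?N"
    by (rule prod_mvar_diff_square_dvd[OF fin]) (use sq in \<open>auto simp: F_def\<close>)
  moreover have "discr n mvar = (\<Prod>(i, j)\<in>F. - 1) * (\<Prod>(i, j)\<in>F. (mvar i - mvar j :: 'a mpoly)\<^sup>2)"
  proof -
    have U: "same_pairs n = F \<union> prod.swap ` F"
      by (auto simp: F_def same_pairs_def image_iff)
    have "discr n mvar = (\<Prod>(i, j)\<in>F. mvar i - mvar j) * (\<Prod>(i, j)\<in>prod.swap ` F. mvar i - mvar j :: 'a mpoly)"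
      unfolding discr_def U by (rule prod.union_disjoint) (use fin in \<open>auto simp: F_def\<close>)
    also have "(\<Prod>(i, j)\<in>prod.swap ` F. mvar i - mvar j :: 'a mpoly) = (\<Prod>(i, j)\<in>F. mvar j - mvar i)"
      by (subst prod.reindex) (auto simp: split_beta inj_on_def intro!: prod.cong)
    also have "(\<Prod>(i, j)\<in>F. mvar i - mvar j) * (\<Prod>(i, j)\<in>F. mvar j - mvar i) =
        (\<Prod>(i, j)\<in>F. - 1) * (\<Prod>(i, j)\<in>F. (mvar i - mvar j :: 'a mpoly)\<^sup>2)"
      unfolding split_beta prod.distrib[symmetric]
      by (rule prod.cong[OF refl]) (simp add: power2_eq_square algebra_simps)
    finally show ?thesis .
  qed
  \<comment> \<open>The sign is its own inverse and is moved into the quotient.\<close>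
  moreover have u: "(\<Prod>(i, j)\<in>F. - 1 :: 'a mpoly) * (\<Prod>(i, j)\<in>F. - 1) = 1"
    unfolding split_beta prod.distrib[symmetric] by simp
  ultimately obtain Q where "?N = (\<Prod>(i, j)\<in>F. (mvar i - mvar j)\<^sup>2) * Q"
    and d: "discr n mvar = (\<Prod>(i, j)\<in>F. - 1) * (\<Prod>(i, j)\<in>F. (mvar i - mvar j :: 'a mpoly)\<^sup>2)"
    by (auto simp: dvd_def)
  then have "?N = ((\<Prod>(i, j)\<in>F. - 1) * (\<Prod>(i, j)\<in>F. - 1)) * ((\<Prod>(i, j)\<in>F. (mvar i - mvar j)\<^sup>2) * Q)"
    by (simp only: u mult_1)
  also have "\<dots> = discr n mvar * ((\<Prod>(i, j)\<in>F. - 1) * Q)"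
    unfolding d by (simp only: mult_ac)
  finally show ?thesis by (rule dvdI)
qed

definition pieri_op :: "nat \<Rightarrow> 'a::{idom, ring_char_0} \<Rightarrow> nat \<Rightarrow> 'a mpoly \<Rightarrow> 'a mpoly" where
  "pieri_op n r m f = (SOME g. discr n mvar * g = pieri_num n r m f)"

lemma pieri_op:
  "f \<in> semisymmetric n \<Longrightarrow> discr n mvar * pieri_op n r m f = pieri_num n r m f"
  unfolding pieri_op_def by (rule someI_ex) (use discr_dvd_pieri_num[of f n r m] in \<open>metis dvdE\<close>)

lemma discr_mvar_nonzero: "discr n (mvar :: nat \<Rightarrow> 'a::idom mpoly) \<noteq> 0"
  unfolding discr_def prod_zero_iff[OF finite_same_pairs] by (auto simp: same_pairs_def)

lemma pieri_op_unique:
  assumes "f \<in> semisymmetric n" "discr n mvar * g = pieri_num n r m f"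
  shows "pieri_op n r m f = g"
  using pieri_op[OF assms(1), of r m] assms(2) discr_mvar_nonzero[of n] by (metis mult_left_cancel)

lemma restrict_vars_mvar: "restrict_vars n (mvar i) = (if i \<in> {1..n} then mvar i else 0)"
  by (simp add: restrict_vars_def ring_morphism_mconst)

lemma restrict_vars_mconst: "restrict_vars n (mconst c) = mconst c"
  by (simp add: restrict_vars_def ring_morphism_mconst)

lemma restrict_discr: "restrict_vars n (discr n mvar) = discr n mvar"
  by (simp only: map_discr[OF restrict_vars_morphism])
    (auto simp: discr_def restrict_vars_mvar same_pairs_def intro!: prod.cong)

lemma restrict_shift:
  assumes "I \<subseteq> {1..n}"
  shows "restrict_vars n (shift (eps I) (restrict_vars n f)) = shift (eps I) (restrict_vars n f)"
proof (rule morphism_eqI[of "\<lambda>f. restrict_vars n (shift (eps I) (restrict_vars n f))" "\<lambda>f. shift (eps I) (restrict_vars n f)"])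
  note s = shift_hom.map_zero restrict_hom.map_zero
  show "restrict_vars n (shift (eps I) (restrict_vars n (mvar i))) = shift (eps I) (restrict_vars n (mvar i))" for i
    by (simp add: restrict_vars_mvar restrict_vars_mconst
        restrict_hom.map_diff s)
  show "ring_morphism (\<lambda>f. shift (eps I) (restrict_vars n f))"
    by (rule ring_morphism_comp[OF shift_morphism restrict_vars_morphism])
  then show "ring_morphism (\<lambda>f. restrict_vars n (shift (eps I) (restrict_vars n f)))"
    by (rule ring_morphism_comp[OF restrict_vars_morphism])
qed (simp add: restrict_vars_mconst)

lemma restrict_shift_coeff:
  assumes "I \<subseteq> {1..n}"
  shows "restrict_vars n (shift_coeff n (mconst r) I mvar) = shift_coeff n (mconst r) I mvar"
proof -
  have [simp]: "\<And>i. i \<in> I \<Longrightarrow> Suc 0 \<le> i \<and> i \<le> n" using assms by auto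
  show ?thesis
    by (simp only: map_shift_coeff[OF restrict_vars_morphism])
      (auto simp: shift_coeff_def shift_num_def restrict_vars_mvar restrict_vars_mconst same_pairs_def cross_pairs_def
       intro!: prod.cong arg_cong2[of _ _ _ _ "(*)"])
qed

text \<open>Both invariances follow from uniqueness of the quotient: the transformed polynomial has
  the same product with \<open>discr\<close>, which is itself invariant.\<close>

lemma pieri_op_semisymmetric:
  fixes f :: "'a::{idom, ring_char_0} mpoly"
  assumes "f \<in> semisymmetric n"
  shows "pieri_op n r m f \<in> semisymmetric n"
proof -
  let ?g = "pieri_op n r m f"
  have "permute_vars \<pi> ?g = ?g" if \<pi>: "\<pi> \<in> parity_group n" for \<pi>
  proof (rule pieri_op_unique[OF assms, symmetric])
    have "permute_vars \<pi> (discr n mvar * ?g) = permute_vars \<pi> (pieri_num n r m f)"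
      using pieri_op[OF assms] by simp
    then show "discr n mvar * permute_vars \<pi> ?g = pieri_num n r m f"
      by (simp add: permute_hom.map_mult pieri_num_permute[OF assms \<pi>]
          map_discr[OF permute_vars_morphism] permute_vars_mvar discr_permute[OF \<pi>, where x = mvar])
  qed
  moreover have "restrict_vars n ?g = ?g"
  proof (rule pieri_op_unique[OF assms, symmetric])
    have I: "I \<in> shift_sets n m \<Longrightarrow> I \<subseteq> {1..n}" for I by (auto simp: shift_sets_def)
    have f: "restrict_vars n f = f" by (rule semisymmetricD(2)[OF assms])
    have sh: "restrict_vars n (shift (eps I) f) = shift (eps I) f" if "I \<in> shift_sets n m" for I
      using restrict_shift[OF I[OF that], of f] by (simp only: f)
    have "restrict_vars n (discr n mvar * ?g) = restrict_vars n (pieri_num n r m f)"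
      using pieri_op[OF assms] by simp
    also have "\<dots> = pieri_num n r m f"
      unfolding pieri_num_def restrict_hom.map_sum
      by (rule sum.cong) (simp_all add: restrict_hom.map_mult
          restrict_shift_coeff[OF I] sh)
    finally show "discr n mvar * restrict_vars n ?g = pieri_num n r m f"
      by (simp add: restrict_hom.map_mult restrict_discr)
  qed
  ultimately show ?thesis by (auto simp: semisymmetric_def poly_ring_iff)
qed

section \<open>Evaluation and change of the coefficient ring\<close>

lemma eval_shift: "eval_mpoly x (shift c f) = eval_mpoly (\<lambda>i. x i - c i) f"
  unfolding eval_mpoly_subst shift_def
  by (simp add: subst_comp[OF subst_morphism[OF ring_morphism_id] ring_morphism_mconst]
      ring_morphism_id ring_morphism.map_diff[OF subst_morphism[OF ring_morphism_id]])

lemma eval_morphism: "ring_morphism (eval_mpoly x)"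
  using subst_morphism[OF ring_morphism_id, of x] by (simp add: eval_mpoly_subst[abs_def])

interpretation eval_hom: ring_morphism "eval_mpoly x" for x
  by (rule eval_morphism)

lemma eval_mvar [simp]: "eval_mpoly x (mvar i) = (x i :: 'a::comm_ring_1)"
  by (simp add: eval_mpoly_subst ring_morphism_id)

lemma eval_mconst [simp]: "eval_mpoly x (mconst c) = (c :: 'a::comm_ring_1)"
  by (simp add: eval_mpoly_subst ring_morphism_id)

lemma eval_pieri_num:
  "eval_mpoly x (pieri_num n r m f) =
    (\<Sum>I\<in>shift_sets n m. shift_coeff n r I x * eval_mpoly (\<lambda>i. x i - eps I i) f)"
  by (simp add: pieri_num_def eval_hom.map_sum
      eval_hom.map_mult map_shift_coeff[OF eval_morphism] eval_shift)

text \<open>Free of division and thus valid at every point. Where \<open>discr n x\<close> is 0 it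
  does not determine the value, which later forces the passage to an indeterminate
  parameter.\<close>

lemma eval_pieri_op:
  assumes "f \<in> semisymmetric n"
  shows "discr n x * eval_mpoly x (pieri_op n r m f) =
    (\<Sum>I\<in>shift_sets n m. shift_coeff n r I x * eval_mpoly (\<lambda>i. x i - eps I i) f)"
proof -
  have "discr n x * eval_mpoly x (pieri_op n r m f) =
      eval_mpoly x (discr n mvar * pieri_op n r m f)"
    by (simp add: eval_hom.map_mult map_discr[OF eval_morphism])
  then show ?thesis by (simp add: pieri_op[OF assms] eval_pieri_num)
qed

lemma cmap_mvar [simp]: "ring_morphism h \<Longrightarrow> cmap h (mvar i) = mvar i"
  by (simp add: cmap_def ring_morphism_mconst_comp)

lemma cmap_mconst [simp]: "ring_morphism h \<Longrightarrow> cmap h (mconst c) = mconst (h c)"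
  by (simp add: cmap_def ring_morphism_mconst_comp)

lemma cmap_semisymmetric:
  assumes h: "ring_morphism h" and f: "f \<in> semisymmetric n"
  shows "cmap h f \<in> semisymmetric n"
proof -
  have "permute_vars \<pi> (cmap h f) = cmap h (permute_vars \<pi> f)" for \<pi>
    by (rule morphism_eqI[of "\<lambda>f. permute_vars \<pi> (cmap h f)" "\<lambda>f. cmap h (permute_vars \<pi> f)"])
      (simp_all add: ring_morphism_comp permute_vars_morphism cmap_morphism[OF h] h permute_vars_mvar
        permute_vars_mconst)
  moreover have "restrict_vars n (cmap h f) = cmap h (restrict_vars n f)"
    by (rule morphism_eqI[of "\<lambda>f. restrict_vars n (cmap h f)" "\<lambda>f. cmap h (restrict_vars n f)"])
      (simp_all add: ring_morphism_comp restrict_vars_morphism cmap_morphism[OF h] h restrict_vars_mvar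
        restrict_vars_mconst ring_morphism.map_zero[OF cmap_morphism[OF h]])
  ultimately show ?thesis
    using semisymmetricD[OF f] by (auto simp: semisymmetric_def poly_ring_iff)
qed

text \<open>Used to specialise the operator with indeterminate parameter to the one with parameter
  \<open>r\<close>; uniqueness of the quotient gives it.\<close>

lemma cmap_pieri_op:
  assumes h: "ring_morphism h" and f: "f \<in> semisymmetric n"
  shows "cmap h (pieri_op n r m f) = pieri_op n (h r) m (cmap h f)"
proof (rule pieri_op_unique[OF cmap_semisymmetric[OF h f], symmetric])
  note c = cmap_morphism[OF h]
  have sh: "cmap h (shift (eps I) f) = shift (eps I) (cmap h f)" for I
    by (rule morphism_eqI[of "\<lambda>f. cmap h (shift (eps I) f)" "\<lambda>f. shift (eps I) (cmap h f)"])
      (simp_all add: ring_morphism_comp shift_morphism c h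
        ring_morphism.map_diff[OF c] eps_def ring_morphism.map_one[OF h] ring_morphism.map_zero[OF h]
        ring_morphism.map_one[OF c] ring_morphism.map_zero[OF c])
  have "cmap h (discr n mvar * pieri_op n r m f) = cmap h (pieri_num n r m f)"
    using pieri_op[OF f] by simp
  then show "discr n mvar * cmap h (pieri_op n r m f) = pieri_num n (h r) m (cmap h f)"
    by (simp add: pieri_num_def ring_morphism.map_sum[OF c] ring_morphism.map_mult[OF c]
        map_discr[OF c] map_shift_coeff[OF c] h sh)
qed

section \<open>Leading terms of the difference operators\<close>

text \<open>The integer form of \<open>alt_tail\<close>. It may be negative outside
  \<open>Lam n\<close>, notably for the indicator functions \<open>ind I\<close> to which it is
  applied.\<close>

definition asum :: "nat \<Rightarrow> (nat \<Rightarrow> nat) \<Rightarrow> nat \<Rightarrow> int" where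
  "asum n l k = (\<Sum>j=k..n. (-1) ^ (j - k) * int (l j))"

lemma asum_rec: "k \<le> n \<Longrightarrow> asum n l k = int (l k) - asum n l (Suc k)"
proof -
  assume "k \<le> n"
  then have "asum n l k = int (l k) + (\<Sum>j=Suc k..n. (-1) ^ (j - k) * int (l j))"
    by (simp add: asum_def sum.atLeast_Suc_atMost)
  also have "(\<Sum>j=Suc k..n. (-1) ^ (j - k) * int (l j)) = - asum n l (Suc k)"
    unfolding asum_def sum_negf[symmetric]
  proof (rule sum.cong[OF refl])
    fix j assume "j \<in> {Suc k..n}"
    then have "j - k = Suc (j - Suc k)" by auto
    then show "(-1) ^ (j - k) * int (l j) = - ((-1) ^ (j - Suc k) * int (l j))" by simp
  qed
  finally show ?thesis by simp
qed

lemma asum_beyond: "n < k \<Longrightarrow> asum n l k = 0"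
  by (simp add: asum_def)

lemma asum_cong: "(\<And>j. k \<le> j \<Longrightarrow> j \<le> n \<Longrightarrow> l j = l' j) \<Longrightarrow> asum n l k = asum n l' k"
  unfolding asum_def by (rule sum.cong) auto

lemma asum_add: "asum n (\<lambda>j. l j + l' j) k = asum n l k + asum n l' k"
  by (simp add: asum_def algebra_simps sum.distrib)

lemma asum_column:
  assumes "1 \<le> k" "m \<le> n"
  shows "asum n (column m) k = (if k \<le> m \<and> even (m - k) then 1 else 0)"
proof (cases "k \<le> n")
  case True
  from \<open>k \<le> n\<close> show ?thesis
  proof (induction rule: inc_induct)
    case base
    have "asum n (column m) n = int (column m n)"
      by (simp add: asum_rec asum_beyond)
    then show ?case using assms True by (simp add: column_def)
  next
    case (step j)
    have j: "asum n (column m) j = int (column m j) - asum n (column m) (Suc j)"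
      using step by (intro asum_rec) simp
    have c: "column m j = (if j \<le> m then 1 else 0)"
      using step assms by (simp add: column_def)
    show ?case
    proof (cases "j < m")
      case True
      then have "m - j = Suc (m - Suc j)" by simp
      then show ?thesis
        using True step assms by (simp add: j c)
    next
      case False
      then show ?thesis using step assms by (simp add: j c)
    qed
  qed
qed (use assms in \<open>simp add: asum_beyond\<close>)

lemma asum_eq_sum_Suc:
  "(\<Sum>j\<in>{1..n}. if k < j then (-1) ^ (k + j) * int (l j) else 0) = - asum n l (Suc k)"
proof -
  have "(\<Sum>j\<in>{1..n}. if k < j then (-1) ^ (k + j) * int (l j) else 0) =
      (\<Sum>j\<in>{1..n} \<inter> {j. k < j}. (-1) ^ (k + j) * int (l j))"
    by (subst sum.inter_restrict) simp_all
  also have "{1..n} \<inter> {j. k < j} = {Suc k..n}" by auto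
  also have "(\<Sum>j\<in>{Suc k..n}. (-1) ^ (k + j) * int (l j)) = - asum n l (Suc k)"
    unfolding asum_def sum_negf[symmetric]
  proof (rule sum.cong[OF refl])
    fix j assume "j \<in> {Suc k..n}"
    then have "k + j = Suc (2 * k + (j - Suc k))" by auto
    then have "(-1 :: int) ^ (k + j) = - ((-1) ^ (j - Suc k))"
      by (simp only: power_Suc power_add power_mult) simp
    then show "(-1) ^ (k + j) * int (l j) = - ((-1) ^ (j - Suc k) * int (l j))" by simp
  qed
  finally show ?thesis .
qed

definition ind :: "nat set \<Rightarrow> nat \<Rightarrow> nat" where
  "ind I j = (if j \<in> I then 1 else 0)"

lemma ind_atLeastAtMost: "ind {1..m} = column m"
  by (auto simp: ind_def column_def)

lemma cross_pairs_sum: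
  fixes f :: "nat \<Rightarrow> nat \<Rightarrow> 'a::comm_monoid_add"
  shows "(\<Sum>(i, j)\<in>cross_pairs n I. f i j) = (\<Sum>i\<in>I. \<Sum>j\<in>{1..n} - I. f i j)"
proof -
  have "cross_pairs n I = I \<times> ({1..n} - I)" by (auto simp: cross_pairs_def)
  then show ?thesis by (simp add: sum.cartesian_product)
qed

text \<open>The leading variable of z_i - z_j has index \<open>min i j\<close>, and the sign (-1)^(i
  + j) is 1 for denominators and -1 for numerators. So the cross pairs add minus this sum to the
  exponent of z_k in a_I. The first term on the right is compensated by the factors z_i with i
  congruent to n, which leaves a signed tail sum.\<close>

lemma cross_pairs_min_sum:
  assumes I: "I \<subseteq> {1..n}" and k: "k \<in> {1..n}"
  shows "(\<Sum>(i, j)\<in>cross_pairs n I. if min i j = k then (-1) ^ (i + j) else (0::int)) =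
    (if k \<in> I \<and> even (n + k) then 1 else 0) - (if k \<in> I then 1 else -1) * asum n (ind I) k"
proof -
  have fin: "finite I" using I finite_subset by blast
  have rec: "asum n (ind I) k = int (ind I k) - asum n (ind I) (Suc k)"
    using k by (intro asum_rec) simp
  show ?thesis
  proof (cases "k \<in> I")
    case True
    have "(\<Sum>(i, j)\<in>cross_pairs n I. if min i j = k then (-1) ^ (i + j) else (0::int)) =
        (\<Sum>i\<in>I. if i = k then (\<Sum>j\<in>{1..n} - I. if k < j then (-1) ^ (k + j) else 0) else 0)"
      unfolding cross_pairs_sum
    proof (rule sum.cong[OF refl])
      fix i assume "i \<in> I"
      show "(\<Sum>j\<in>{1..n} - I. if min i j = k then (-1) ^ (i + j) else (0::int)) =
          (if i = k then \<Sum>j\<in>{1..n} - I. if k < j then (-1) ^ (k + j) else 0 else 0)"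
      proof (cases "i = k")
        case i: True
        have m: "min k j = k \<longleftrightarrow> k < j" if "j \<in> {1..n} - I" for j
          using that True by (cases "j = k") (auto simp: min_def)
        have "(\<Sum>j\<in>{1..n} - I. if min k j = k then (-1) ^ (k + j) else (0::int)) =
            (\<Sum>j\<in>{1..n} - I. if k < j then (-1) ^ (k + j) else 0)"
          by (rule sum.cong[OF refl]) (simp only: m)
        then show ?thesis by (simp only: i refl if_True)
      next
        case False
        have "min i j \<noteq> k" if "j \<in> {1..n} - I" for j
          using that True False by (auto simp: min_def)
        then show ?thesis using False by simp
      qed
    qed
    also have "\<dots> = (\<Sum>j\<in>{1..n} - I. if k < j then (-1) ^ (k + j) else 0)"
      using True fin by simp
    also have "\<dots> = (\<Sum>j\<in>{1..n}. if k < j then (-1) ^ (k + j) else 0) -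
        (\<Sum>j\<in>I. if k < j then (-1) ^ (k + j) else 0)"
      using I by (intro sum_diff) auto
    \<comment> \<open>\<open>column n\<close> is constantly 1 on \<open>{1..n}\<close>, so that
      \<open>asum_column\<close> evaluates the sum over all indices.\<close>
    also have "(\<Sum>j\<in>{1..n}. if k < j then (-1) ^ (k + j) else 0) = - asum n (column n) (Suc k)"
      unfolding asum_eq_sum_Suc[symmetric] by (rule sum.cong) (auto simp: column_def)
    also have "(\<Sum>j\<in>I. if k < j then (-1) ^ (k + j) else 0) = - asum n (ind I) (Suc k)"
      unfolding asum_eq_sum_Suc[symmetric]
      by (rule sum.mono_neutral_cong_left) (use I in \<open>auto simp: ind_def\<close>)
    also have "asum n (column n) (Suc k) = (if even (n + k) then 0 else 1)"
      using k by (simp add: asum_column) (auto elim!: le_SucE simp: le_less Suc_le_eq)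
    moreover have "ind I k = 1" using True by (simp add: ind_def)
    ultimately show ?thesis using True rec by simp
  next
    case False
    have "(\<Sum>(i, j)\<in>cross_pairs n I. if min i j = k then (-1) ^ (i + j) else (0::int)) =
        (\<Sum>i\<in>I. if k < i then (-1) ^ (k + i) else 0)"
      unfolding cross_pairs_sum
    proof (rule sum.cong[OF refl])
      fix i assume i: "i \<in> I"
      then have "i \<noteq> k" using False by auto
      then have "min i j = k \<longleftrightarrow> j = k \<and> k < i" for j
        using i by (auto simp: min_def)
      then have "(\<Sum>j\<in>{1..n} - I. if min i j = k then (-1) ^ (i + j) else (0::int)) =
          (\<Sum>j\<in>{1..n} - I. if j = k then (if k < i then (-1) ^ (k + i) else 0) else 0)"
        by (intro sum.cong) (auto simp: add.commute)
      also have "\<dots> = (if k < i then (-1) ^ (k + i) else 0)"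
        using False k by simp
      finally show "(\<Sum>j\<in>{1..n} - I. if min i j = k then (-1) ^ (i + j) else (0::int)) =
          (if k < i then (-1) ^ (k + i) else 0)" .
    qed
    also have "\<dots> = - asum n (ind I) (Suc k)"
      unfolding asum_eq_sum_Suc[symmetric]
      by (rule sum.mono_neutral_cong_left) (use I in \<open>auto simp: ind_def\<close>)
    moreover have "ind I k = 0" using False by (simp add: ind_def)
    ultimately show ?thesis using False rec by simp
  qed
qed

lemma shift_setsD:
  assumes "I \<in> shift_sets n m"
  shows "I \<subseteq> {1..n}" "finite I" "card I = m" "(\<Sum>i\<in>I. (-1::int) ^ i) = int (m div 2) - int ((m + 1) div 2)"
proof -
  show I: "I \<subseteq> {1..n}" using assms by (auto simp: shift_sets_def)
  then show fin: "finite I" by (rule finite_subset) simp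
  have c: "card {i \<in> I. odd i} = (m + 1) div 2" "card {i \<in> I. even i} = m div 2"
    using assms by (auto simp: shift_sets_def)
  have I2: "I = {i \<in> I. odd i} \<union> {i \<in> I. even i}" by auto
  have "card I = card {i \<in> I. odd i} + card {i \<in> I. even i}"
    by (subst I2, rule card_Un_disjoint) (use fin in auto)
  then show "card I = m" unfolding c by presburger
  have "(\<Sum>i\<in>I. (-1::int) ^ i) = (\<Sum>i\<in>{i \<in> I. odd i}. (-1) ^ i) + (\<Sum>i\<in>{i \<in> I. even i}. (-1) ^ i)"
    by (subst I2, rule sum.union_disjoint) (use fin in auto)
  also have "(\<Sum>i\<in>{i \<in> I. odd i}. (-1::int) ^ i) = (\<Sum>i\<in>{i \<in> I. odd i}. -1)"
    by (rule sum.cong) auto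
  also have "(\<Sum>i\<in>{i \<in> I. even i}. (-1::int) ^ i) = (\<Sum>i\<in>{i \<in> I. even i}. 1)"
    by (rule sum.cong) auto
  finally show "(\<Sum>i\<in>I. (-1::int) ^ i) = int (m div 2) - int ((m + 1) div 2)"
    by (simp add: c del: sum_constant add: sum_constant)
qed

lemma sum_alternating: "(\<Sum>i\<in>{1..n}. (-1::int) ^ i) = (if odd n then -1 else 0)"
  by (induction n) auto

lemma initial_in_shift_sets:
  assumes "m \<le> n"
  shows "{1..m} \<in> shift_sets n m"
proof -
  have "card {i \<in> {1..m}. odd i} = (m + 1) div 2 \<and> card {i \<in> {1..m}. even i} = m div 2"
  proof (induction m)
    case (Suc m)
    have "{i \<in> {1..Suc m}. odd i} = (if even m then insert (Suc m) {i \<in> {1..m}. odd i} else {i \<in> {1..m}. odd i})"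
      "{i \<in> {1..Suc m}. even i} = (if even m then {i \<in> {1..m}. even i} else insert (Suc m) {i \<in> {1..m}. even i})"
      by (auto simp: le_Suc_eq)
    with Suc show ?case by auto
  qed simp
  with assms show ?thesis by (auto simp: shift_sets_def)
qed

text \<open>At index 1 the tail sum sees only the numbers of odd and even elements of
  \<open>I\<close>, so it is the same for all members of \<open>shift_sets n m\<close>.\<close>

lemma asum_ind_one:
  assumes "I \<subseteq> {1..n}"
  shows "asum n (ind I) 1 = - (\<Sum>i\<in>I. (-1::int) ^ i)"
proof -
  have "asum n (ind I) 1 = - (\<Sum>j\<in>{1..n}. if 0 < j then (-1) ^ (0 + j) * int (ind I j) else 0)"
    using asum_eq_sum_Suc[of 0 "ind I" n] by simp
  also have "(\<Sum>j\<in>{1..n}. if 0 < j then (-1) ^ (0 + j) * int (ind I j) else 0) = (\<Sum>i\<in>I. (-1::int) ^ i)"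
    by (rule sum.mono_neutral_cong_right) (use assms in \<open>auto simp: ind_def\<close>)
  finally show ?thesis .
qed

section \<open>Leading exponents and signs of the coefficients\<close>

definition sgn_lt :: "nat \<Rightarrow> nat \<Rightarrow> 'a::comm_ring_1" where
  "sgn_lt i j = (if i < j then 1 else -1)"

definition pair_exp :: "nat \<times> nat \<Rightarrow> (nat \<Rightarrow>\<^sub>0 nat)" where
  "pair_exp p = single (min (fst p) (snd p)) 1"

lemma lead_mvar: "lead (mvar i) (single i 1) 1"
  unfolding mvar_def by (rule lead_single)

lemma grless_single: "i < j \<Longrightarrow> grless (single j 1) (single i 1)"
  unfolding grless_def mono_less_iff
  by (auto simp: lookup_single when_def intro!: exI[of _ i])

lemma lead_mvar_diff:
  assumes "i \<noteq> j"
  shows "lead (mvar i - mvar j - mconst r) (pair_exp (i, j)) (sgn_lt i j :: 'a::comm_ring_1)"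
proof -
  have r: "lead (mconst r) (single k 1) 0" for k and r :: 'a
    by (rule lead_grless[OF lead_single]) (simp add: grless_def)
  show ?thesis
  proof (cases "i < j")
    case True
    have "lead (mvar i - mvar j - mconst r) (single i 1) (1 - 0 - 0)"
      by (intro lead_diff lead_mvar r lead_grless[OF lead_mvar grless_single[OF True]])
    with True show ?thesis by (simp add: pair_exp_def sgn_lt_def)
  next
    case False
    with assms have lt: "j < i" by simp
    have "lead (mvar i - mvar j - mconst r) (single j 1) (0 - 1 - 0)"
      by (intro lead_diff lead_mvar r lead_grless[OF lead_mvar grless_single[OF lt]])
    with lt show ?thesis by (simp add: pair_exp_def sgn_lt_def)
  qed
qed

lemma lead_mvar_diff0:
  assumes "i \<noteq> j"
  shows "lead (mvar i - mvar j) (pair_exp (i, j)) (sgn_lt i j :: 'a::comm_ring_1)"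
  using lead_mvar_diff[OF assms, of 0] by simp

definition discr_exp :: "nat \<Rightarrow> (nat \<Rightarrow>\<^sub>0 nat)" where
  "discr_exp n = (\<Sum>p\<in>same_pairs n. pair_exp p)"

definition discr_sgn :: "nat \<Rightarrow> 'a::comm_ring_1" where
  "discr_sgn n = (\<Prod>(i, j)\<in>same_pairs n. sgn_lt i j)"

lemma lead_discr: "lead (discr n mvar) (discr_exp n) (discr_sgn n)"
  unfolding discr_def discr_exp_def discr_sgn_def
  by (rule lead_prod) (auto simp: same_pairs_def intro: lead_mvar_diff0)

lemma discr_sgn_nonzero: "discr_sgn n \<noteq> (0 :: 'a::idom)"
  unfolding discr_sgn_def prod_zero_iff[OF finite_same_pairs] by (auto simp: sgn_lt_def split: if_splits)

definition shift_exp :: "nat \<Rightarrow> nat set \<Rightarrow> (nat \<Rightarrow>\<^sub>0 nat)" where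
  "shift_exp n I = (\<Sum>i\<in>{i \<in> I. even (n + i)}. single i 1) +
     (\<Sum>p\<in>{(i, j) \<in> cross_pairs n I. odd (i + j)}. pair_exp p) +
     (\<Sum>p\<in>same_pairs n - cross_pairs n I. pair_exp p)"

definition shift_sgn :: "nat \<Rightarrow> nat set \<Rightarrow> 'a::comm_ring_1" where
  "shift_sgn n I = (\<Prod>(i, j)\<in>{(i, j) \<in> cross_pairs n I. odd (i + j)}. sgn_lt i j) *
     (\<Prod>(i, j)\<in>same_pairs n - cross_pairs n I. sgn_lt i j)"

lemma lead_shift_coeff:
  "lead (shift_coeff n (mconst r) I mvar) (shift_exp n I) (shift_sgn n I :: 'a::comm_ring_1)"
proof -
  have "lead (\<Prod>i\<in>{i \<in> I. even (n + i)}. mvar i) (\<Sum>i\<in>{i \<in> I. even (n + i)}. single i 1)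
      (\<Prod>i\<in>{i \<in> I. even (n + i)}. 1 :: 'a)"
    by (intro lead_prod lead_mvar)
  moreover have "lead (\<Prod>(i, j)\<in>{(i, j) \<in> cross_pairs n I. odd (i + j)}. mvar i - mvar j - mconst r)
      (\<Sum>p\<in>{(i, j) \<in> cross_pairs n I. odd (i + j)}. pair_exp p)
      (\<Prod>(i, j)\<in>{(i, j) \<in> cross_pairs n I. odd (i + j)}. sgn_lt i j :: 'a)"
    by (rule lead_prod) (auto simp: cross_pairs_def intro: lead_mvar_diff)
  moreover have "lead (\<Prod>(i, j)\<in>same_pairs n - cross_pairs n I. mvar i - mvar j)
      (\<Sum>p\<in>same_pairs n - cross_pairs n I. pair_exp p)
      (\<Prod>(i, j)\<in>same_pairs n - cross_pairs n I. sgn_lt i j :: 'a)"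
    by (rule lead_prod) (auto simp: same_pairs_def intro: lead_mvar_diff0)
  ultimately have "lead (shift_coeff n (mconst r) I mvar) (shift_exp n I) (1 *
      (\<Prod>(i, j)\<in>{(i, j) \<in> cross_pairs n I. odd (i + j)}. sgn_lt i j) *
      (\<Prod>(i, j)\<in>same_pairs n - cross_pairs n I. sgn_lt i j))"
    unfolding shift_coeff_def shift_num_def shift_exp_def by (intro lead_mult) simp_all
  then show ?thesis by (simp add: shift_sgn_def)
qed

text \<open>Compared with \<open>discr_exp\<close>, the cross pairs of equal parity are removed and
  those of opposite parity are added, which one sign -(-1)^(i + j) records. The functional
  \<open>g\<close> is arbitrary because both the exponent of a variable and the degree are needed;
  integer values make room for the subtraction.\<close>

lemma shift_exp_additive:
  fixes g :: "(nat \<Rightarrow>\<^sub>0 nat) \<Rightarrow> int"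
  assumes I: "I \<subseteq> {1..n}" and g0: "g 0 = 0" and g: "\<And>a b. g (a + b) = g a + g b"
  shows "g (shift_exp n I) = g (discr_exp n) +
    (\<Sum>i\<in>{i \<in> I. even (n + i)}. g (single i 1)) -
    (\<Sum>(i, j)\<in>cross_pairs n I. (-1) ^ (i + j) * g (pair_exp (i, j)))"
proof -
  have gsum: "g (sum f A) = (\<Sum>x\<in>A. g (f x))" for f :: "'x \<Rightarrow> _" and A
    by (induction A rule: infinite_finite_induct) (auto simp: g0 g)
  let ?C = "cross_pairs n I"
  let ?O = "{(i, j) \<in> ?C. odd (i + j)}" and ?E = "{(i, j) \<in> ?C. even (i + j)}"
  have fin: "finite ?C" using I by (rule finite_cross_pairs)
  have CE: "same_pairs n - ?C = same_pairs n - ?E" "?E \<subseteq> same_pairs n"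
    using I by (auto simp: same_pairs_def cross_pairs_def)
  have "(\<Sum>(i, j)\<in>?C. (-1) ^ (i + j) * g (pair_exp (i, j))) =
      (\<Sum>(i, j)\<in>?O. (-1) ^ (i + j) * g (pair_exp (i, j))) + (\<Sum>(i, j)\<in>?E. (-1) ^ (i + j) * g (pair_exp (i, j)))"
    by (subst sum.union_disjoint[symmetric]) (use fin in \<open>auto intro!: sum.cong intro: finite_subset[OF _ fin]\<close>)
  also have "(\<Sum>(i, j)\<in>?O. (-1) ^ (i + j) * g (pair_exp (i, j))) = - (\<Sum>p\<in>?O. g (pair_exp p))"
    unfolding sum_negf[symmetric] by (rule sum.cong) auto
  also have "(\<Sum>(i, j)\<in>?E. (-1) ^ (i + j) * g (pair_exp (i, j))) = (\<Sum>p\<in>?E. g (pair_exp p))"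
    by (rule sum.cong) auto
  finally have *: "(\<Sum>(i, j)\<in>?C. (-1) ^ (i + j) * g (pair_exp (i, j))) =
      (\<Sum>p\<in>?E. g (pair_exp p)) - (\<Sum>p\<in>?O. g (pair_exp p))" by simp
  have "(\<Sum>p\<in>same_pairs n - ?C. g (pair_exp p)) =
      (\<Sum>p\<in>same_pairs n. g (pair_exp p)) - (\<Sum>p\<in>?E. g (pair_exp p))"
    unfolding CE(1) using CE(2) by (intro sum_diff) auto
  then show ?thesis
    unfolding * by (simp add: shift_exp_def discr_exp_def g gsum)
qed

lemma lookup_alt_mono:
  "lookup (alt_mono n l) k = (if k \<in> {1..n} then alt_tail n l k else 0)"
  by (auto simp: alt_mono_def lookup_sum lookup_single when_def)

lemma alt_tail_asum: "alt_tail n l k = nat (asum n l k)"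
  by (simp add: alt_tail_def asum_def)

lemma lookup_alt_mono_column:
  assumes "m \<le> n" "k \<in> {1..n}"
  shows "int (lookup (alt_mono n (column m)) k) = asum n (column m) k"
proof -
  have "0 \<le> asum n (column m) k" using assms by (simp add: asum_column)
  then show ?thesis using assms(2) by (simp add: lookup_alt_mono alt_tail_asum)
qed

text \<open>The last term is the exponent of z_k in the leading term of the rational coefficient
  a_I; it may be negative.\<close>

lemma lookup_shift_exp:
  assumes "I \<subseteq> {1..n}" "k \<in> {1..n}"
  shows "int (lookup (shift_exp n I) k) =
    int (lookup (discr_exp n) k) + (if k \<in> I then 1 else -1) * asum n (ind I) k"
proof -
  have fin: "finite I" using assms(1) finite_subset by blast
  have "(\<Sum>i\<in>{i \<in> I. even (n + i)}. int (lookup (single i 1) k)) =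
      (\<Sum>i\<in>{i \<in> I. even (n + i)}. if i = k then 1 else 0)"
    by (rule sum.cong) (auto simp: lookup_single when_def)
  also have "\<dots> = (if k \<in> I \<and> even (n + k) then 1 else 0)" using fin by simp
  finally have 1: "(\<Sum>i\<in>{i \<in> I. even (n + i)}. int (lookup (single i 1) k)) =
      (if k \<in> I \<and> even (n + k) then 1 else 0)" .
  have "(\<Sum>(i, j)\<in>cross_pairs n I. (-1) ^ (i + j) * int (lookup (pair_exp (i, j)) k)) =
      (\<Sum>(i, j)\<in>cross_pairs n I. if min i j = k then (-1) ^ (i + j) else 0)"
    by (rule sum.cong) (auto simp: pair_exp_def lookup_single when_def)
  with 1 cross_pairs_min_sum[OF assms] shift_exp_additive[OF assms(1), of "\<lambda>a. int (lookup a k)"]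
  show ?thesis by (simp add: lookup_add)
qed

lemma lookup_exp_outside:
  assumes "I \<subseteq> {1..n}" "k \<notin> {1..n}"
  shows "lookup (shift_exp n I) k = 0" "lookup (discr_exp n) k = 0"
proof -
  have 1: "i \<noteq> k" if "i \<in> I" for i using assms that by blast
  have 2: "min i j \<noteq> k" if "i \<in> {1..n}" "j \<in> {1..n}" for i j using assms(2) that by (auto simp: min_def)
  show "lookup (discr_exp n) k = 0"
    using 2 by (auto simp: discr_exp_def lookup_sum pair_exp_def lookup_single when_def same_pairs_def intro!: sum.neutral)
  have "I \<subseteq> {1..n}" by fact
  then show "lookup (shift_exp n I) k = 0"
    using 1 2 by (auto simp: shift_exp_def lookup_add lookup_sum pair_exp_def lookup_single when_def
        same_pairs_def cross_pairs_def subset_iff intro!: sum.neutral)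
qed

lemma mono_degree_alt_mono_column:
  assumes "m \<le> n"
  shows "mono_degree (alt_mono n (column m)) = (m + 1) div 2"
proof -
  have "mono_degree (alt_mono n (column m)) = (\<Sum>i\<in>{1..n}. alt_tail n (column m) i)"
    by (simp add: alt_mono_def mono_degree_sum)
  also have "\<dots> = (\<Sum>i\<in>{1..n}. if i \<le> m \<and> even (m - i) then 1 else 0)"
    by (rule sum.cong) (use assms in \<open>auto simp: alt_tail_asum asum_column\<close>)
  also have "\<dots> = (\<Sum>i\<in>{1..m}. if even (m - i) then 1 else 0)"
    by (rule sum.mono_neutral_cong_right) (use assms in auto)
  also have "\<dots> = (m + 1) div 2"
  proof (induction m rule: nat_less_induct)
    case (1 m)
    show ?case
    proof (cases "m < 2")
      case True
      then show ?thesis by (cases m) (auto simp: less_Suc_eq)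
    next
      case False
      then obtain k where m: "m = Suc (Suc k)" by (metis add_2_eq_Suc le_Suc_ex not_less)
      have "(\<Sum>i\<in>{1..m}. if even (m - i) then 1 else (0::nat)) = (\<Sum>i\<in>{1..k}. if even (m - i) then 1 else 0) + 1"
        by (simp add: m)
      also have "(\<Sum>i\<in>{1..k}. if even (m - i) then 1 else (0::nat)) = (\<Sum>i\<in>{1..k}. if even (k - i) then 1 else 0)"
        by (rule sum.cong) (auto simp: m Suc_diff_le)
      finally show ?thesis using 1 by (simp add: m)
    qed
  qed
  finally show ?thesis .
qed

text \<open>The signed count of the cross pairs is a product of two alternating sums, one over I and
  one over its complement, and both depend only on n and m.\<close>

lemma mono_degree_shift_exp:
  assumes "I \<in> shift_sets n m"
  shows "mono_degree (shift_exp n I) = mono_degree (discr_exp n) + (m + 1) div 2"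
proof -
  note I = shift_setsD[OF assms]
  let ?s = "int (m div 2) - int ((m + 1) div 2)"
  have p1: "mono_degree (pair_exp p) = 1" for p by (simp add: pair_exp_def)
  have "(\<Sum>(i, j)\<in>cross_pairs n I. (-1::int) ^ (i + j)) =
      (\<Sum>i\<in>I. (-1) ^ i) * (\<Sum>j\<in>{1..n} - I. (-1) ^ j)"
    unfolding cross_pairs_sum by (simp add: power_add sum_product)
  also have "(\<Sum>j\<in>{1..n} - I. (-1::int) ^ j) = (if odd n then -1 else 0) - ?s"
    unfolding I(4)[symmetric] sum_alternating[symmetric] using I(1) by (intro sum_diff) auto
  finally have c: "(\<Sum>(i, j)\<in>cross_pairs n I. (-1::int) ^ (i + j)) = ?s * ((if odd n then -1 else 0) - ?s)"
    by (simp only: I(4))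
  have s: "?s = (if odd m then -1 else 0)" by (auto elim!: oddE evenE)
  have "{i \<in> I. even (n + i)} = (if odd n then {i \<in> I. odd i} else {i \<in> I. even i})" by auto
  then have d: "card {i \<in> I. even (n + i)} = (if odd n then (m + 1) div 2 else m div 2)"
    using assms by (simp add: shift_sets_def)
  have "int (mono_degree (shift_exp n I)) = int (mono_degree (discr_exp n)) +
      (\<Sum>i\<in>{i \<in> I. even (n + i)}. int (mono_degree (single i 1))) -
      (\<Sum>(i, j)\<in>cross_pairs n I. (-1) ^ (i + j) * int (mono_degree (pair_exp (i, j))))"
    by (rule shift_exp_additive[OF I(1), of "\<lambda>a. int (mono_degree a)"]) (simp_all add: mono_degree_add)
  moreover have "(\<Sum>i\<in>{i \<in> I. even (n + i)}. int (mono_degree (single i 1))) =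
      int (if odd n then (m + 1) div 2 else m div 2)"
    unfolding d[symmetric] by simp
  moreover have "(\<Sum>(i, j)\<in>cross_pairs n I. (-1) ^ (i + j) * int (mono_degree (pair_exp (i, j)))) =
      ?s * ((if odd n then -1 else 0) - ?s)"
    unfolding c[symmetric] p1 by simp
  moreover have "int (if odd n then (m + 1) div 2 else m div 2) - ?s * ((if odd n then -1 else 0) - ?s) =
      int ((m + 1) div 2)"
    unfolding s by (auto elim!: oddE evenE)
  ultimately show ?thesis by linarith
qed

lemma shift_exp_initial:
  assumes "m \<le> n"
  shows "shift_exp n {1..m} = discr_exp n + alt_mono n (column m)"
proof (rule poly_mapping_eqI)
  fix k
  have sub: "{1..m} \<subseteq> {1..n}" using assms by auto
  show "lookup (shift_exp n {1..m}) k =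
      lookup (discr_exp n + alt_mono n (column m)) k"
  proof (cases "k \<in> {1..n}")
    case True
    \<comment> \<open>Beyond m the tail sums of \<open>column m\<close> are 0, so the sign is
      immaterial there.\<close>
    have "(if k \<in> {1..m} then 1 else -1) * asum n (column m) k = asum n (column m) k"
      using True assms by (auto simp: asum_column)
    then have "int (lookup (shift_exp n {1..m}) k) =
        int (lookup (discr_exp n) k) + int (lookup (alt_mono n (column m)) k)"
      using lookup_shift_exp[OF sub True] lookup_alt_mono_column[OF assms True]
      by (simp only: ind_atLeastAtMost)
    then show ?thesis by (simp only: lookup_add)
  next
    case False
    then show ?thesis
      using lookup_exp_outside[OF sub False] by (simp add: lookup_add lookup_alt_mono del: atLeastAtMost_iff)
  qed
qed

lemma shift_sgn_initial: "m \<le> n \<Longrightarrow> shift_sgn n {1..m} = (discr_sgn n :: 'a::comm_ring_1)"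
proof -
  assume "m \<le> n"
  let ?C = "cross_pairs n {1..m}"
  have C: "sgn_lt i j = (1::'a)" if "(i, j) \<in> ?C" for i j
    using that by (auto simp: cross_pairs_def sgn_lt_def)
  have "(\<Prod>(i, j)\<in>{(i, j) \<in> ?C. odd (i + j)}. sgn_lt i j :: 'a) = 1"
    by (rule prod.neutral) (use C in auto)
  moreover have "(\<Prod>(i, j)\<in>same_pairs n - ?C. sgn_lt i j :: 'a) = discr_sgn n"
    unfolding discr_sgn_def by (rule prod.mono_neutral_left) (use C in auto)
  ultimately show ?thesis by (simp add: shift_sgn_def)
qed

text \<open>The tail sums of I and of {1..m} agree at 1 by the count of odd and even elements. The
  recursion \<open>asum_rec\<close> carries the equality forward as long as both sets contain the
  current index. Both comparisons of leading exponents start from here.\<close>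

lemma first_missing:
  assumes I: "I \<in> shift_sets n m" and ne: "I \<noteq> {1..m}" and m: "m \<le> n"
  shows "\<exists>k\<in>{1..m}. k \<notin> I \<and> (\<forall>j\<in>{1..<k}. j \<in> I) \<and>
    (\<forall>j\<in>{1..k}. asum n (ind I) j = asum n (column m) j)"
proof -
  note ID = shift_setsD[OF I]
  let ?s = "asum n (ind I)" and ?t = "asum n (column m)"
  have "\<not> {1..m} \<subseteq> I"
    using card_subset_eq[OF ID(2), of "{1..m}"] ID(3) ne by auto
  then have ex: "\<exists>k. k \<in> {1..m} \<and> k \<notin> I" by auto
  define k where "k = (LEAST k. k \<in> {1..m} \<and> k \<notin> I)"
  have k: "k \<in> {1..m}" "k \<notin> I" using LeastI_ex[OF ex] by (auto simp: k_def)
  have below: "j \<in> I" if "1 \<le> j" "j < k" for j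
    using not_less_Least[of j "\<lambda>k. k \<in> {1..m} \<and> k \<notin> I"] that k(1) by (auto simp: k_def)
  have "?s 1 = ?t 1"
  proof -
    have "?s 1 = int ((m + 1) div 2) - int (m div 2)"
      unfolding asum_ind_one[OF ID(1)] ID(4) by simp
    also have "\<dots> = ?t 1" using k(1) m by (auto simp: asum_column elim!: oddE evenE)
    finally show ?thesis .
  qed
  have st: "j \<le> k \<Longrightarrow> ?s j = ?t j" if "1 \<le> j" for j
    using that
  proof (induction j rule: dec_induct)
    case base
    then show ?case using \<open>?s 1 = ?t 1\<close> by simp
  next
    case (step j)
    have "j \<le> n" using step k(1) m by simp
    then have "?s j = int (ind I j) - ?s (Suc j)" "?t j = int (column m j) - ?t (Suc j)"
      by (rule asum_rec)+
    moreover have "ind I j = 1" "column m j = 1"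
      using step k(1) below[of j] by (auto simp: ind_def column_def)
    moreover have "?s j = ?t j" using step by simp
    ultimately show ?case by linarith
  qed
  show ?thesis by (rule bexI[OF _ k(1)]) (simp add: k(2) below st)
qed

text \<open>Before the first missing index k the exponents agree. As k is not in I, the tail sum at
  k enters with a minus sign: this is a strict drop if it is 1. If it is 0, the exponents still
  agree at k and the drop from 1 to 0 occurs at k + 1.\<close>

lemma shift_exp_grless:
  assumes I: "I \<in> shift_sets n m" and ne: "I \<noteq> {1..m}" and m: "m \<le> n"
  shows "grless (shift_exp n I) (discr_exp n + alt_mono n (column m))"
proof -
  note ID = shift_setsD[OF I]
  let ?s = "asum n (ind I)" and ?t = "asum n (column m)"
  let ?u = "\<lambda>k. (if k \<in> I then 1 else -1) * ?s k"
  obtain k where k: "k \<in> {1..m}" "k \<notin> I"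
    and below': "\<forall>j\<in>{1..<k}. j \<in> I" and st': "\<forall>j\<in>{1..k}. ?s j = ?t j"
    using first_missing[OF I ne m] by auto
  have below: "j \<in> I" if "1 \<le> j" "j < k" for j using below' that by simp
  have st: "?s j = ?t j" if "1 \<le> j" "j \<le> k" for j using st' that by simp
  have lt: "grless (shift_exp n I) (discr_exp n + alt_mono n (column m))"
    if l: "l \<in> {1..n}" "?u l < ?t l" "\<And>j. 1 \<le> j \<Longrightarrow> j < l \<Longrightarrow> ?u j = ?t j" for l
    unfolding grless_def mono_less_iff
  proof (intro disjI2 conjI exI[of _ l] allI impI)
    show "mono_degree (shift_exp n I) = mono_degree (discr_exp n + alt_mono n (column m))"
      by (simp add: mono_degree_shift_exp[OF I] mono_degree_add mono_degree_alt_mono_column[OF m])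
    have eq: "int (lookup (shift_exp n I) j) + ?t j =
        int (lookup (discr_exp n + alt_mono n (column m)) j) + ?u j" if "j \<in> {1..n}" for j
      using lookup_shift_exp[OF ID(1) that] lookup_alt_mono_column[OF m that] by (simp add: lookup_add)
    show "lookup (shift_exp n I) l <
        lookup (discr_exp n + alt_mono n (column m)) l"
      using eq[OF l(1)] l(2) by linarith
    show "lookup (shift_exp n I) j =
        lookup (discr_exp n + alt_mono n (column m)) j" if "j < l" for j
    proof (cases "j \<in> {1..n}")
      case True
      then have "?u j = ?t j" using l(3)[of j] that by simp
      with eq[OF True] show ?thesis by linarith
    next
      case False
      then show ?thesis
        using lookup_exp_outside[OF ID(1) False] by (simp add: lookup_add lookup_alt_mono del: atLeastAtMost_iff)
    qed
  qed
  have ub: "?u j = ?t j" if "1 \<le> j" "j < k" for j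
    using below[OF that] st[OF that(1)] that(2) by simp
  have kn: "k \<in> {1..n}" using k(1) m by auto
  have sk: "?s k = ?t k" using st[of k] k(1) by simp
  show ?thesis
  proof (cases "even (m - k)")
    case True
    then have "?t k = 1" using k(1) m by (simp add: asum_column)
    then show ?thesis using lt[OF kn] k(2) sk ub by auto
  next
    case False
    then have t0: "?t k = 0" using k(1) m by (simp add: asum_column)
    have "k \<noteq> m" using False by auto
    then have k1: "Suc k \<le> m" using k(1) by auto
    have "?s (Suc k) = 0"
      using asum_rec[of k n "ind I"] kn k(2) sk t0 by (simp add: ind_def)
    moreover have "?t (Suc k) = 1"
      using False k1 m by (simp add: asum_column)
    moreover have "?u j = ?t j" if "1 \<le> j" "j < Suc k" for j
      using ub[of j] that t0 sk k(2) by (cases "j = k") auto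
    ultimately show ?thesis using lt[of "Suc k"] k1 m by auto
  qed
qed

lemma lead_pieri_op:
  fixes f :: "'a::{idom, ring_char_0} mpoly"
  assumes f: "f \<in> semisymmetric n" and m: "m \<le> n" and l: "lead f a c"
  shows "lead (pieri_op n r m f) (alt_mono n (column m) + a) c"
proof -
  let ?e = "discr_exp n + (alt_mono n (column m) + a)"
  let ?g = "\<lambda>I. shift_coeff n (mconst r) I mvar * shift (eps I) f"
  have t: "lead (?g I) (shift_exp n I + a) (shift_sgn n I * c)" for I
    by (intro lead_mult lead_shift_coeff lead_shift l)
  have "lead (?g I) ?e (if I = {1..m} then discr_sgn n * c else 0)" if "I \<in> shift_sets n m" for I
  proof (cases "I = {1..m}")
    case True
    show ?thesis
      using t[of "{1..m}"]
      by (simp only: True shift_exp_initial[OF m] shift_sgn_initial[OF m] add.assoc refl if_True)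
  next
    case False
    have "grless (shift_exp n I + a) ?e"
      using shift_exp_grless[OF that False m] grless_add_right by (simp only: add.assoc[symmetric])
    then show ?thesis using lead_grless[OF t] False by simp
  qed
  then have "lead (pieri_num n r m f) ?e (\<Sum>I\<in>shift_sets n m. if I = {1..m} then discr_sgn n * c else 0)"
    unfolding pieri_num_def by (rule lead_sum)
  also have "(\<Sum>I\<in>shift_sets n m. if I = {1..m} then discr_sgn n * c else 0) = discr_sgn n * c"
    using initial_in_shift_sets[OF m] by simp
  finally show ?thesis
    using pieri_op[OF f, of r m] lead_cancel[OF lead_discr discr_sgn_nonzero] by metis
qed

lemma one_semisymmetric: "(1 :: 'a::comm_ring_1 mpoly) \<in> semisymmetric n"
  by (simp add: semisymmetric_def poly_ring_iff restrict_hom.map_one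
      permute_hom.map_one)

lemma hom_discr: "hom_component (mono_degree (discr_exp n)) (discr n mvar) = (discr n mvar :: 'a::comm_ring_1 mpoly)"
proof -
  have h: "top_part 1 (mvar i - mvar j) (mvar i - mvar j :: 'a mpoly)" for i j
  proof -
    have t: "top_part 1 (mvar i) (mvar i :: 'a mpoly)" for i
      using top_part_mvar_diff[of i 0] by simp
    have "hom_component 1 (mvar i - mvar j) = (mvar i - mvar j :: 'a mpoly)"
      using t[of i] t[of j] by (simp add: top_part_def hom_component_diff)
    then show ?thesis using t[of i] t[of j] by (simp add: top_part_def deg_le_diff)
  qed
  have "top_part (\<Sum>p\<in>same_pairs n. 1) (discr n mvar) (discr n mvar :: 'a mpoly)"
    unfolding discr_def split_beta by (intro top_part_prod h)
  moreover have "mono_degree (discr_exp n) = (\<Sum>p\<in>same_pairs n. 1)"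
    unfolding discr_exp_def mono_degree_sum by (simp add: pair_exp_def)
  ultimately show ?thesis by (simp only: top_part_def)
qed

text \<open>Shifts do not change top components, so the top component of \<open>pieri_num\<close> is
  that of \<open>f\<close> times a sum \<open>?C\<close> independent of \<open>f\<close>. The case f
  = 1 identifies \<open>?C\<close>, and the homogeneous factor \<open>discr\<close> cancels.\<close>

lemma top_pieri_op:
  fixes f :: "'a::{idom, ring_char_0} mpoly"
  assumes f: "f \<in> semisymmetric n" and d: "deg_le d f"
  shows "deg_le ((m + 1) div 2 + d) (pieri_op n r m f)"
    and "hom_component ((m + 1) div 2 + d) (pieri_op n r m f) =
      hom_component ((m + 1) div 2) (pieri_op n r m 1) * hom_component d f"
proof -
  let ?p = "(m + 1) div 2" and ?D = "mono_degree (discr_exp n)"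
  let ?b = "\<lambda>I. shift_coeff n (mconst r) I mvar :: 'a mpoly"
  let ?C = "\<Sum>I\<in>shift_sets n m. hom_component (?D + ?p) (?b I)"
  have b: "deg_le (?D + ?p) (?b I)" if "I \<in> shift_sets n m" for I
    using lead_deg_le[OF lead_shift_coeff[of n r I]] mono_degree_shift_exp[OF that] by simp
  have num: "deg_le (?D + (?p + d)) (pieri_num n r m f) \<and>
      hom_component (?D + (?p + d)) (pieri_num n r m f) = ?C * hom_component d f"
    if d: "deg_le d f" for d and f :: "'a mpoly"
  proof
    have s: "deg_le d (shift c f)" "hom_component d (shift c f) = hom_component d f" for c
      using top_part_shift[OF d, of c] by (auto simp: top_part_def)
    have e: "?D + (?p + d) = ?D + ?p + d" by simp
    show "deg_le (?D + (?p + d)) (pieri_num n r m f)"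
      unfolding pieri_num_def e by (intro deg_le_sum deg_le_mult b s)
    show "hom_component (?D + (?p + d)) (pieri_num n r m f) = ?C * hom_component d f"
      unfolding pieri_num_def e hom_component_sum sum_distrib_right
      by (rule sum.cong) (simp_all only: hom_component_mult[OF b s(1)] s(2))
  qed
  have op: "deg_le (?p + d) (pieri_op n r m f) \<and>
      discr n mvar * hom_component (?p + d) (pieri_op n r m f) = ?C * hom_component d f"
    if f: "f \<in> semisymmetric n" and d: "deg_le d f" for d and f :: "'a mpoly"
  proof
    note n = num[OF d, folded pieri_op[OF f]]
    show g: "deg_le (?p + d) (pieri_op n r m f)"
      by (rule deg_le_cancel[OF lead_discr discr_sgn_nonzero]) (use n in blast)
    have "hom_component (?D + (?p + d)) (discr n mvar * pieri_op n r m f) =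
        discr n mvar * hom_component (?p + d) (pieri_op n r m f)"
      using hom_component_mult[OF lead_deg_le[OF lead_discr] g] by (simp only: hom_discr)
    with n show "discr n mvar * hom_component (?p + d) (pieri_op n r m f) = ?C * hom_component d f"
      by simp
  qed
  have one: "deg_le 0 (1 :: 'a mpoly)" "hom_component 0 1 = (1 :: 'a mpoly)"
    using top_part_one[where 'a = 'a] by (auto simp: top_part_def)
  show "deg_le (?p + d) (pieri_op n r m f)"
    using op[OF f d] by blast
  have "discr n mvar * hom_component (?p + d) (pieri_op n r m f) =
      discr n mvar * hom_component ?p (pieri_op n r m 1) * hom_component d f"
    using op[OF f d] op[OF one_semisymmetric one(1)] one(2) by simp
  then show "hom_component (?p + d) (pieri_op n r m f) =
      hom_component ?p (pieri_op n r m 1) * hom_component d f"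
    using mult_left_cancel[OF discr_mvar_nonzero[of n, where 'a = 'a]] by (simp only: mult.assoc)
qed

section \<open>Coefficients at the interpolation points\<close>

lemma Lam_antimono: "l \<in> Lam n \<Longrightarrow> 1 \<le> i \<Longrightarrow> i \<le> j \<Longrightarrow> j \<le> n \<Longrightarrow> l j \<le> l i"
  by (auto simp: Lam_def)

lemma Lam_outside: "l \<in> Lam n \<Longrightarrow> i \<notin> {1..n} \<Longrightarrow> l i = 0"
  by (auto simp: Lam_def)

lemma LamI:
  assumes "\<And>k. 1 \<le> k \<Longrightarrow> k < n \<Longrightarrow> l (Suc k) \<le> l k" "\<And>i. i \<notin> {1..n} \<Longrightarrow> l i = 0"
  shows "l \<in> Lam n"
proof -
  have "l j \<le> l i" if "1 \<le> i" "i \<le> j" "j \<le> n" for i j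
    using that(2,3)
  proof (induction j rule: dec_induct)
    case (step k)
    then have "l (Suc k) \<le> l k" using assms(1)[of k] that(1) by simp
    then show ?case using step by simp
  qed simp
  then show ?thesis using assms(2) by (auto simp: Lam_def)
qed

text \<open>The Pochhammer symbol of \<open>c + 1\<close>. Adding a box to a row will multiply it by
  one linear factor.\<close>

definition rise :: "'a::comm_ring_1 \<Rightarrow> nat \<Rightarrow> 'a" where
  "rise c d = (\<Prod>k<d. of_nat (Suc k) + c)"

lemma rise_Suc: "rise c (Suc d) = rise c d * (of_nat (Suc d) + c)"
  by (simp add: rise_def)

definition lt_pairs :: "nat \<Rightarrow> (nat \<times> nat) set" where
  "lt_pairs n = {(i, j). i \<in> {1..n} \<and> j \<in> {1..n} \<and> i < j}"

text \<open>The value \<open>R\<^sub>\<lambda>(\<rho> + \<lambda>)\<close>.\<close>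

definition hook :: "nat \<Rightarrow> 'a::field \<Rightarrow> (nat \<Rightarrow> nat) \<Rightarrow> 'a" where
  "hook n r l = (\<Prod>i\<in>{i \<in> {1..n}. even (n + i)}. rise (of_nat (n - i) * r) (l i)) *
     (\<Prod>(i, j)\<in>lt_pairs n. if odd (j - i) then rise (of_nat (j - i - 1) * r) (l i - l j)
       else inverse (rise (of_nat (j - i) * r) (l i - l j)))"

definition gen_point :: "nat \<Rightarrow> 'a::comm_ring_1 \<Rightarrow> (nat \<Rightarrow> nat) \<Rightarrow> nat \<Rightarrow> 'a" where
  "gen_point n r l i = rho n r i + of_nat (l i)"

lemma gen_point_lambda: "(\<lambda>i. rho n r i + of_nat (l i)) = gen_point n r l"
  by (simp add: gen_point_def fun_eq_iff)

lemma finite_lt_pairs [simp]: "finite (lt_pairs n)"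
  by (rule finite_subset[of _ "{1..n} \<times> {1..n}"]) (auto simp: lt_pairs_def)

lemma psi_pairs_sub: "psi_pairs n I \<subseteq> lt_pairs n"
  by (auto simp: psi_pairs_def lt_pairs_def)

lemma finite_psi_pairs [simp]: "finite (psi_pairs n I)"
  by (rule finite_subset[OF psi_pairs_sub]) simp

lemma gen_point_diff:
  assumes "l \<in> Lam n" "(i, j) \<in> lt_pairs n"
  shows "gen_point n r l i - gen_point n r l j = of_nat (l i - l j) + of_nat (j - i) * r"
proof -
  have ij: "1 \<le> i" "i < j" "j \<le> n" using assms(2) by (auto simp: lt_pairs_def)
  then have "l j \<le> l i" using Lam_antimono[OF assms(1)] by simp
  moreover have "n - i = (n - j) + (j - i)" using ij by simp
  ultimately show ?thesis
    by (simp add: gen_point_def rho_def of_nat_diff algebra_simps)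
qed

text \<open>The number equals the sum of the elements of I minus m(m + 1)/2. Both terms have the
  parity of the ceiling of m/2, the number of odd elements of I. Evenness removes the sign that
  appears when the factors of a_I with j < i are reversed.\<close>

lemma card_psi_pairs_even:
  assumes "I \<in> shift_sets n m"
  shows "even (card (psi_pairs n I))"
proof -
  note I = shift_setsD[OF assms]
  define L where "L = {(i, j). i \<in> I \<and> j \<in> I \<and> i < j}"
  have L: "finite L" by (rule finite_subset[of _ "I \<times> I"]) (use I(2) in \<open>auto simp: L_def\<close>)
  define G where "G = {(i, j). i \<in> I \<and> j \<in> I \<and> j < i}"
  define E where "E = {(i, j). i \<in> I \<and> j = i}"
  have "G = prod.swap ` L" "E = (\<lambda>i. (i, i)) ` I" by (auto simp: G_def L_def E_def)
  then have G: "card G = card L" "card E = card I" "finite G" "finite E"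
    using L I(2) by (auto intro!: card_image simp: inj_on_def)
  have "I \<times> I = L \<union> G \<union> E"
    by (auto simp: L_def G_def E_def)
  moreover have "card (L \<union> G \<union> E) = card (L \<union> G) + card E"
    by (rule card_Un_disjoint) (use L G in \<open>auto simp: L_def G_def E_def\<close>)
  moreover have "card (L \<union> G) = card L + card G"
    by (rule card_Un_disjoint) (use L G in \<open>auto simp: L_def G_def\<close>)
  ultimately have 1: "m * m = 2 * card L + m"
    using I(3) G card_cartesian_product[of I I] by simp
  define K where "K = {(i, j). 1 \<le> i \<and> i < j \<and> j \<in> I}"
  have "K = prod.swap ` (SIGMA j:I. {1..<j})" by (auto simp: K_def)
  then have "card K = card (SIGMA j:I. {1..<j})" by (simp add: card_image)
  moreover have "K = psi_pairs n I \<union> L"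
    unfolding K_def psi_pairs_def L_def using I(1) by auto
  moreover have "psi_pairs n I \<inter> L = {}" by (auto simp: psi_pairs_def L_def)
  ultimately have "card (psi_pairs n I) + card L = card (SIGMA j:I. {1..<j})"
    using card_Un_disjoint[OF finite_psi_pairs L, of n I] by simp
  also have "\<dots> = (\<Sum>j\<in>I. j - 1)" using I(2) by simp
  finally have "card (psi_pairs n I) + card L + m = (\<Sum>j\<in>I. j - 1) + (\<Sum>j\<in>I. 1)"
    using I(3) by simp
  also have "\<dots> = (\<Sum>j\<in>I. j)"
    unfolding sum.distrib[symmetric] by (rule sum.cong) (use I(1) in auto)
  finally have 2: "card (psi_pairs n I) + card L + m = \<Sum>I" .
  have "even (\<Sum>I) \<longleftrightarrow> even (card {i \<in> I. odd i})"
    using I(2) by (rule even_sum_iff)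
  then have 3: "even (\<Sum>I) \<longleftrightarrow> even ((m + 1) div 2)"
    using assms by (simp add: shift_sets_def)
  show ?thesis
  proof (cases "even m")
    case True
    then obtain q where q: "m = 2 * q" by auto
    define s where "s = q * q"
    have "card L + q = 2 * s" using 1 by (simp add: q s_def)
    then have "card (psi_pairs n I) + 2 * s + q = \<Sum>I" using 2 by (simp add: q)
    then show ?thesis using 3 unfolding q by presburger
  next
    case False
    then obtain q where q: "m = 2 * q + 1" by (auto elim: oddE)
    define s where "s = q * q"
    have "card L = 2 * s + q" using 1 by (simp add: q s_def algebra_simps)
    then have "card (psi_pairs n I) + 2 * (s + q) + (q + 1) = \<Sum>I" using 2 by (simp add: q)
    then show ?thesis using 3 unfolding q by presburger
  qed
qed

lemma prod_if_split:
  assumes "finite S"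
  shows "(\<Prod>p\<in>S. if P p then f p else g p) = (\<Prod>p\<in>{p \<in> S. P p}. f p) * (\<Prod>p\<in>{p \<in> S. \<not> P p}. g p)"
  using prod.If_cases[OF assms, of P f g] by (simp add: Int_def Diff_eq Compl_eq Collect_neg_eq[symmetric])

definition psi_factor :: "'a::field \<Rightarrow> (nat \<Rightarrow> nat) \<Rightarrow> (nat \<Rightarrow> nat) \<Rightarrow> nat \<Rightarrow> nat \<Rightarrow> 'a" where
  "psi_factor r \<mu> l i j = (if odd (j - i)
     then (of_nat (\<mu> i) - of_nat (\<mu> j) + of_nat (j - i - 1) * r) *
       (of_nat (l i) - of_nat (l j) + of_nat (j - i + 1) * r)
     else inverse ((of_nat (\<mu> i) - of_nat (\<mu> j) + of_nat (j - i) * r) *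
       (of_nat (l i) - of_nat (l j) + of_nat (j - i) * r)))"

lemma psi_formula_prod:
  "psi_formula n r \<mu> I = (\<Prod>p\<in>psi_pairs n I. psi_factor r \<mu> (add_eps \<mu> I) (fst p) (snd p))"
proof -
  have s: "{p \<in> psi_pairs n I. odd (snd p - fst p)} = {(i, j) \<in> psi_pairs n I. odd (j - i)}"
    "{p \<in> psi_pairs n I. \<not> odd (snd p - fst p)} = {(i, j) \<in> psi_pairs n I. even (j - i)}"
    by auto
  show ?thesis
    unfolding psi_formula_def psi_factor_def Let_def split_beta prod_if_split[OF finite_psi_pairs]
      s[unfolded split_beta]
    by (simp only: prod_inversef[symmetric] o_def divide_inverse)
qed

text \<open>The cross pairs are split into the increasing ones, \<open>U\<close>, and the reversals
  of \<open>V\<close>. Passing from \<kappa> to \<lambda> raises the difference of parts on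
  \<open>U\<close> and lowers it on \<open>V\<close>; accordingly the hook value is multiplied by
  \<open>X\<close>, by the factors \<open>g\<close> on \<open>U\<close>, and by the inverses of
  \<open>g'\<close> on \<open>V\<close>. The operator coefficient contributes \<open>X\<close>,
  \<open>g\<close> on \<open>U\<close> and \<open>v\<close> on \<open>V\<close>, and \<psi> is the
  product of \<open>g'\<close> and \<open>v\<close>. Under \<open>gen\<close>, which excludes r = 0,
  no denominator vanishes.\<close>

lemma shift_coeff_hook:
  fixes r :: "'a::field"
  assumes gen: "\<And>a b. a + b > 0 \<Longrightarrow> of_nat a + of_nat b * r \<noteq> 0"
    and I: "I \<in> shift_sets n m" and k: "\<kappa> \<in> Lam n" and l: "add_eps \<kappa> I \<in> Lam n"
  shows "shift_coeff n r I (gen_point n r (add_eps \<kappa> I)) * hook n r \<kappa> =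
    discr n (gen_point n r (add_eps \<kappa> I)) * (psi_formula n r \<kappa> I * hook n r (add_eps \<kappa> I))"
proof -
  define l where "l = add_eps \<kappa> I"
  note lL = l[folded l_def]
  define x where "x = gen_point n r l"
  define X where "X = (\<Prod>i\<in>{i \<in> I. even (n + i)}. x i)"
  define U where "U = {(i, j) \<in> lt_pairs n. i \<in> I \<and> j \<notin> I}"
  define V where "V = psi_pairs n I"
  define g where "g = (\<lambda>(i, j). if odd (j - i) then x i - x j - r else inverse (x i - x j))"
  define g' where "g' = (\<lambda>(i, j). if odd (j - i) then of_nat (\<kappa> i - \<kappa> j) + of_nat (j - i - 1) * r
    else inverse (of_nat (\<kappa> i - \<kappa> j) + of_nat (j - i) * r))"
  define v where "v = (\<lambda>(i, j). if odd (j - i) then x i - x j + r else inverse (x i - x j))"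
  define h where "h = (\<lambda>l (i, j). if odd (j - i) then rise (of_nat (j - i - 1) * r) (l i - l j)
       else inverse (rise (of_nat (j - i) * r) (l i - l j)))"
  note I' = shift_setsD[OF I]
  have xd: "x i - x j = of_nat (l i - l j) + of_nat (j - i) * r" if "(i, j) \<in> lt_pairs n" for i j
    unfolding x_def by (rule gen_point_diff[OF lL that])
  have lk: "l i = \<kappa> i + (if i \<in> I then 1 else 0)" for i by (simp add: l_def add_eps_def)
  have kd: "\<kappa> j \<le> \<kappa> i" "l j \<le> l i" if "(i, j) \<in> lt_pairs n" for i j
    using that Lam_antimono[OF k, of i j] Lam_antimono[OF lL, of i j] by (auto simp: lt_pairs_def)
  have VU: "V \<subseteq> lt_pairs n" "U \<subseteq> lt_pairs n" "finite V" "finite U" "U \<inter> V = {}"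
    unfolding V_def using psi_pairs_sub[of n I]
    by (auto simp: U_def psi_pairs_def intro: finite_subset[OF _ finite_lt_pairs])
  have psi: "psi_formula n r \<kappa> I = (\<Prod>p\<in>V. g' p * v p)"
    unfolding psi_formula_prod V_def
  proof (rule prod.cong[OF refl])
    fix p assume p: "p \<in> psi_pairs n I"
    obtain i j where ij: "p = (i, j)" by (cases p)
    have t: "(i, j) \<in> lt_pairs n" using p psi_pairs_sub[of n I] ij by auto
    have "of_nat (j - i + 1) * r = of_nat (j - i) * r + r" by (simp add: algebra_simps)
    then show "psi_factor r \<kappa> (add_eps \<kappa> I) (fst p) (snd p) = g' p * v p"
      unfolding ij fst_conv snd_conv psi_factor_def prod.case g'_def v_def xd[OF t] l_def[symmetric]
      by (simp only: of_nat_diff[OF kd(1)[OF t]] of_nat_diff[OF kd(2)[OF t]] inverse_mult_distrib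
          add.assoc if_distrib[of "\<lambda>x. x * _"] if_distrib[of "\<lambda>x. _ * x"] split: if_split) simp
  qed
  have hl: "hook n r l = (\<Prod>i\<in>{i \<in> {1..n}. even (n + i)}. rise (of_nat (n - i) * r) (l i)) *
      (\<Prod>p\<in>lt_pairs n. h l p)" for l
    unfolding hook_def h_def by (rule refl)
  have A: "(\<Prod>i\<in>{i \<in> {1..n}. even (n + i)}. rise (of_nat (n - i) * r) (l i)) =
      (\<Prod>i\<in>{i \<in> {1..n}. even (n + i)}. rise (of_nat (n - i) * r) (\<kappa> i)) * X"
  proof -
    have "X = (\<Prod>i\<in>{i \<in> {1..n}. even (n + i)}. if i \<in> I then x i else 1)"
      unfolding X_def by (rule prod.mono_neutral_cong_left) (use I'(1) in auto)
    moreover have "rise (of_nat (n - i) * r) (l i) = rise (of_nat (n - i) * r) (\<kappa> i) * (if i \<in> I then x i else 1)" for i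
      by (simp add: lk rise_Suc x_def gen_point_def rho_def add.commute)
    ultimately show ?thesis by (simp only: prod.distrib)
  qed
  have B: "h l p * (if p \<in> V then g' p else 1) = h \<kappa> p * (if p \<in> U then g p else 1)"
    if "p \<in> lt_pairs n" for p
  proof -
    obtain i j where ij: "p = (i, j)" by (cases p)
    have t: "(i, j) \<in> lt_pairs n" using that ij by simp
    then have rng: "i \<in> {1..n}" "j \<in> {1..n}" "i < j" by (auto simp: lt_pairs_def)
    show ?thesis
    proof (cases "i \<in> I \<longleftrightarrow> j \<in> I")
      case True
      then have "p \<notin> V" "p \<notin> U" by (auto simp: V_def psi_pairs_def U_def ij)
      moreover have "l i - l j = \<kappa> i - \<kappa> j" using True by (simp add: lk)
      ultimately show ?thesis by (simp add: h_def ij)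
    next
      case False
      show ?thesis
      proof (cases "i \<in> I")
        case True
        then have m: "p \<notin> V" "p \<in> U" using False t by (auto simp: V_def psi_pairs_def U_def ij)
        have d: "l i - l j = Suc (\<kappa> i - \<kappa> j)" using True False kd[OF t] by (simp add: lk)
        \<comment> \<open>The operator subtracts r from the difference of coordinates; this is the
          origin of the index j - i - 1 in \<open>hook\<close>.\<close>
        have o: "of_nat (j - i) * r - r = of_nat (j - i - 1) * r"
          using rng(3) by (simp add: of_nat_diff algebra_simps)
        have "g p = (if odd (j - i) then of_nat (Suc (\<kappa> i - \<kappa> j)) + of_nat (j - i - 1) * r
            else inverse (of_nat (Suc (\<kappa> i - \<kappa> j)) + of_nat (j - i) * r))"
          unfolding g_def ij prod.case xd[OF t] d o[symmetric] by (simp only: add_diff_eq)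
        then show ?thesis
          using m by (simp add: h_def ij d rise_Suc del: of_nat_Suc)
      next
        case i: False
        with False have j: "j \<in> I" by simp
        then have m: "p \<in> V" "p \<notin> U" using i rng by (auto simp: V_def psi_pairs_def U_def ij)
        have d: "\<kappa> i - \<kappa> j = Suc (l i - l j)" using i j kd[OF t] by (simp add: lk)
        have "of_nat (Suc (l i - l j)) + of_nat b * r \<noteq> 0" for b by (rule gen) simp
        then show ?thesis
          using m by (simp add: h_def g'_def ij d rise_Suc del: of_nat_Suc)
      qed
    qed
  qed
  have "(\<Prod>p\<in>lt_pairs n. h l p) * (\<Prod>p\<in>V. g' p) =
      (\<Prod>p\<in>lt_pairs n. h l p * (if p \<in> V then g' p else 1))"
    unfolding prod.distrib using VU(1)
    by (simp add: prod.inter_restrict[symmetric, of "lt_pairs n" V g'] Int_absorb1)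
  also have "\<dots> = (\<Prod>p\<in>lt_pairs n. h \<kappa> p * (if p \<in> U then g p else 1))"
    by (rule prod.cong[OF refl]) (rule B)
  also have "\<dots> = (\<Prod>p\<in>lt_pairs n. h \<kappa> p) * (\<Prod>p\<in>U. g p)"
    unfolding prod.distrib using VU(2)
    by (simp add: prod.inter_restrict[symmetric, of "lt_pairs n" U g] Int_absorb1)
  finally have hg: "(\<Prod>p\<in>lt_pairs n. h l p) * (\<Prod>p\<in>V. g' p) =
      (\<Prod>p\<in>lt_pairs n. h \<kappa> p) * (\<Prod>p\<in>U. g p)" .
  define A0 where "A0 = (\<Prod>i\<in>{i \<in> {1..n}. even (n + i)}. rise (of_nat (n - i) * r) (\<kappa> i))"
  have "hook n r l * (\<Prod>p\<in>V. g' p) = A0 * X * ((\<Prod>p\<in>lt_pairs n. h l p) * (\<Prod>p\<in>V. g' p))"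
    unfolding hl A A0_def[symmetric] by (simp only: mult.assoc)
  also have "\<dots> = hook n r \<kappa> * X * (\<Prod>p\<in>U. g p)"
    unfolding hg hl A0_def[symmetric] by (simp only: mult_ac)
  finally have HH: "hook n r l * (\<Prod>p\<in>V. g' p) = hook n r \<kappa> * X * (\<Prod>p\<in>U. g p)" .
  have xne: "x i - x j \<noteq> 0" if "(i, j) \<in> same_pairs n" for i j
  proof (cases "i < j")
    case True
    then have t: "(i, j) \<in> lt_pairs n" using that by (auto simp: same_pairs_def lt_pairs_def)
    show ?thesis unfolding xd[OF t] by (rule gen) (use True in simp)
  next
    case False
    then have t: "(j, i) \<in> lt_pairs n" "j < i" using that by (auto simp: same_pairs_def lt_pairs_def)
    have "x j - x i \<noteq> 0" unfolding xd[OF t(1)] by (rule gen) (use t(2) in simp)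
    then show ?thesis by simp
  qed
  define w where "w = (\<lambda>(i, j). if odd (i + j) then x i - x j - r else inverse (x i - x j))"
  let ?C = "cross_pairs n I"
  have finC: "finite ?C" using I'(1) by (rule finite_cross_pairs)
  have "shift_coeff n r I x = discr n x * X * (\<Prod>p\<in>?C. w p)"
  proof -
    let ?O = "{(i, j) \<in> ?C. odd (i + j)}" and ?E = "{(i, j) \<in> ?C. even (i + j)}"
    have CE: "same_pairs n - ?C = same_pairs n - ?E" "?E \<subseteq> same_pairs n"
      using I'(1) by (auto simp: same_pairs_def cross_pairs_def)
    have "?C = ?O \<union> ?E" by auto
    then have "(\<Prod>p\<in>?C. w p) = (\<Prod>p\<in>?O \<union> ?E. w p)" by simp
    also have "\<dots> = (\<Prod>p\<in>?O. w p) * (\<Prod>p\<in>?E. w p)"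
      by (rule prod.union_disjoint) (auto intro: finite_subset[OF _ finC])
    also have "(\<Prod>p\<in>?O. w p) = (\<Prod>(i, j)\<in>?O. x i - x j - r)"
      by (rule prod.cong) (auto simp: w_def)
    also have "(\<Prod>p\<in>?E. w p) = (\<Prod>(i, j)\<in>?E. inverse (x i - x j))"
      by (rule prod.cong) (auto simp: w_def)
    finally have W: "(\<Prod>p\<in>?C. w p) = (\<Prod>(i, j)\<in>?O. x i - x j - r) * (\<Prod>(i, j)\<in>?E. inverse (x i - x j))" .
    have "discr n x = (\<Prod>(i, j)\<in>same_pairs n - ?E. x i - x j) * (\<Prod>(i, j)\<in>?E. x i - x j)"
      unfolding discr_def by (rule prod.subset_diff[OF CE(2) finite_same_pairs])
    moreover have "(\<Prod>(i, j)\<in>?E. x i - x j) * (\<Prod>(i, j)\<in>?E. inverse (x i - x j)) = 1"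
      unfolding prod.distrib[symmetric]
    proof (rule prod.neutral, rule ballI)
      fix p assume p: "p \<in> ?E"
      obtain i j where ij: "p = (i, j)" by (cases p)
      have "x i - x j \<noteq> 0" by (rule xne) (use p CE(2) ij in blast)
      then show "(case p of (i, j) \<Rightarrow> x i - x j) * (case p of (i, j) \<Rightarrow> inverse (x i - x j)) = 1"
        unfolding ij prod.case by (rule right_inverse)
    qed
    ultimately have D: "discr n x * (\<Prod>(i, j)\<in>?E. inverse (x i - x j)) = (\<Prod>(i, j)\<in>same_pairs n - ?E. x i - x j)"
      by (simp only: mult.assoc mult_1_right)
    show ?thesis
      unfolding shift_coeff_def shift_num_def CE(1) D[symmetric] W X_def by (simp only: mult_ac)
  qed
  moreover have "(\<Prod>p\<in>?C. w p) = (\<Prod>p\<in>U. g p) * (\<Prod>p\<in>V. v p)"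
  proof -
    have "?C = U \<union> prod.swap ` V"
    proof (intro equalityI subsetI)
      fix p assume p: "p \<in> ?C"
      obtain i j where ij: "p = (i, j)" by (cases p)
      have m: "i \<in> I" "j \<notin> I" "i \<in> {1..n}" "j \<in> {1..n}"
        using p I'(1) by (auto simp: cross_pairs_def ij)
      then have "i < j \<or> j < i" by (metis nat_neq_iff)
      then show "p \<in> U \<union> prod.swap ` V"
      proof
        assume "j < i"
        then have "(j, i) \<in> V" using m by (simp add: V_def psi_pairs_def)
        then have "prod.swap (j, i) \<in> prod.swap ` V" by (rule imageI)
        then show ?thesis by (simp add: ij)
      qed (use m in \<open>simp add: ij U_def lt_pairs_def\<close>)
    next
      fix p assume "p \<in> U \<union> prod.swap ` V"
      then show "p \<in> ?C" by (auto simp: cross_pairs_def U_def V_def psi_pairs_def lt_pairs_def)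
    qed
    then have "(\<Prod>p\<in>?C. w p) = (\<Prod>p\<in>U \<union> prod.swap ` V. w p)" by simp
    also have "\<dots> = (\<Prod>p\<in>U. w p) * (\<Prod>p\<in>prod.swap ` V. w p)"
      by (rule prod.union_disjoint) (use VU(3,4) in \<open>auto simp: U_def V_def psi_pairs_def lt_pairs_def\<close>)
    also have "(\<Prod>p\<in>U. w p) = (\<Prod>p\<in>U. g p)"
      by (rule prod.cong) (auto simp: U_def lt_pairs_def w_def g_def)
    also have "(\<Prod>p\<in>prod.swap ` V. w p) = (\<Prod>p\<in>V. w (prod.swap p))"
      by (subst prod.reindex) (auto simp: inj_on_def)
    \<comment> \<open>Reversing a pair costs a sign for either parity: x_j - x_i - r is the negative
      of x_i - x_j + r, and the inverse changes sign with its argument.\<close>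
    also have "\<dots> = (\<Prod>p\<in>V. - 1 * v p)"
    proof (rule prod.cong[OF refl])
      fix p assume p: "p \<in> V"
      obtain i j where ij: "p = (i, j)" by (cases p)
      have "i < j" using p by (auto simp: V_def psi_pairs_def ij)
      then have "odd (j + i) \<longleftrightarrow> odd (j - i)" by simp
      moreover have "inverse (x j - x i) = - inverse (x i - x j)"
        by (metis inverse_minus_eq minus_diff_eq)
      ultimately show "w (prod.swap p) = - 1 * v p"
        by (simp add: w_def v_def ij)
    qed
    also have "\<dots> = (- 1) ^ card V * (\<Prod>p\<in>V. v p)" by (simp only: prod.distrib prod_constant)
    also have "(- 1 :: 'a) ^ card V = 1"
      using card_psi_pairs_even[OF I] by (simp add: V_def)
    finally show ?thesis by simp
  qed
  ultimately have S: "shift_coeff n r I x = discr n x * X * ((\<Prod>p\<in>U. g p) * (\<Prod>p\<in>V. v p))" by simp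
  have "shift_coeff n r I x * hook n r \<kappa> =
      discr n x * ((hook n r \<kappa> * X * (\<Prod>p\<in>U. g p)) * (\<Prod>p\<in>V. v p))"
    unfolding S by (simp only: mult_ac)
  also have "\<dots> = discr n x * (psi_formula n r \<kappa> I * hook n r l)"
    unfolding HH[symmetric] psi prod.distrib by (simp only: mult_ac)
  finally show ?thesis by (simp only: x_def l_def)
qed

lemma discr_gen_point_nonzero:
  fixes r :: "'a::field"
  assumes gen: "\<And>a b. a + b > 0 \<Longrightarrow> of_nat a + of_nat b * r \<noteq> 0" and l: "l \<in> Lam n"
  shows "discr n (gen_point n r l) \<noteq> 0"
proof -
  have ne: "gen_point n r l i - gen_point n r l j \<noteq> 0" if "(i, j) \<in> lt_pairs n" for i j
    unfolding gen_point_diff[OF l that] by (rule gen) (use that in \<open>auto simp: lt_pairs_def\<close>)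
  have "gen_point n r l i - gen_point n r l j \<noteq> 0" if "(i, j) \<in> same_pairs n" for i j
  proof (cases "i < j")
    case True
    then have "(i, j) \<in> lt_pairs n" using that by (auto simp: same_pairs_def lt_pairs_def)
    then show ?thesis by (rule ne)
  next
    case False
    then have "(j, i) \<in> lt_pairs n" using that by (auto simp: same_pairs_def lt_pairs_def)
    then show ?thesis using ne[of j i] by simp
  qed
  then show ?thesis
    unfolding discr_def prod_zero_iff[OF finite_same_pairs] by (auto simp del: right_minus_eq)
qed

text \<open>If lowering \<nu> on I destroys monotonicity, there are equal neighbours with k in I and
  k + 1 not in I, and the factor for (k, k + 1) vanishes. If it would lower a zero part, consider k
  = Max I: either k = n and the factor z_n is 0, or k and k + 1 are neighbours of this kind with
  both parts 0.\<close>

lemma shift_coeff_eq_0: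
  assumes l: "\<nu> \<in> Lam n" and I: "I \<subseteq> {1..n}"
    and no: "\<And>\<kappa>. \<kappa> \<in> Lam n \<Longrightarrow> add_eps \<kappa> I \<noteq> \<nu>"
  shows "shift_coeff n r I (gen_point n r \<nu>) = 0"
proof -
  have fin: "finite I" using I finite_subset by blast
  have adj: "shift_num n r I (gen_point n r \<nu>) = 0"
    if k: "1 \<le> k" "k < n" "k \<in> I" "Suc k \<notin> I" "\<nu> k = \<nu> (Suc k)" for k
  proof -
    have "n - k = Suc (n - Suc k)" using k by simp
    then have "gen_point n r \<nu> k - gen_point n r \<nu> (Suc k) - r = 0"
      using k by (simp add: gen_point_def rho_def algebra_simps)
    moreover have m: "(k, Suc k) \<in> {(i, j) \<in> cross_pairs n I. odd (i + j)}"
      using k by (auto simp: cross_pairs_def)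
    moreover have f: "finite {(i, j) \<in> cross_pairs n I. odd (i + j)}"
      by (rule finite_subset[OF _ finite_cross_pairs[OF I]]) auto
    ultimately have "(\<Prod>(i, j)\<in>{(i, j) \<in> cross_pairs n I. odd (i + j)}.
        gen_point n r \<nu> i - gen_point n r \<nu> j - r) = 0"
      by (intro prod_zero[OF f bexI[OF _ m]]) simp
    then show ?thesis by (simp add: shift_num_def)
  qed
  have "shift_num n r I (gen_point n r \<nu>) = 0"
  proof (cases "\<exists>i\<in>I. \<nu> i = 0")
    case True
    then obtain i where i: "i \<in> I" "\<nu> i = 0" by auto
    define k where "k = Max I"
    have k: "k \<in> I" "i \<le> k" using i fin by (auto simp: k_def intro!: Max_in)
    then have kn: "1 \<le> k" "k \<le> n" "1 \<le> i" using I i by auto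
    have z: "\<nu> j = 0" if "k \<le> j" "j \<le> n" for j
      using Lam_antimono[OF l, of i j] that k i kn by simp
    show ?thesis
    proof (cases "k = n")
      case True
      have "gen_point n r \<nu> n = 0" using z[of n] kn by (simp add: gen_point_def rho_def True)
      then have "(\<Prod>i\<in>{i \<in> I. even (n + i)}. gen_point n r \<nu> i) = 0"
        using k True fin by (intro prod_zero) auto
      then show ?thesis by (simp add: shift_num_def)
    next
      case False
      have "Suc k \<notin> I" using Max_ge[OF fin, of "Suc k"] by (auto simp: k_def)
      then show ?thesis using adj[of k] kn k z[of k] z[of "Suc k"] False by simp
    qed
  next
    case False
    define \<kappa> where "\<kappa> i = \<nu> i - (if i \<in> I then 1 else 0)" for i
    have e: "add_eps \<kappa> I = \<nu>"
      using False by (auto simp: add_eps_def \<kappa>_def fun_eq_iff)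
    have "\<kappa> \<notin> Lam n" using no e by blast
    moreover have "\<kappa> i = 0" if "i \<notin> {1..n}" for i
      using Lam_outside[OF l that] by (simp add: \<kappa>_def)
    ultimately obtain k where k: "1 \<le> k" "k < n" "\<kappa> k < \<kappa> (Suc k)"
      using LamI[of n \<kappa>] by (metis not_le)
    moreover have "\<nu> (Suc k) \<le> \<nu> k" using Lam_antimono[OF l, of k "Suc k"] k by simp
    ultimately have "k \<in> I" "Suc k \<notin> I" "\<nu> k = \<nu> (Suc k)"
      using False by (auto simp: \<kappa>_def split: if_splits)
    then show ?thesis using adj k by blast
  qed
  then show ?thesis by (simp add: shift_coeff_def)
qed

section \<open>Specialisation of the parameter\<close>

text \<open>The relation behind \<open>ratfun_value\<close>. Values are assembled by introduction
  rules and compared by \<open>regular_at_unique\<close>.\<close>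

definition regular_at :: "'a::field \<Rightarrow> 'a poly fract \<Rightarrow> 'a \<Rightarrow> bool" where
  "regular_at r f c \<longleftrightarrow> (\<exists>p q. poly q r \<noteq> 0 \<and> f = Fract p q \<and> c = poly p r / poly q r)"

lemma regular_atE:
  assumes "regular_at r f c"
  obtains p q where "poly q r \<noteq> 0" "q \<noteq> 0" "f = Fract p q" "c = poly p r / poly q r"
  using assms unfolding regular_at_def by fastforce

lemma regular_atI: "poly q r \<noteq> 0 \<Longrightarrow> f = Fract p q \<Longrightarrow> c = poly p r / poly q r \<Longrightarrow> regular_at r f c"
  unfolding regular_at_def by blast

lemma regular_at_unique:
  assumes "regular_at r f c" "regular_at r f d"
  shows "c = d"
proof -
  obtain p q where 1: "poly q r \<noteq> 0" "q \<noteq> 0" "f = Fract p q" "c = poly p r / poly q r"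
    using assms(1) by (rule regular_atE)
  obtain p' q' where 2: "poly q' r \<noteq> 0" "q' \<noteq> 0" "f = Fract p' q'" "d = poly p' r / poly q' r"
    using assms(2) by (rule regular_atE)
  have "p * q' = p' * q" using 1 2 by (simp add: eq_fract)
  then have "poly p r * poly q' r = poly p' r * poly q r" by (metis poly_mult)
  then show ?thesis using 1 2 by (simp add: frac_eq_eq)
qed

lemma regular_at_add:
  assumes "regular_at r f c" "regular_at r g d"
  shows "regular_at r (f + g) (c + d)"
proof -
  obtain p q where 1: "poly q r \<noteq> 0" "q \<noteq> 0" "f = Fract p q" "c = poly p r / poly q r"
    using assms(1) by (rule regular_atE)
  obtain p' q' where 2: "poly q' r \<noteq> 0" "q' \<noteq> 0" "g = Fract p' q'" "d = poly p' r / poly q' r"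
    using assms(2) by (rule regular_atE)
  show ?thesis
    by (rule regular_atI[of "q * q'" _ _ "p * q' + p' * q"])
      (use 1 2 in \<open>simp_all add: add_frac_eq\<close>)
qed

lemma regular_at_mult:
  assumes "regular_at r f c" "regular_at r g d"
  shows "regular_at r (f * g) (c * d)"
proof -
  obtain p q where 1: "poly q r \<noteq> 0" "q \<noteq> 0" "f = Fract p q" "c = poly p r / poly q r"
    using assms(1) by (rule regular_atE)
  obtain p' q' where 2: "poly q' r \<noteq> 0" "q' \<noteq> 0" "g = Fract p' q'" "d = poly p' r / poly q' r"
    using assms(2) by (rule regular_atE)
  show ?thesis
    by (rule regular_atI[of "q * q'" _ _ "p * p'"]) (use 1 2 in simp_all)
qed

lemma regular_at_inverse:
  assumes "regular_at r f c" "c \<noteq> 0"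
  shows "regular_at r (inverse f) (inverse c)"
proof -
  obtain p q where 1: "poly q r \<noteq> 0" "q \<noteq> 0" "f = Fract p q" "c = poly p r / poly q r"
    using assms(1) by (rule regular_atE)
  show ?thesis
    by (rule regular_atI[of p _ _ q]) (use 1 assms(2) in simp_all)
qed

lemma regular_at_poly: "regular_at r (Fract p 1) (poly p r)"
  by (rule regular_atI[of 1]) simp_all

lemma Fract_morphism: "ring_morphism (\<lambda>p :: 'a::idom. Fract p 1)"
  by standard (auto simp: One_fract_def)

lemma regular_at_of_nat: "regular_at r (of_nat k) (of_nat k)"
  using regular_at_poly[of r "of_nat k"] by (simp add: ring_morphism.map_of_nat[OF Fract_morphism])

lemma regular_at_zero: "regular_at r 0 0"
  using regular_at_of_nat[of r 0] by simp

lemma regular_at_one: "regular_at r 1 1"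
  using regular_at_of_nat[of r 1] by simp

lemma regular_at_var: "regular_at r (Fract [:0, 1:] 1) r"
  using regular_at_poly[of r "[:0, 1:]"] by simp

lemma regular_at_if:
  "(P \<Longrightarrow> regular_at r f c) \<Longrightarrow> (\<not> P \<Longrightarrow> regular_at r g d) \<Longrightarrow>
    regular_at r (if P then f else g) (if P then c else d)"
  by simp

lemma regular_at_sum:
  "(\<And>x. x \<in> A \<Longrightarrow> regular_at r (f x) (c x)) \<Longrightarrow> regular_at r (\<Sum>x\<in>A. f x) (\<Sum>x\<in>A. c x)"
  by (induction A rule: infinite_finite_induct) (auto simp: regular_at_zero regular_at_add)

lemma regular_at_prod:
  "(\<And>x. x \<in> A \<Longrightarrow> regular_at r (f x) (c x)) \<Longrightarrow> regular_at r (\<Prod>x\<in>A. f x) (\<Prod>x\<in>A. c x)"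
  by (induction A rule: infinite_finite_induct) (auto simp: regular_at_one regular_at_mult)

lemma regular_at_power: "regular_at r f c \<Longrightarrow> regular_at r (f ^ k) (c ^ k)"
  by (induction k) (auto simp: regular_at_one regular_at_mult)

lemma regular_at_linear:
  "regular_at r (of_nat a + of_nat b * Fract [:0, 1:] 1) (of_nat a + of_nat b * r)"
  by (intro regular_at_add regular_at_mult regular_at_of_nat regular_at_var)

text \<open>If the form were 0, its values at 0 and at 1 would be 0 as well. So the indeterminate
  satisfies the hypothesis \<open>gen\<close> of \<open>shift_coeff_hook\<close>.\<close>

lemma generic_var:
  fixes a b :: nat
  assumes "a + b > 0"
  shows "of_nat a + of_nat b * Fract [:0, 1:] 1 \<noteq> (0 :: 'a::field_char_0 poly fract)"
proof
  assume *: "of_nat a + of_nat b * Fract [:0, 1:] 1 = (0 :: 'a poly fract)"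
  have "of_nat a + of_nat b * s = 0" for s :: 'a
    using regular_at_unique[OF regular_at_linear[of s a b, unfolded *] regular_at_zero] .
  from this[of 0] this[of 1] have "a = 0" "b = 0" by (auto simp flip: of_nat_add)
  with assms show False by simp
qed

lemma regular_at_rise:
  "regular_at r (rise (of_nat a * Fract [:0, 1:] 1) d) (rise (of_nat a * r) d)"
  unfolding rise_def by (intro regular_at_prod regular_at_linear)

lemma rise_nonzero:
  fixes r :: "'a::field"
  assumes "\<And>a b. a > 0 \<Longrightarrow> of_nat a + of_nat b * r \<noteq> 0"
  shows "rise (of_nat a * r) d \<noteq> 0"
  unfolding rise_def using assms by (simp del: of_nat_Suc)

lemma hook_nonzero:
  fixes r :: "'a::field"
  assumes "\<And>a b. a > 0 \<Longrightarrow> of_nat a + of_nat b * r \<noteq> 0"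
  shows "hook n r l \<noteq> 0"
  unfolding hook_def using rise_nonzero[OF assms] by (auto split: if_splits simp del: of_nat_diff)

text \<open>The factors of \<open>rise\<close> are of the form a + b r with a > 0, so inverting them
  creates no pole at \<open>r\<close>; r = 0 does no harm here.\<close>

lemma regular_at_hook:
  fixes r :: "'a::field"
  assumes "\<And>a b. a > 0 \<Longrightarrow> of_nat a + of_nat b * r \<noteq> 0"
  shows "regular_at r (hook n (Fract [:0, 1:] 1) l) (hook n r l)"
  unfolding hook_def
proof (intro regular_at_mult regular_at_prod regular_at_rise)
  fix p
  show "regular_at r
      (case p of (i, j) \<Rightarrow> if odd (j - i) then rise (of_nat (j - i - 1) * Fract [:0, 1:] 1) (l i - l j)
        else inverse (rise (of_nat (j - i) * Fract [:0, 1:] 1) (l i - l j)))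
      (case p of (i, j) \<Rightarrow> if odd (j - i) then rise (of_nat (j - i - 1) * r) (l i - l j)
        else inverse (rise (of_nat (j - i) * r) (l i - l j)))"
    unfolding split_beta
    by (intro regular_at_if regular_at_rise regular_at_inverse rise_nonzero[OF assms])
qed

section \<open>Powers of the indeterminate in the coefficients at r = 0\<close>

lemma sum_alternating_interval:
  "a \<le> b \<Longrightarrow> (\<Sum>i\<in>{a..b}. (-1::int) ^ i) = (if even (b - a) then (-1) ^ a else 0)"
proof (induction b rule: dec_induct)
  case (step k)
  then show ?case by (cases "even (k - a)"; cases "even a") (auto simp: Suc_diff_le)
qed simp

text \<open>In a block of equal parts of \<open>\<lambda>\<close> the set \<open>I\<close> is a final segment. Hence the block contributes
  to the difference of the two counts a product of alternating sums over two adjacent intervals,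
  which is 0 or -1.\<close>

lemma card_equal_psi_pairs_le:
  assumes k: "\<kappa> \<in> Lam n" and l: "add_eps \<kappa> I \<in> Lam n"
  defines "Z \<equiv> {(i, j) \<in> psi_pairs n I. add_eps \<kappa> I i = add_eps \<kappa> I j}"
  shows "card {(i, j) \<in> Z. even (j - i)} \<le> card {(i, j) \<in> Z. odd (j - i)}"
proof -
  define l where "l = add_eps \<kappa> I"
  have lI: "l i = \<kappa> i + (if i \<in> I then 1 else 0)" for i by (simp add: l_def add_eps_def)
  have fin: "finite Z" by (rule finite_subset[OF _ finite_psi_pairs[of n I]]) (auto simp: Z_def)
  define f where "f = (\<lambda>(i, j). (-1::int) ^ i * (-1) ^ j)"
  have blk: "(\<Sum>p\<in>{p \<in> Z. l (fst p) = v}. f p) \<le> 0" for v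
  proof -
    define A where "A = {i \<in> {1..n}. l i = v \<and> i \<notin> I}"
    define B where "B = {i \<in> {1..n}. l i = v \<and> i \<in> I}"
    have fAB: "finite A" "finite B" by (auto simp: A_def B_def)
    \<comment> \<open>Otherwise \<kappa>_i \<le> \<kappa>_j, whereas equal entries of \<lambda> mean
      \<kappa>_i = \<kappa>_j + 1.\<close>
    have lt: "i < j" if "i \<in> A" "j \<in> B" for i j
    proof (rule ccontr)
      assume "\<not> i < j"
      moreover have "i \<noteq> j" using that by (auto simp: A_def B_def)
      ultimately have "\<kappa> i \<le> \<kappa> j" using Lam_antimono[OF k, of j i] that by (auto simp: A_def B_def)
      then show False using that lI[of i] lI[of j] by (auto simp: A_def B_def)
    qed
    have mid: "l x = v" if "l a = v" "l b = v" "a \<le> x" "x \<le> b" "1 \<le> a" "b \<le> n" for a b x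
      using Lam_antimono[OF l[folded l_def], of a x] Lam_antimono[OF l[folded l_def], of x b] that by auto
    have "{p \<in> Z. l (fst p) = v} = A \<times> B"
    proof (intro equalityI subsetI)
      fix p assume "p \<in> {p \<in> Z. l (fst p) = v}"
      then show "p \<in> A \<times> B"
        by (auto simp: Z_def A_def B_def psi_pairs_def l_def)
    next
      fix p assume p: "p \<in> A \<times> B"
      then have "fst p < snd p" using lt by auto
      then show "p \<in> {p \<in> Z. l (fst p) = v}"
        using p by (auto simp: Z_def A_def B_def psi_pairs_def l_def)
    qed
    then have eq: "(\<Sum>p\<in>{p \<in> Z. l (fst p) = v}. f p) = (\<Sum>i\<in>A. (-1) ^ i) * (\<Sum>j\<in>B. (-1) ^ j)"
      by (simp add: sum.cartesian_product f_def sum_product)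
    show ?thesis
    proof (cases "A = {} \<or> B = {}")
      case True
      then show ?thesis unfolding eq by auto
    next
      case False
      define a b c d where "a = Min A" and "b = Max A" and "c = Min B" and "d = Max B"
      have m: "a \<in> A" "b \<in> A" "c \<in> B" "d \<in> B" "a \<le> b" "c \<le> d"
        using False fAB by (auto simp: a_def b_def c_def d_def)
      have "A = {a..b}"
      proof (intro equalityI subsetI)
        fix x assume "x \<in> A" then show "x \<in> {a..b}" using fAB by (auto simp: a_def b_def)
      next
        fix x assume x: "x \<in> {a..b}"
        then have "l x = v" "x \<in> {1..n}" using mid[of a b x] m by (auto simp: A_def)
        moreover have "x \<notin> I"
          using lt[OF m(2), of x] x calculation by (auto simp: B_def)
        ultimately show "x \<in> A" by (simp add: A_def)
      qed
      moreover have "B = {c..d}"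
      proof (intro equalityI subsetI)
        fix x assume "x \<in> B" then show "x \<in> {c..d}" using fAB by (auto simp: c_def d_def)
      next
        fix x assume x: "x \<in> {c..d}"
        then have "l x = v" "x \<in> {1..n}" using mid[of c d x] m by (auto simp: B_def)
        moreover have "x \<in> I"
          using lt[OF _ m(3), of x] x calculation by (auto simp: A_def)
        ultimately show "x \<in> B" by (simp add: B_def)
      qed
      moreover have "c = Suc b"
      proof -
        have bc: "b < c" using lt m by blast
        then have y: "l (Suc b) = v" "Suc b \<in> {1..n}" using mid[of b c "Suc b"] m by (auto simp: A_def B_def)
        have "Suc b \<notin> A" using Max_ge[OF fAB(1), of "Suc b"] by (auto simp: b_def)
        then have "Suc b \<in> B" using y by (simp add: A_def B_def)
        then have "c \<le> Suc b" using fAB by (simp add: c_def)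
        with bc show ?thesis by simp
      qed
      ultimately have "(\<Sum>i\<in>A. (-1::int) ^ i) = (if even (b - a) then (-1) ^ a else 0)"
        "(\<Sum>j\<in>B. (-1::int) ^ j) = (if even (d - c) then (-1) ^ Suc b else 0)"
        using sum_alternating_interval[OF m(5)] sum_alternating_interval[OF m(6)] by simp_all
      moreover have "even a \<longleftrightarrow> even b" if "even (b - a)" using that m(5) by simp
      ultimately show ?thesis unfolding eq by (cases "even a") auto
    qed
  qed
  have "(\<Sum>p\<in>Z. f p) = (\<Sum>v\<in>(l \<circ> fst) ` Z. \<Sum>p\<in>{p \<in> Z. (l \<circ> fst) p = v}. f p)"
    by (rule sum.image_gen[OF fin])
  also have "\<dots> \<le> 0" by (rule sum_nonpos) (simp add: blk)
  finally have le: "(\<Sum>p\<in>Z. f p) \<le> 0" .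
  let ?E = "{(i, j) \<in> Z. even (j - i)}" and ?O = "{(i, j) \<in> Z. odd (j - i)}"
  have f: "f (i, j) = (if even (j - i) then 1 else -1)" if "(i, j) \<in> Z" for i j
  proof -
    have "i \<le> j" using that by (auto simp: Z_def psi_pairs_def)
    then show ?thesis by (cases "even i"; cases "even j") (auto simp: f_def)
  qed
  have "Z = ?E \<union> ?O" by auto
  then have "(\<Sum>p\<in>Z. f p) = (\<Sum>p\<in>?E \<union> ?O. f p)" by simp
  also have "\<dots> = (\<Sum>p\<in>?E. f p) + (\<Sum>p\<in>?O. f p)"
    by (rule sum.union_disjoint) (auto intro: finite_subset[OF _ fin])
  also have "(\<Sum>p\<in>?E. f p) = (\<Sum>p\<in>?E. 1)" by (rule sum.cong) (auto simp: f)
  also have "(\<Sum>p\<in>?O. f p) = (\<Sum>p\<in>?O. - 1)" by (rule sum.cong) (auto simp: f)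
  finally show ?thesis using le by simp
qed

text \<open>For nonzero r every factor specialises by itself. For r = 0 the factor formed with
  \<kappa> keeps a nonzero value because \<kappa>_i > \<kappa>_j, and the one formed with \<lambda>
  is a multiple of t exactly when \<lambda>_i = \<lambda>_j. These powers of t are collected in
  \<open>e\<close>, and \<open>card_equal_psi_pairs_le\<close> makes their total exponent
  nonnegative.\<close>

lemma regular_at_psi:
  fixes r :: "'a::field_char_0"
  assumes nn: "\<And>a b. a > 0 \<Longrightarrow> of_nat a + of_nat b * r \<noteq> 0"
    and k: "\<kappa> \<in> Lam n" and l: "add_eps \<kappa> I \<in> Lam n"
  shows "regular_at r (psi_formula n (Fract [:0, 1:] 1) \<kappa> I) (psi_even n r \<kappa> I)"
proof (cases "r = 0")
  case False
  have gen: "of_nat a + of_nat b * r \<noteq> 0" if "a + b > 0" for a b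
    using nn[of a b] that False by (cases "a = 0") auto
  have "regular_at r (psi_formula n (Fract [:0, 1:] 1) \<kappa> I) (psi_formula n r \<kappa> I)"
    unfolding psi_formula_prod
  proof (rule regular_at_prod)
    fix p assume p: "p \<in> psi_pairs n I"
    obtain i j where ij: "p = (i, j)" by (cases p)
    have t: "1 \<le> i" "i < j" "j \<le> n" using p by (auto simp: ij psi_pairs_def)
    have d: "of_nat (\<kappa> i) - of_nat (\<kappa> j) = (of_nat (\<kappa> i - \<kappa> j) :: 'b::comm_ring_1)"
      "of_nat (add_eps \<kappa> I i) - of_nat (add_eps \<kappa> I j) = (of_nat (add_eps \<kappa> I i - add_eps \<kappa> I j) :: 'b::comm_ring_1)"
      using Lam_antimono[OF k, of i j] Lam_antimono[OF l, of i j] t by (simp_all add: of_nat_diff)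
    show "regular_at r (psi_factor (Fract [:0, 1:] 1) \<kappa> (add_eps \<kappa> I) (fst p) (snd p))
        (psi_factor r \<kappa> (add_eps \<kappa> I) (fst p) (snd p))"
      unfolding ij fst_conv snd_conv psi_factor_def d
    proof (intro regular_at_if regular_at_inverse regular_at_mult regular_at_linear)
      show "(of_nat (\<kappa> i - \<kappa> j) + of_nat (j - i) * r) *
           (of_nat (add_eps \<kappa> I i - add_eps \<kappa> I j) + of_nat (j - i) * r) \<noteq> 0"
        using gen[of _ "j - i"] t(2) by simp
    qed
  qed
  with False show ?thesis by (simp add: psi_even_def)
next
  case True
  define t where "t = (Fract [:0, 1:] 1 :: 'a poly fract)"
  define l where "l = add_eps \<kappa> I"
  note lL = l[folded l_def]
  define Z where "Z = {(i, j) \<in> psi_pairs n I. l i = l j}"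
  define e where "e p = (if p \<in> Z then if odd (snd p - fst p) then t else inverse t else 1)" for p
  let ?\<psi> = "\<lambda>p. psi_factor t \<kappa> l (fst p) (snd p)"
  have lin: "regular_at 0 (of_nat a + of_nat b * t) (of_nat a)" for a b
    using regular_at_linear[of 0 a b] by (simp add: t_def)
  define Q where "Q p u c \<longleftrightarrow> ?\<psi> p = u * e p \<and> regular_at 0 u c" for p u c
  have *: "\<exists>u c. ?\<psi> p = u * e p \<and> regular_at 0 u c" if p: "p \<in> psi_pairs n I" for p
  proof -
    obtain i j where ij: "p = (i, j)" by (cases p)
    have ps: "1 \<le> i" "i < j" "j \<le> n" "i \<notin> I" "j \<in> I" using p by (auto simp: ij psi_pairs_def)
    then have le: "\<kappa> j < \<kappa> i" "l j \<le> l i"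
      using Lam_antimono[OF lL, of i j] by (auto simp: l_def add_eps_def)
    define a where "a = \<kappa> i - \<kappa> j"
    define b where "b = l i - l j"
    have a: "a > 0" using le by (simp add: a_def)
    have d: "of_nat (\<kappa> i) - of_nat (\<kappa> j) = (of_nat a :: 'a poly fract)"
      "of_nat (l i) - of_nat (l j) = (of_nat b :: 'a poly fract)"
      using le by (simp_all add: a_def b_def of_nat_diff)
    have \<psi>: "?\<psi> p = (if odd (j - i) then (of_nat a + of_nat (j - i - 1) * t) * (of_nat b + of_nat (j - i + 1) * t)
      else inverse (of_nat a + of_nat (j - i) * t) * inverse (of_nat b + of_nat (j - i) * t))"
      unfolding ij fst_conv snd_conv psi_factor_def d by simp
    have inv: "regular_at 0 (inverse (of_nat a + of_nat c * t)) (inverse (of_nat a))" for c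
      by (rule regular_at_inverse[OF lin]) (use a in simp)
    show ?thesis
    proof (cases "b = 0")
      case True
      then have Z: "p \<in> Z" using p le by (simp add: Z_def ij b_def)
      show ?thesis
      proof (cases "odd (j - i)")
        case o: True
        have "?\<psi> p = ((of_nat a + of_nat (j - i - 1) * t) * of_nat (j - i + 1)) * e p"
          unfolding \<psi> using o Z True by (simp add: e_def ij del: of_nat_Suc of_nat_add)
        then show ?thesis using regular_at_mult[OF lin regular_at_of_nat] by blast
      next
        case o: False
        have "?\<psi> p = (inverse (of_nat a + of_nat (j - i) * t) * inverse (of_nat (j - i))) * e p"
          unfolding \<psi> using o Z True by (simp add: e_def ij)
        moreover have "regular_at 0 (inverse (of_nat (j - i))) (inverse (of_nat (j - i) :: 'a))"
          by (rule regular_at_inverse[OF regular_at_of_nat]) (use ps in simp)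
        ultimately show ?thesis using regular_at_mult[OF inv] by blast
      qed
    next
      case False
      then have Z: "p \<notin> Z" using le by (auto simp: Z_def ij b_def)
      have invb: "regular_at 0 (inverse (of_nat b + of_nat c * t)) (inverse (of_nat b))" for c
        by (rule regular_at_inverse[OF lin]) (use False in simp)
      show ?thesis
      proof (cases "odd (j - i)")
        case o: True
        have "?\<psi> p = ((of_nat a + of_nat (j - i - 1) * t) * (of_nat b + of_nat (j - i + 1) * t)) * e p"
          unfolding \<psi> using o Z by (simp add: e_def)
        then show ?thesis using regular_at_mult[OF lin lin] by blast
      next
        case o: False
        have "?\<psi> p = (inverse (of_nat a + of_nat (j - i) * t) * inverse (of_nat b + of_nat (j - i) * t)) * e p"
          unfolding \<psi> using o Z by (simp add: e_def)
        then show ?thesis using regular_at_mult[OF inv invb] by blast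
      qed
    qed
  qed
  have "\<exists>u c. Q p u c" if "p \<in> psi_pairs n I" for p
    unfolding Q_def by (rule *[OF that])
  then obtain u c where "Q p (u p) (c p)" if "p \<in> psi_pairs n I" for p
    by metis
  then have uc: "?\<psi> p = u p * e p" "regular_at 0 (u p) (c p)" if "p \<in> psi_pairs n I" for p
    using that unfolding Q_def by blast+
  have tne: "t \<noteq> 0" using generic_var[of 0 1] by (simp add: t_def)
  let ?O = "card {(i, j) \<in> Z. odd (j - i)}" and ?E = "card {(i, j) \<in> Z. even (j - i)}"
  have fin: "finite Z" by (rule finite_subset[OF _ finite_psi_pairs[of n I]]) (auto simp: Z_def)
  have sets: "{p \<in> Z. odd (snd p - fst p)} = {(i, j) \<in> Z. odd (j - i)}"
    "{p \<in> Z. \<not> odd (snd p - fst p)} = {(i, j) \<in> Z. even (j - i)}" by auto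
  have "(\<Prod>p\<in>psi_pairs n I. e p) = (\<Prod>p\<in>Z. if odd (snd p - fst p) then t else inverse t)"
    unfolding e_def by (rule prod.mono_neutral_cong_right) (auto simp: Z_def)
  also have "\<dots> = t ^ ?O * inverse t ^ ?E"
    unfolding prod_if_split[OF fin] sets prod_constant ..
  also have "\<dots> = t ^ (?O - ?E)"
    using card_equal_psi_pairs_le[OF k l] tne
    by (simp add: Z_def l_def power_diff power_inverse divide_inverse)
  finally have E: "(\<Prod>p\<in>psi_pairs n I. e p) = t ^ (?O - ?E)" .
  have "psi_formula n t \<kappa> I = (\<Prod>p\<in>psi_pairs n I. u p * e p)"
    unfolding psi_formula_prod l_def[symmetric] by (rule prod.cong[OF refl]) (rule uc(1))
  also have "\<dots> = (\<Prod>p\<in>psi_pairs n I. u p) * t ^ (?O - ?E)"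
    by (simp only: prod.distrib E)
  \<comment> \<open>The power of 0 is 1 if the powers of t cancel, and 0 otherwise.\<close>
  finally have "regular_at 0 (psi_formula n t \<kappa> I) ((\<Prod>p\<in>psi_pairs n I. c p) * 0 ^ (?O - ?E))"
    unfolding t_def by (auto intro!: regular_at_mult regular_at_prod regular_at_power regular_at_var uc(2))
  moreover have "ratfun_value f 0 = c" if "regular_at 0 f c" for f and c :: 'a
    unfolding ratfun_value_def regular_at_def[symmetric]
    by (rule the_equality[where P = "\<lambda>c. regular_at 0 f c"]) (use that regular_at_unique in auto)
  ultimately show ?thesis using True by (simp add: psi_even_def t_def)
qed

text \<open>Applied only where the entries on \<open>I\<close> are positive, so the subtraction does
  not truncate.\<close>

definition del_eps :: "(nat \<Rightarrow> nat) \<Rightarrow> nat set \<Rightarrow> nat \<Rightarrow> nat" where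
  "del_eps \<nu> I = (\<lambda>i. \<nu> i - (if i \<in> I then 1 else 0))"

lemma del_add_eps [simp]: "del_eps (add_eps \<kappa> I) I = \<kappa>"
  by (auto simp: del_eps_def add_eps_def)

text \<open>For \<open>r = 0\<close> the denominators of the operator may vanish at \<open>\<rho> + \<nu>\<close>. Therefore the parameter
  is first replaced by an indeterminate, which is then specialised to \<open>r\<close>.\<close>

lemma eval_pieri_op_Lam:
  fixes r :: "'a::field_char_0"
  assumes nn: "\<And>a b. a > 0 \<Longrightarrow> of_nat a + of_nat b * r \<noteq> 0"
    and f: "f \<in> semisymmetric n" and \<nu>: "\<nu> \<in> Lam n"
  shows "eval_mpoly (gen_point n r \<nu>) (pieri_op n r m f) =
    (\<Sum>I\<in>{I \<in> shift_sets n m. \<exists>\<kappa>\<in>Lam n. add_eps \<kappa> I = \<nu>}.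
      psi_even n r (del_eps \<nu> I) I * hook n r \<nu> * inverse (hook n r (del_eps \<nu> I)) *
      eval_mpoly (gen_point n r (del_eps \<nu> I)) f)"
proof -
  define S where "S = {I \<in> shift_sets n m. \<exists>\<kappa>\<in>Lam n. add_eps \<kappa> I = \<nu>}"
  \<comment> \<open>The indeterminate appears twice: \<open>s\<close> lies in the polynomial ring,
    over which the operator is formed and evaluation at \<open>r\<close> is a homomorphism;
    \<open>t\<close> is its image in the fraction field, where \<open>discr\<close> can be cancelled
    at the points.\<close>
  define s where "s = ([:0, 1:] :: 'a poly)"
  define t where "t = (Fract s 1 :: 'a poly fract)"
  define emb where "emb = (\<lambda>p :: 'a poly. Fract p 1)"
  define cst where "cst = (\<lambda>c :: 'a. [:c:])"
  have emb: "ring_morphism emb" unfolding emb_def by (rule Fract_morphism)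
  have cst: "ring_morphism cst" by standard (auto simp: cst_def one_pCons)
  have ev: "ring_morphism (\<lambda>p. poly p r)" by standard auto
  let ?F = "cmap cst f"
  let ?G = "pieri_op n s m ?F"
  let ?x = "gen_point n s \<nu>"
  let ?g = "eval_mpoly ?x ?G"
  have F: "?F \<in> semisymmetric n" using cst f by (rule cmap_semisymmetric)
  have evF: "cmap (\<lambda>p. poly p r) ?F = f"
    by (rule morphism_eqI[of "\<lambda>f. cmap (\<lambda>p. poly p r) (cmap cst f)" "\<lambda>f. f"])
      (simp_all add: ring_morphism_comp ring_morphism_id cmap_morphism ev cst, simp add: cst_def)
  have evx: "poly (gen_point n s \<kappa> i) r = gen_point n r \<kappa> i" for \<kappa> i
    by (simp add: gen_point_def rho_def s_def)
  have g: "poly ?g r = eval_mpoly (gen_point n r \<nu>) (pieri_op n r m f)"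
    using map_eval_mpoly[OF ev, of ?x ?G] by (simp add: evx cmap_pieri_op[OF ev F] evF) (simp add: s_def)
  let ?X = "gen_point n t \<nu>"
  have embx: "emb (?x i) = ?X i" for i
    by (simp add: gen_point_def rho_def ring_morphism.map_add[OF emb] ring_morphism.map_mult[OF emb]
        ring_morphism.map_of_nat[OF emb]) (simp add: emb_def t_def)
  have embs: "emb s = t" by (simp add: emb_def t_def)
  let ?f = "\<lambda>I. eval_mpoly (\<lambda>i. ?x i - eps I i) ?F"
  have gent: "of_nat a + of_nat b * t \<noteq> 0" if "a + b > 0" for a b
    using generic_var[OF that, where 'a = 'a] by (simp add: t_def s_def)
  have ht: "hook n t l \<noteq> 0" for l
    by (rule hook_nonzero) (use gent in simp)
  have "discr n ?X * emb ?g = emb (discr n ?x * ?g)"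
    by (simp add: ring_morphism.map_mult[OF emb] map_discr[OF emb] embx)
  also have "\<dots> = (\<Sum>I\<in>shift_sets n m. shift_coeff n t I ?X * emb (?f I))"
    unfolding eval_pieri_op[OF F]
    by (simp add: ring_morphism.map_sum[OF emb] ring_morphism.map_mult[OF emb]
        map_shift_coeff[OF emb] embx embs)
  also have "\<dots> = (\<Sum>I\<in>S. shift_coeff n t I ?X * emb (?f I))"
  proof (rule sum.mono_neutral_right)
    show "\<forall>I\<in>shift_sets n m - S. shift_coeff n t I ?X * emb (?f I) = 0"
    proof
      fix I assume I: "I \<in> shift_sets n m - S"
      then have "I \<subseteq> {1..n}" using shift_setsD(1) by blast
      moreover have "add_eps \<kappa> I \<noteq> \<nu>" if "\<kappa> \<in> Lam n" for \<kappa> using that I by (auto simp: S_def)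
      ultimately have "shift_coeff n t I ?X = 0" by (rule shift_coeff_eq_0[OF \<nu>])
      then show "shift_coeff n t I ?X * emb (?f I) = 0" by simp
    qed
  qed (auto simp: S_def)
  also have "\<dots> = discr n ?X * (\<Sum>I\<in>S. psi_formula n t (del_eps \<nu> I) I * hook n t \<nu> *
      inverse (hook n t (del_eps \<nu> I)) * emb (?f I))"
    unfolding sum_distrib_left
  proof (rule sum.cong[OF refl])
    fix I assume "I \<in> S"
    then obtain \<kappa> where I: "I \<in> shift_sets n m" and \<kappa>: "\<kappa> \<in> Lam n" and \<nu>': "add_eps \<kappa> I = \<nu>"
      by (auto simp: S_def)
    have del: "del_eps \<nu> I = \<kappa>" unfolding \<nu>'[symmetric] by simp
    have "shift_coeff n t I ?X * hook n t \<kappa> = discr n ?X * (psi_formula n t \<kappa> I * hook n t \<nu>)"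
      using shift_coeff_hook[OF gent I \<kappa>] \<nu> \<nu>' by simp
    then have "shift_coeff n t I ?X = discr n ?X * (psi_formula n t \<kappa> I * hook n t \<nu>) * inverse (hook n t \<kappa>)"
      using ht[of \<kappa>] by (metis mult.assoc right_inverse mult_1_right)
    then show "shift_coeff n t I ?X * emb (?f I) = discr n ?X *
        (psi_formula n t (del_eps \<nu> I) I * hook n t \<nu> * inverse (hook n t (del_eps \<nu> I)) * emb (?f I))"
      unfolding del by (simp only: mult.assoc)
  qed
  finally have K: "emb ?g = (\<Sum>I\<in>S. psi_formula n t (del_eps \<nu> I) I * hook n t \<nu> *
      inverse (hook n t (del_eps \<nu> I)) * emb (?f I))"
    using discr_gen_point_nonzero[OF gent \<nu>] by (simp only: mult_left_cancel simp_thms)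
  have "regular_at r (emb ?g) (\<Sum>I\<in>S. psi_even n r (del_eps \<nu> I) I * hook n r \<nu> *
      inverse (hook n r (del_eps \<nu> I)) * eval_mpoly (gen_point n r (del_eps \<nu> I)) f)"
    unfolding K
  proof (rule regular_at_sum)
    fix I assume "I \<in> S"
    then obtain \<kappa> where I: "I \<in> shift_sets n m" and \<kappa>: "\<kappa> \<in> Lam n" and \<nu>': "add_eps \<kappa> I = \<nu>"
      by (auto simp: S_def)
    have del: "del_eps \<nu> I = \<kappa>" unfolding \<nu>'[symmetric] by simp
    have "poly (?f I) r = eval_mpoly (gen_point n r \<kappa>) f"
    proof -
      have "(\<lambda>i. poly (?x i - eps I i) r) = gen_point n r \<kappa>"
        unfolding \<nu>'[symmetric] fun_eq_iff poly_diff evx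
        by (simp add: eps_def gen_point_def add_eps_def)
      then show ?thesis
        using map_eval_mpoly[OF ev, of "\<lambda>i. ?x i - eps I i" ?F] by (simp add: evF)
    qed
    then have 4: "regular_at r (emb (?f I)) (eval_mpoly (gen_point n r \<kappa>) f)"
      using regular_at_poly[of r "?f I"] by (simp add: emb_def)
    have 1: "regular_at r (psi_formula n t \<kappa> I) (psi_even n r \<kappa> I)"
      using regular_at_psi[OF nn \<kappa>] \<nu> \<nu>' by (simp add: t_def s_def)
    have 2: "regular_at r (hook n t l) (hook n r l)" for l
      using regular_at_hook[OF nn] by (simp add: t_def s_def)
    show "regular_at r (psi_formula n t (del_eps \<nu> I) I * hook n t \<nu> *
        inverse (hook n t (del_eps \<nu> I)) * emb (?f I))
      (psi_even n r (del_eps \<nu> I) I * hook n r \<nu> * inverse (hook n r (del_eps \<nu> I)) *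
        eval_mpoly (gen_point n r (del_eps \<nu> I)) f)"
      unfolding del by (intro regular_at_mult regular_at_inverse 1 2 4 hook_nonzero[OF nn])
  qed
  \<comment> \<open>The same element comes from a polynomial, whose value at \<open>r\<close> is the
    one sought.\<close>
  moreover have "regular_at r (emb ?g) (poly ?g r)"
    unfolding emb_def by (rule regular_at_poly)
  ultimately show ?thesis
    unfolding g[symmetric] S_def[symmetric] by (rule regular_at_unique[rotated])
qed

section \<open>The exponents \<open>[\<lambda>]\<close>\<close>

text \<open>Downward induction: by \<open>asum_rec\<close> the tail sum at k is \<lambda>_k minus a
  number between 0 and \<lambda>_(k+1). It follows that \<open>alt_tail\<close> does not
  truncate.\<close>

lemma asum_bounds:
  assumes l: "l \<in> Lam n" and k: "1 \<le> k" "k \<le> n"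
  shows "0 \<le> asum n l k \<and> asum n l k \<le> int (l k)"
  using k(2)
proof (induction rule: inc_induct)
  case base
  show ?case by (simp add: asum_rec asum_beyond)
next
  case (step j)
  have "asum n l j = int (l j) - asum n l (Suc j)" using step by (intro asum_rec) simp
  moreover have "l (Suc j) \<le> l j" using Lam_antimono[OF l, of j "Suc j"] step k by simp
  ultimately show ?case using step by linarith
qed

lemma int_lookup_alt_mono:
  assumes "l \<in> Lam n" "k \<in> {1..n}"
  shows "int (lookup (alt_mono n l) k) = asum n l k"
  using assms asum_bounds[of l n k] by (simp add: lookup_alt_mono alt_tail_asum)

lemma lookup_alt_mono_outside: "k \<notin> {1..n} \<Longrightarrow> lookup (alt_mono n l) k = 0"
  by (simp add: lookup_alt_mono del: atLeastAtMost_iff)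

lemma asum_add_eps: "asum n (add_eps \<kappa> I) k = asum n \<kappa> k + asum n (ind I) k"
  unfolding asum_add[symmetric] by (rule asum_cong) (simp add: add_eps_def ind_def)

lemma alt_mono_add_column:
  assumes k: "\<kappa> \<in> Lam n" and l: "add_eps \<kappa> {1..m} \<in> Lam n" and m: "m \<le> n"
  shows "alt_mono n (add_eps \<kappa> {1..m}) = alt_mono n (column m) + alt_mono n \<kappa>"
proof (rule poly_mapping_eqI)
  fix j
  show "lookup (alt_mono n (add_eps \<kappa> {1..m})) j =
      lookup (alt_mono n (column m) + alt_mono n \<kappa>) j"
  proof (cases "j \<in> {1..n}")
    case True
    have "int (lookup (alt_mono n (add_eps \<kappa> {1..m})) j) =
        int (lookup (alt_mono n (column m) + alt_mono n \<kappa>) j)"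
      using int_lookup_alt_mono[OF k True] int_lookup_alt_mono[OF l True] lookup_alt_mono_column[OF m True]
      by (simp only: lookup_add of_nat_add asum_add_eps ind_atLeastAtMost)
    then show ?thesis by (simp only: of_nat_eq_iff)
  next
    case False
    show ?thesis by (simp only: lookup_add lookup_alt_mono_outside[OF False] add_0_right)
  qed
qed

text \<open>After exchanging the summations the coefficient of \<lambda>_j is an alternating sum of
  j signs ending in +1, which is 1 for odd j and 0 for even j.\<close>

lemma mono_degree_alt_mono:
  assumes l: "l \<in> Lam n"
  shows "mono_degree (alt_mono n l) = odd_size n l"
proof -
  have "mono_degree (alt_mono n l) = (\<Sum>k\<in>{1..n}. lookup (alt_mono n l) k)"
    by (rule mono_degree_superset) (simp, metis in_keys_iff lookup_alt_mono_outside subsetI)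
  then have "int (mono_degree (alt_mono n l)) = (\<Sum>k\<in>{1..n}. asum n l k)"
    by (simp add: int_lookup_alt_mono[OF l])
  also have "\<dots> = (\<Sum>k\<in>{1..n}. \<Sum>j\<in>{1..n}. if k \<le> j then (-1) ^ (j - k) * int (l j) else 0)"
    unfolding asum_def
  proof (rule sum.cong[OF refl])
    fix k assume k: "k \<in> {1..n}"
    then have "{j \<in> {1..n}. k \<le> j} = {k..n}" by auto
    then show "(\<Sum>j=k..n. (-1) ^ (j - k) * int (l j)) =
        (\<Sum>j\<in>{1..n}. if k \<le> j then (-1) ^ (j - k) * int (l j) else 0)"
      using sum.inter_filter[of "{1..n}" "\<lambda>j. (-1) ^ (j - k) * int (l j)" "\<lambda>j. k \<le> j"] by simp
  qed
  also have "\<dots> = (\<Sum>j\<in>{1..n}. \<Sum>k\<in>{1..n}. if k \<le> j then (-1) ^ (j - k) * int (l j) else 0)"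
    by (rule sum.swap)
  also have "\<dots> = (\<Sum>j\<in>{1..n}. if odd j then int (l j) else 0)"
  proof (rule sum.cong[OF refl])
    fix j assume j: "j \<in> {1..n}"
    then have "{k \<in> {1..n}. k \<le> j} = {1..j}" by auto
    then have "(\<Sum>k\<in>{1..n}. if k \<le> j then (-1) ^ (j - k) * int (l j) else 0) =
        (\<Sum>k\<in>{1..j}. (-1) ^ (j - k) * int (l j))"
      using sum.inter_filter[of "{1..n}" "\<lambda>k. (-1) ^ (j - k) * int (l j)" "\<lambda>k. k \<le> j"] by simp
    also have "\<dots> = (\<Sum>k\<in>{1..j}. (-1) ^ (j - k)) * int (l j)" by (simp add: sum_distrib_right)
    also have "(\<Sum>k\<in>{1..j}. (-1::int) ^ (j - k)) = (if odd j then 1 else 0)"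
    proof (induction j)
      case (Suc j)
      have "(\<Sum>k\<in>{1..Suc j}. (-1::int) ^ (Suc j - k)) = (\<Sum>k\<in>{1..j}. (-1) ^ (Suc j - k)) + 1"
        by simp
      also have "(\<Sum>k\<in>{1..j}. (-1::int) ^ (Suc j - k)) = - (\<Sum>k\<in>{1..j}. (-1) ^ (j - k))"
        unfolding sum_negf[symmetric] by (rule sum.cong) (auto simp: Suc_diff_le)
      finally show ?case using Suc by simp
    qed simp
    finally show "(\<Sum>k\<in>{1..n}. if k \<le> j then (-1) ^ (j - k) * int (l j) else 0) =
        (if odd j then int (l j) else 0)" by simp
  qed
  also have "\<dots> = int (odd_size n l)"
    using sum.inter_filter[of "{1..n}" "\<lambda>j. int (l j)" odd] by (simp add: odd_size_def)
  finally show ?thesis by simp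
qed

lemma pieri_sets_iff: "I \<in> pieri_sets n \<mu> m \<longleftrightarrow> I \<in> shift_sets n m \<and> add_eps \<mu> I \<in> Lam n"
  by (auto simp: pieri_sets_def shift_sets_def)

lemma finite_pieri_sets [simp]: "finite (pieri_sets n \<mu> m)"
  by (rule finite_subset[OF _ finite_shift_sets[of n m]]) (auto simp: pieri_sets_iff)

lemma odd_size_add_eps:
  assumes "I \<in> shift_sets n m"
  shows "odd_size n (add_eps \<kappa> I) = odd_size n \<kappa> + (m + 1) div 2"
proof -
  have "(\<Sum>i\<in>{i \<in> {1..n}. odd i}. if i \<in> I then 1 else (0::nat)) = (\<Sum>i\<in>{i \<in> I. odd i}. 1)"
    by (rule sum.mono_neutral_cong_right) (use shift_setsD(1)[OF assms] in auto)
  also have "\<dots> = (m + 1) div 2" using assms by (simp add: shift_sets_def)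
  finally show ?thesis by (simp add: odd_size_def add_eps_def sum.distrib)
qed

text \<open>The two exponents differ by the tail sums of I and of {1..m}, which agree up to the
  first missing index k. One more step of the recursion makes the sum for I smaller by 1 at k + 1;
  as tail sums beyond n are 0, this also gives k < n.\<close>

lemma alt_mono_add_eps_grless:
  assumes k: "\<kappa> \<in> Lam n" and I: "I \<in> pieri_sets n \<kappa> m" and ne: "I \<noteq> {1..m}"
    and m: "m \<le> n" and l: "add_eps \<kappa> {1..m} \<in> Lam n"
  shows "grless (alt_mono n (add_eps \<kappa> I)) (alt_mono n (add_eps \<kappa> {1..m}))"
proof -
  have I': "I \<in> shift_sets n m" "add_eps \<kappa> I \<in> Lam n" using I by (auto simp: pieri_sets_iff)
  let ?s = "asum n (ind I)" and ?t = "asum n (column m)"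
  obtain k where k: "k \<in> {1..m}" "k \<notin> I" and st': "\<forall>j\<in>{1..k}. ?s j = ?t j"
    using first_missing[OF I'(1) ne m] by auto
  have st: "?s j = ?t j" if "1 \<le> j" "j \<le> k" for j using st' that by simp
  have d: "?s (Suc k) < ?t (Suc k)"
  proof -
    have "k \<le> n" using k m by simp
    then have "?s k = int (ind I k) - ?s (Suc k)" "?t k = int (column m k) - ?t (Suc k)"
      by (rule asum_rec)+
    moreover have "ind I k = 0" "column m k = 1" using k by (auto simp: ind_def column_def)
    moreover have "?s k = ?t k" using st[of k] k by simp
    ultimately show ?thesis by linarith
  qed
  have kn: "Suc k \<in> {1..n}"
  proof (rule ccontr)
    assume "Suc k \<notin> {1..n}"
    then have "?s (Suc k) = 0" "?t (Suc k) = 0" by (simp_all add: asum_beyond)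
    with d show False by simp
  qed
  have e: "int (lookup (alt_mono n (add_eps \<kappa> I)) j) + ?t j =
      int (lookup (alt_mono n (add_eps \<kappa> {1..m})) j) + ?s j" if "j \<in> {1..n}" for j
    using int_lookup_alt_mono[OF l that] int_lookup_alt_mono[OF I'(2) that]
    unfolding asum_add_eps ind_atLeastAtMost by linarith
  show ?thesis
    unfolding grless_def mono_less_iff
  proof (intro disjI2 conjI exI[of _ "Suc k"] allI impI)
    show "mono_degree (alt_mono n (add_eps \<kappa> I)) = mono_degree (alt_mono n (add_eps \<kappa> {1..m}))"
      unfolding mono_degree_alt_mono[OF l] mono_degree_alt_mono[OF I'(2)]
        odd_size_add_eps[OF I'(1)] odd_size_add_eps[OF initial_in_shift_sets[OF m]] by (rule refl)
    show "lookup (alt_mono n (add_eps \<kappa> I)) (Suc k) <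
        lookup (alt_mono n (add_eps \<kappa> {1..m})) (Suc k)"
      using e[OF kn] d by linarith
    show "lookup (alt_mono n (add_eps \<kappa> I)) j =
        lookup (alt_mono n (add_eps \<kappa> {1..m})) j" if "j < Suc k" for j
    proof (cases "j \<in> {1..n}")
      case True
      then have "?s j = ?t j" using st[of j] that by simp
      with e[OF True] show ?thesis by linarith
    next
      case False
      show ?thesis by (simp only: lookup_alt_mono_outside[OF False])
    qed
  qed
qed

section \<open>Finiteness and induction along leading exponents\<close>

lemma odd_size_zero_iff:
  assumes "l \<in> Lam n" "odd_size n l = 0"
  shows "l = (\<lambda>_. 0)"
proof
  fix i
  show "l i = 0"
  proof (cases "i \<in> {1..n}")
    case True
    then have "l 1 \<le> odd_size n l"
      unfolding odd_size_def by (intro member_le_sum) auto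
    moreover have "l i \<le> l 1" using Lam_antimono[OF assms(1), of 1 i] True by simp
    ultimately show ?thesis using assms(2) by simp
  qed (rule Lam_outside[OF assms(1)])
qed

lemma finite_Lam: "finite {l \<in> Lam n. odd_size n l \<le> d}"
proof (rule finite_subset)
  show "{l \<in> Lam n. odd_size n l \<le> d} \<subseteq> {l. \<forall>i. (i \<in> {1..n} \<longrightarrow> l i \<in> {..d}) \<and> (i \<notin> {1..n} \<longrightarrow> l i = 0)}"
  proof (intro subsetI CollectI allI conjI impI)
    fix l i assume l: "l \<in> {l \<in> Lam n. odd_size n l \<le> d}"
    then have L: "l \<in> Lam n" by simp
    show "l i = 0" if "i \<notin> {1..n}" using Lam_outside[OF L that] .
    assume i: "i \<in> {1..n}"
    then have "l i \<le> l 1" using Lam_antimono[OF L, of 1 i] by simp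
    also have "l 1 \<le> odd_size n l"
      unfolding odd_size_def by (rule member_le_sum) (use i in auto)
    finally show "l i \<in> {..d}" using l by simp
  qed
  show "finite {l. \<forall>i. (i \<in> {1..n} \<longrightarrow> l i \<in> {..d}) \<and> (i \<notin> {1..n} \<longrightarrow> l i = (0::nat))}"
    by (rule finite_set_of_finite_funs) auto
qed

text \<open>For \<open>l\<close> in \<open>Lam n\<close> the set is finite, since the order compares
  degrees first. Its cardinality is the measure of the inductions along leading exponents.\<close>

definition below :: "nat \<Rightarrow> (nat \<Rightarrow> nat) \<Rightarrow> (nat \<Rightarrow> nat) set" where
  "below n l = {\<nu> \<in> Lam n. grless (alt_mono n \<nu>) (alt_mono n l)}"

lemma card_below_less:
  assumes l: "l \<in> Lam n" and k: "\<kappa> \<in> Lam n" "grless (alt_mono n \<kappa>) (alt_mono n l)"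
  shows "card (below n \<kappa>) < card (below n l)"
proof (rule psubset_card_mono)
  show "finite (below n l)"
    by (rule finite_subset[OF _ finite_Lam[of n "odd_size n l"]])
      (auto simp: below_def grless_def mono_degree_alt_mono l)
  have "below n \<kappa> \<subseteq> below n l"
    using grless_trans[OF _ k(2)] by (auto simp: below_def)
  moreover have "\<kappa> \<in> below n l" "\<kappa> \<notin> below n \<kappa>"
    using k by (simp_all add: below_def)
  ultimately show "below n \<kappa> \<subset> below n l" by blast
qed

lemma semisymmetric_diff:
  fixes f g :: "'a::comm_ring_1 mpoly"
  assumes "f \<in> semisymmetric n" "g \<in> semisymmetric n"
  shows "f - g \<in> semisymmetric n"
  using semisymmetricD[OF assms(1)] semisymmetricD[OF assms(2)]
  by (simp add: semisymmetric_def poly_ring_iff permute_hom.map_diff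
      restrict_hom.map_diff)

lemma semisymmetric_sum:
  fixes f :: "'b \<Rightarrow> 'a::comm_ring_1 mpoly"
  assumes "\<And>x. x \<in> A \<Longrightarrow> f x \<in> semisymmetric n"
  shows "(\<Sum>x\<in>A. f x) \<in> semisymmetric n"
  using semisymmetricD[OF assms]
  by (simp add: semisymmetric_def poly_ring_iff permute_hom.map_sum
      restrict_hom.map_sum)

lemma semisymmetric_mconst_mult:
  fixes f :: "'a::comm_ring_1 mpoly"
  assumes "f \<in> semisymmetric n"
  shows "mconst c * f \<in> semisymmetric n"
  using semisymmetricD[OF assms]
  by (simp add: semisymmetric_def poly_ring_iff permute_hom.map_mult
      restrict_hom.map_mult permute_vars_mconst restrict_vars_mconst)

text \<open>Exchanging z_i and z_(i+2) must not enlarge the leading exponent a, so a_i \<ge>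
  a_(i+2). Then \<lambda>_i = a_i + a_(i+1) is weakly decreasing, and its alternating tail sums
  telescope back to a.\<close>

lemma lead_semisymmetric:
  fixes f :: "'a::comm_ring_1 mpoly"
  assumes f: "f \<in> semisymmetric n" and a: "lead f a c" "c \<noteq> 0"
  obtains l where "l \<in> Lam n" "alt_mono n l = a"
proof -
  let ?a = "lookup a"
  have "a \<in> keys f" using a by (auto simp: lead_def in_keys_iff)
  then have "keys a \<subseteq> {1..n}"
    using f by (auto simp: semisymmetric_def poly_ring_def)
  then have out: "?a i = 0" if "i \<notin> {1..n}" for i
    using that by (auto simp: in_keys_iff)
  have dec: "?a (i + 2) \<le> ?a i" if i: "1 \<le> i" for i
  proof (rule ccontr)
    assume n: "\<not> ?a (i + 2) \<le> ?a i"
    have r2: "i + 2 \<in> {1..n}" using out[of "i + 2"] n by (cases "i + 2 \<in> {1..n}") simp_all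
    then have r: "i \<in> {1..n}" using i by simp
    define \<tau> where "\<tau> = transpose i (i + 2)"
    have "\<tau> k mod 2 = k mod 2" for k by (simp add: \<tau>_def transpose_def)
    then have \<tau>: "\<tau> \<in> parity_group n"
      using permutes_swap_id[OF r r2] by (simp add: \<tau>_def parity_group_def)
    then have bij: "bij \<tau>" by (rule parity_groupD)
    let ?b = "permute_mono \<tau> a"
    have "lookup f ?b = lookup f a"
      using lookup_permute_vars[OF bij, of f a] semisymmetricD(1)[OF f \<tau>] by simp
    then have "grle ?b a" using a by (auto simp: lead_def)
    moreover have "grless a ?b"
      unfolding grless_def mono_less_iff
    proof (intro disjI2 conjI exI[of _ i] allI impI)
      show "mono_degree a = mono_degree ?b" by (simp add: mono_degree_permute_mono)
      show "?a i < lookup ?b i"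
        using lookup_permute_mono[OF bij, of a "i + 2"] n by (simp add: \<tau>_def)
      show "?a k = lookup ?b k" if "k < i" for k
        using lookup_permute_mono[OF bij, of a k] that by (simp add: \<tau>_def transpose_def)
    qed
    ultimately show False using not_grle by blast
  qed
  \<comment> \<open>At i = n the second summand is 0, because \<open>a\<close> vanishes outside
    \<open>{1..n}\<close>.\<close>
  define l where "l i = (if i \<in> {1..n} then ?a i + ?a (i + 1) else 0)" for i
  have l: "l \<in> Lam n"
    by (rule LamI) (use dec in \<open>auto simp: l_def\<close>)
  have as: "asum n l k = int (?a k)" if "k \<in> {1..n}" for k
  proof -
    have "k \<le> n" "1 \<le> k" using that by auto
    then show ?thesis
    proof (induction rule: inc_induct)
      case base
      then show ?case using out[of "Suc n"] by (simp add: asum_rec asum_beyond l_def)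
    next
      case (step j)
      have "asum n l j = int (l j) - asum n l (Suc j)" using step by (intro asum_rec) simp
      moreover have "l j = ?a j + ?a (Suc j)" using step by (simp add: l_def)
      ultimately show ?case using step by simp
    qed
  qed
  have "alt_mono n l = a"
  proof (rule poly_mapping_eqI)
    fix k
    show "lookup (alt_mono n l) k = ?a k"
    proof (cases "k \<in> {1..n}")
      case True
      then show ?thesis using int_lookup_alt_mono[OF l True] as[OF True] by simp
    next
      case False
      show ?thesis by (simp only: lookup_alt_mono_outside[OF False] out[OF False])
    qed
  qed
  with l show thesis by (rule that)
qed

section \<open>The interpolation polynomials and the Pieri formula\<close>

text \<open>The assumption says that \<open>r\<close> is not a negative rational number, in the form
  in which the factors of \<open>rise\<close> use it.\<close>

locale generic_parameter =
  fixes n :: nat and r :: "'a::field_char_0"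
  assumes nn: "\<And>a b. a > 0 \<Longrightarrow> of_nat a + of_nat b * r \<noteq> 0"
begin

text \<open>The induction hypothesis for existence. Beyond the conditions of \<open>is_R\<close> it
  asks that the coefficient 1 belong to the leading exponent and prescribes the value at the point
  of \<open>l\<close> itself.\<close>

definition R_like :: "(nat \<Rightarrow> nat) \<Rightarrow> 'a mpoly \<Rightarrow> bool" where
  "R_like l g \<longleftrightarrow> g \<in> semisymmetric n \<and> lead g (alt_mono n l) 1 \<and>
     (\<forall>\<nu>\<in>Lam n. odd_size n \<nu> \<le> odd_size n l \<longrightarrow>
        eval_mpoly (gen_point n r \<nu>) g = (if \<nu> = l then hook n r l else 0))"

lemma psi_even_initial:
  assumes "\<mu> \<in> Lam n" "add_eps \<mu> {1..m} \<in> Lam n"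
  shows "psi_even n r \<mu> {1..m} = 1"
proof -
  have "psi_pairs n {1..m} = {}" by (auto simp: psi_pairs_def)
  then have "psi_formula n (Fract [:0, 1:] 1 :: 'a poly fract) \<mu> {1..m} = 1"
    by (simp add: psi_formula_prod)
  then show ?thesis
    using regular_at_psi[OF nn assms] regular_at_unique[OF _ regular_at_one] by metis
qed

text \<open>The value at \<nu> involves \<open>g\<close> at the tuples \<kappa> with \<kappa> +
  \<epsilon>_I = \<nu>. The size bound on \<nu> gives |\<kappa>|_odd \<le> |\<mu>|_odd, so only
  \<kappa> = \<mu> survives, and there the hook value of \<mu> cancels.\<close>

lemma eval_pieri_op_R_like:
  assumes \<mu>: "\<mu> \<in> Lam n" and g: "R_like \<mu> g"
    and \<nu>: "\<nu> \<in> Lam n" "odd_size n \<nu> \<le> odd_size n \<mu> + (m + 1) div 2"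
  shows "eval_mpoly (gen_point n r \<nu>) (pieri_op n r m g) =
    (\<Sum>I\<in>pieri_sets n \<mu> m. if add_eps \<mu> I = \<nu> then psi_even n r \<mu> I * hook n r \<nu> else 0)"
proof -
  have gs: "g \<in> semisymmetric n" using g by (simp add: R_like_def)
  have "eval_mpoly (gen_point n r \<nu>) (pieri_op n r m g) =
      (\<Sum>I\<in>{I \<in> shift_sets n m. \<exists>\<kappa>\<in>Lam n. add_eps \<kappa> I = \<nu>}.
        psi_even n r (del_eps \<nu> I) I * hook n r \<nu> * inverse (hook n r (del_eps \<nu> I)) *
        eval_mpoly (gen_point n r (del_eps \<nu> I)) g)"
    by (rule eval_pieri_op_Lam[OF nn gs \<nu>(1)])
  also have "\<dots> = (\<Sum>I\<in>{I \<in> shift_sets n m. \<exists>\<kappa>\<in>Lam n. add_eps \<kappa> I = \<nu>}.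
        if add_eps \<mu> I = \<nu> then psi_even n r \<mu> I * hook n r \<nu> else 0)"
  proof (rule sum.cong[OF refl])
    fix I assume "I \<in> {I \<in> shift_sets n m. \<exists>\<kappa>\<in>Lam n. add_eps \<kappa> I = \<nu>}"
    then obtain \<kappa> where I: "I \<in> shift_sets n m" and \<kappa>: "\<kappa> \<in> Lam n" and eq: "add_eps \<kappa> I = \<nu>" by auto
    have del: "del_eps \<nu> I = \<kappa>" unfolding eq[symmetric] by simp
    have "odd_size n \<kappa> \<le> odd_size n \<mu>"
      using \<nu>(2) odd_size_add_eps[OF I, of \<kappa>] eq by simp
    then have ev: "eval_mpoly (gen_point n r \<kappa>) g = (if \<kappa> = \<mu> then hook n r \<mu> else 0)"
      using g \<kappa> by (auto simp: R_like_def)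
    have iff: "add_eps \<mu> I = \<nu> \<longleftrightarrow> \<kappa> = \<mu>"
      using eq by (metis del_add_eps)
    show "psi_even n r (del_eps \<nu> I) I * hook n r \<nu> * inverse (hook n r (del_eps \<nu> I)) *
        eval_mpoly (gen_point n r (del_eps \<nu> I)) g =
      (if add_eps \<mu> I = \<nu> then psi_even n r \<mu> I * hook n r \<nu> else 0)"
      unfolding del ev iff using hook_nonzero[OF nn, of n] by simp
  qed
  also have "\<dots> = (\<Sum>I\<in>pieri_sets n \<mu> m. if add_eps \<mu> I = \<nu> then psi_even n r \<mu> I * hook n r \<nu> else 0)"
    by (rule sum.mono_neutral_cong) (use \<mu> \<nu> in \<open>auto simp: pieri_sets_iff\<close>)
  finally show ?thesis .
qed

lemma R_like_zero: "R_like (\<lambda>_. 0) 1"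
proof -
  have "alt_mono n (\<lambda>_. 0) = 0" by (simp add: alt_mono_def alt_tail_def)
  moreover have "hook n r (\<lambda>_. 0) = 1"
    by (simp add: hook_def rise_def prod.neutral split_beta)
  ultimately show ?thesis
    using odd_size_zero_iff[of _ n]
    by (auto simp: R_like_def one_semisymmetric lead_one eval_hom.map_one odd_size_def[of n "\<lambda>_. 0"])
qed

lemma R_like_exists: "l \<in> Lam n \<Longrightarrow> \<exists>g. R_like l g"
proof (induction l rule: measure_induct_rule[where f = "\<lambda>l. card (below n l)"])
  case (less l)
  have IH: "\<exists>g. R_like \<kappa> g" if \<kappa>: "\<kappa> \<in> Lam n" "grless (alt_mono n \<kappa>) (alt_mono n l)" for \<kappa>
    by (rule less.IH[OF card_below_less[OF less.prems \<kappa>] \<kappa>(1)])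
  show ?case
  proof (cases "l = (\<lambda>_. 0)")
    case True
    then show ?thesis using R_like_zero by blast
  next
    case False
    \<comment> \<open>The index of the last nonzero part: removing the column \<open>{1..m}\<close>
      leaves a decreasing tuple, and \<open>m\<close> being positive lowers the degree.\<close>
    define m where "m = Max {i. l i \<noteq> 0}"
    have sub: "{i. l i \<noteq> 0} \<subseteq> {1..n}"
    proof
      fix i assume "i \<in> {i. l i \<noteq> 0}"
      then show "i \<in> {1..n}" using Lam_outside[OF less.prems, of i] by (cases "i \<in> {1..n}") simp_all
    qed
    have fin: "finite {i. l i \<noteq> 0}" using sub by (rule finite_subset) simp
    have "{i. l i \<noteq> 0} \<noteq> {}" using False by auto
    then have "m \<in> {i. l i \<noteq> 0}" unfolding m_def by (rule Max_in[OF fin])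
    then have m: "l m \<noteq> 0" "1 \<le> m" "m \<le> n" using sub by auto
    have pos: "l i \<ge> 1" if "i \<in> {1..m}" for i
      using Lam_antimono[OF less.prems, of i m] that m by simp
    have zero: "l i = 0" if "i > m" for i
      using Max_ge[OF fin, of i] that by (auto simp: m_def)
    define \<mu> where "\<mu> = del_eps l {1..m}"
    have l: "add_eps \<mu> {1..m} = l"
      using pos by (auto simp: add_eps_def \<mu>_def del_eps_def fun_eq_iff)
    have \<mu>: "\<mu> \<in> Lam n"
    proof (rule LamI)
      fix k assume k: "1 \<le> k" "k < n"
      have "l (Suc k) \<le> l k" using Lam_antimono[OF less.prems, of k "Suc k"] k by simp
      then show "\<mu> (Suc k) \<le> \<mu> k"
        using zero[of "Suc k"] by (cases "Suc k \<le> m") (auto simp: \<mu>_def del_eps_def)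
    qed (use Lam_outside[OF less.prems] in \<open>simp add: \<mu>_def del_eps_def\<close>)
    have lm: "add_eps \<mu> {1..m} \<in> Lam n" using l less.prems by simp
    have osz: "odd_size n l = odd_size n \<mu> + (m + 1) div 2"
      using odd_size_add_eps[OF initial_in_shift_sets[OF m(3)], of \<mu>] l by simp
    have "grless (alt_mono n \<mu>) (alt_mono n l)"
      using osz m(2) by (simp add: grless_def mono_degree_alt_mono[OF \<mu>] mono_degree_alt_mono[OF less.prems])
    then obtain g where g: "R_like \<mu> g" using IH[OF \<mu>] by blast
    let ?P = "pieri_sets n \<mu> m - {{1..m}}"
    have gr: "add_eps \<mu> I \<in> Lam n" "grless (alt_mono n (add_eps \<mu> I)) (alt_mono n l)" "I \<in> shift_sets n m"
      if "I \<in> ?P" for I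
    proof -
      have I: "I \<in> pieri_sets n \<mu> m" "I \<noteq> {1..m}" using that by blast+
      then show "add_eps \<mu> I \<in> Lam n" "I \<in> shift_sets n m" by (simp_all add: pieri_sets_iff)
      show "grless (alt_mono n (add_eps \<mu> I)) (alt_mono n l)"
        using alt_mono_add_eps_grless[OF \<mu> I m(3) lm] unfolding l .
    qed
    have "\<forall>I\<in>?P. \<exists>h. R_like (add_eps \<mu> I) h" using IH gr by blast
    then obtain h where h: "\<And>I. I \<in> ?P \<Longrightarrow> R_like (add_eps \<mu> I) (h I)" by metis
    let ?G = "pieri_op n r m g"
    let ?S = "\<Sum>I\<in>?P. mconst (psi_even n r \<mu> I) * h I"
    have gs: "g \<in> semisymmetric n" "lead g (alt_mono n \<mu>) 1" using g by (auto simp: R_like_def)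
    have "lead ?G (alt_mono n l) 1"
      using lead_pieri_op[OF gs(1) m(3) gs(2)] alt_mono_add_column[OF \<mu> lm m(3)] l by simp
    moreover have "lead ?S (alt_mono n l) (\<Sum>I\<in>?P. psi_even n r \<mu> I * 0)"
      by (intro lead_sum lead_mconst_mult lead_grless) (use h gr in \<open>auto simp: R_like_def\<close>)
    ultimately have ld: "lead (?G - ?S) (alt_mono n l) 1"
      using lead_diff[of ?G _ 1 ?S 0] by simp
    have ss: "?G - ?S \<in> semisymmetric n"
      by (intro semisymmetric_diff semisymmetric_sum semisymmetric_mconst_mult pieri_op_semisymmetric gs)
        (use h in \<open>auto simp: R_like_def\<close>)
    have ev: "eval_mpoly (gen_point n r \<nu>) (?G - ?S) = (if \<nu> = l then hook n r l else 0)"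
      if \<nu>: "\<nu> \<in> Lam n" "odd_size n \<nu> \<le> odd_size n l" for \<nu>
    proof -
      let ?c = "\<lambda>I. if add_eps \<mu> I = \<nu> then psi_even n r \<mu> I * hook n r \<nu> else 0"
      have "eval_mpoly (gen_point n r \<nu>) ?S = (\<Sum>I\<in>?P. ?c I)"
        unfolding eval_hom.map_sum
      proof (rule sum.cong[OF refl])
        fix I assume I: "I \<in> ?P"
        have "odd_size n \<nu> \<le> odd_size n (add_eps \<mu> I)"
          using \<nu>(2) osz odd_size_add_eps[OF gr(3)[OF I]] by simp
        then show "eval_mpoly (gen_point n r \<nu>) (mconst (psi_even n r \<mu> I) * h I) = ?c I"
          using h[OF I] \<nu>(1) by (auto simp: R_like_def eval_hom.map_mult)
      qed
      moreover have "eval_mpoly (gen_point n r \<nu>) ?G = (\<Sum>I\<in>pieri_sets n \<mu> m. ?c I)"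
        by (rule eval_pieri_op_R_like[OF \<mu> g \<nu>(1)]) (use \<nu>(2) osz in simp)
      \<comment> \<open>After the subtraction only this set contributes. Its coefficient is 1
        because \<open>psi_pairs n {1..m}\<close> is empty, so the value at \<open>l\<close> is the
        hook value.\<close>
      moreover have "{1..m} \<in> pieri_sets n \<mu> m"
        using initial_in_shift_sets[OF m(3)] lm by (simp add: pieri_sets_iff)
      then have "(\<Sum>I\<in>pieri_sets n \<mu> m. ?c I) = ?c {1..m} + (\<Sum>I\<in>?P. ?c I)"
        by (rule sum.remove[OF finite_pieri_sets])
      ultimately have "eval_mpoly (gen_point n r \<nu>) (?G - ?S) = ?c {1..m}"
        by (simp add: eval_hom.map_diff)
      then show ?thesis unfolding psi_even_initial[OF \<mu> lm] l by auto
    qed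
    have "R_like l (?G - ?S)"
      using ld ss ev by (simp add: R_like_def)
    then show ?thesis by blast
  qed
qed

section \<open>Expansion in the interpolation polynomials, and uniqueness\<close>

definition Rg :: "(nat \<Rightarrow> nat) \<Rightarrow> 'a mpoly" where
  "Rg l = (SOME g. R_like l g)"

lemma Rg: "l \<in> Lam n \<Longrightarrow> R_like l (Rg l)"
  unfolding Rg_def by (rule someI_ex) (rule R_like_exists)

lemma RgD:
  assumes "l \<in> Lam n"
  shows "Rg l \<in> semisymmetric n" "lead (Rg l) (alt_mono n l) 1" "deg_le (odd_size n l) (Rg l)"
    "\<nu> \<in> Lam n \<Longrightarrow> odd_size n \<nu> \<le> odd_size n l \<Longrightarrow>
      eval_mpoly (gen_point n r \<nu>) (Rg l) = (if \<nu> = l then hook n r l else 0)"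
  using Rg[OF assms] lead_deg_le[of "Rg l" "alt_mono n l" 1] mono_degree_alt_mono[OF assms]
  by (auto simp: R_like_def)

text \<open>Repeated elimination of the leading term. The remainder is again invariant, so
  \<open>lead_semisymmetric\<close> names its leading exponent, and the graded order keeps the size
  within \<open>d\<close>.\<close>

lemma R_span_lead:
  assumes "l \<in> Lam n" "odd_size n l \<le> d" "f \<in> semisymmetric n" "lead f (alt_mono n l) a"
  shows "\<exists>c. f = (\<Sum>\<kappa>\<in>{\<kappa> \<in> Lam n. odd_size n \<kappa> \<le> d}. mconst (c \<kappa>) * Rg \<kappa>)"
  using assms
proof (induction l arbitrary: f a rule: measure_induct_rule[where f = "\<lambda>l. card (below n l)"])
  case (less l)
  let ?T = "{\<kappa> \<in> Lam n. odd_size n \<kappa> \<le> d}"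
  let ?f = "f - mconst a * Rg l"
  have f: "?f \<in> semisymmetric n"
    using less.prems RgD(1) by (intro semisymmetric_diff semisymmetric_mconst_mult) auto
  have ld: "lead ?f (alt_mono n l) 0"
    using lead_diff[OF less.prems(4) lead_mconst_mult[OF RgD(2)[OF less.prems(1)], of a]] by simp
  have "\<exists>c. ?f = (\<Sum>\<kappa>\<in>?T. mconst (c \<kappa>) * Rg \<kappa>)"
  proof (cases "?f = 0")
    case True
    then show ?thesis by (intro exI[of _ "\<lambda>_. 0"]) simp
  next
    case False
    then obtain b where b: "lead ?f b (lookup ?f b)" "lookup ?f b \<noteq> 0"
      by (rule lead_exists)
    obtain k where k: "k \<in> Lam n" "alt_mono n k = b" using lead_semisymmetric[OF f b] .
    have "grle b (alt_mono n l)" "b \<noteq> alt_mono n l" using ld b(2) by (auto simp: lead_def)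
    then have gr: "grless (alt_mono n k) (alt_mono n l)" using k(2) by (auto simp: grle_def)
    have "mono_degree (alt_mono n k) \<le> mono_degree (alt_mono n l)"
      using gr by (auto simp: grless_def)
    then have "odd_size n k \<le> odd_size n l"
      by (simp only: mono_degree_alt_mono[OF k(1)] mono_degree_alt_mono[OF less.prems(1)])
    then have kd: "odd_size n k \<le> d" using less.prems(2) by simp
    show ?thesis
      by (rule less.IH[OF card_below_less[OF less.prems(1) k(1) gr] k(1) kd f]) (use b(1) k(2) in simp)
  qed
  then obtain c where c: "?f = (\<Sum>\<kappa>\<in>?T. mconst (c \<kappa>) * Rg \<kappa>)" by blast
  have l: "l \<in> ?T" using less.prems by simp
  have "f = mconst a * Rg l + (\<Sum>\<kappa>\<in>?T. mconst (c \<kappa>) * Rg \<kappa>)"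
    unfolding c[symmetric] by simp
  also have "mconst a * Rg l = (\<Sum>\<kappa>\<in>?T. mconst (if \<kappa> = l then a else 0) * Rg \<kappa>)"
  proof -
    have "(\<Sum>\<kappa>\<in>?T. mconst (if \<kappa> = l then a else 0) * Rg \<kappa>) = (\<Sum>\<kappa>\<in>?T. if \<kappa> = l then mconst a * Rg \<kappa> else 0)"
      by (rule sum.cong) auto
    then show ?thesis using l finite_Lam[of n d] by simp
  qed
  finally have "f = (\<Sum>\<kappa>\<in>?T. mconst ((if \<kappa> = l then a else 0) + c \<kappa>) * Rg \<kappa>)"
    by (simp only: sum.distrib[symmetric] single_add distrib_right)
  then show ?case by (rule exI[of _ "\<lambda>\<kappa>. (if \<kappa> = l then a else 0) + c \<kappa>"])
qed

text \<open>Expand \<open>f\<close> in the \<open>Rg \<kappa>\<close> and evaluate at the point of a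
  \<kappa> of minimal size among those with nonzero coefficient. All other terms vanish there, so
  this coefficient times a nonzero hook value would be 0.\<close>

lemma vanishing_imp_zero:
  assumes f: "f \<in> semisymmetric n" "deg_le d f"
    and v: "\<And>\<nu>. \<nu> \<in> Lam n \<Longrightarrow> odd_size n \<nu> \<le> d \<Longrightarrow> eval_mpoly (gen_point n r \<nu>) f = 0"
  shows "f = 0"
proof (rule ccontr)
  assume "f \<noteq> 0"
  let ?T = "{\<kappa> \<in> Lam n. odd_size n \<kappa> \<le> d}"
  obtain b where b: "lead f b (lookup f b)" "lookup f b \<noteq> 0"
    using \<open>f \<noteq> 0\<close> by (rule lead_exists)
  obtain l where l: "l \<in> Lam n" "alt_mono n l = b" using lead_semisymmetric[OF f(1) b] .
  have "odd_size n l \<le> d"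
    using f(2) b(2) mono_degree_alt_mono[OF l(1)] l(2) by (auto simp: deg_le_def)
  then obtain c where c: "f = (\<Sum>\<kappa>\<in>?T. mconst (c \<kappa>) * Rg \<kappa>)"
    using R_span_lead[OF l(1) _ f(1), of d] b(1) l(2) by blast
  have "\<exists>\<kappa>. \<kappa> \<in> ?T \<and> c \<kappa> \<noteq> 0"
  proof (rule ccontr)
    assume "\<not> ?thesis"
    then have "f = 0" unfolding c by (intro sum.neutral) auto
    with \<open>f \<noteq> 0\<close> show False by simp
  qed
  then obtain k0 where "k0 \<in> ?T \<and> c k0 \<noteq> 0" by blast
  from ex_has_least_nat[of "\<lambda>\<kappa>. \<kappa> \<in> ?T \<and> c \<kappa> \<noteq> 0", OF this, of "odd_size n"]
  obtain k where k: "k \<in> ?T \<and> c k \<noteq> 0"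
    and least: "\<And>\<kappa>. \<kappa> \<in> ?T \<and> c \<kappa> \<noteq> 0 \<Longrightarrow> odd_size n k \<le> odd_size n \<kappa>"
    by blast
  have "eval_mpoly (gen_point n r k) f = (\<Sum>\<kappa>\<in>?T. c \<kappa> * eval_mpoly (gen_point n r k) (Rg \<kappa>))"
    by (subst c) (simp add: eval_hom.map_sum eval_hom.map_mult)
  also have "\<dots> = (\<Sum>\<kappa>\<in>?T. if \<kappa> = k then c k * hook n r k else 0)"
  proof (rule sum.cong[OF refl])
    fix \<kappa> assume \<kappa>: "\<kappa> \<in> ?T"
    show "c \<kappa> * eval_mpoly (gen_point n r k) (Rg \<kappa>) = (if \<kappa> = k then c k * hook n r k else 0)"
    proof (cases "c \<kappa> = 0")
      case False
      then have "odd_size n k \<le> odd_size n \<kappa>" using least \<kappa> by blast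
      then show ?thesis using RgD(4)[of \<kappa> k] \<kappa> k by auto
    qed (use k in auto)
  qed
  also have "\<dots> = c k * hook n r k" using k finite_Lam[of n d] by simp
  finally have "eval_mpoly (gen_point n r k) f \<noteq> 0" using k hook_nonzero[OF nn] by simp
  then show False using v k by simp
qed

lemma is_R_Rg:
  assumes "l \<in> Lam n"
  shows "is_R n r l (Rg l)"
  unfolding is_R_def gen_point_lambda
  using RgD[OF assms] lead_total_degree[OF RgD(2)[OF assms]] mono_degree_alt_mono[OF assms]
  by (auto simp: lead_def)

lemma R_poly_eq:
  assumes l: "l \<in> Lam n"
  shows "R_poly n r l = Rg l"
  unfolding R_poly_def
proof (rule the_equality[where P = "is_R n r l", OF is_R_Rg[OF l]])
  fix p assume p: "is_R n r l p"
  then have p1: "p \<in> semisymmetric n" "deg_le (odd_size n l) p" "lookup p (alt_mono n l) = 1"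
    and p2: "\<And>\<nu>. \<nu> \<in> Lam n \<Longrightarrow> odd_size n \<nu> \<le> odd_size n l \<Longrightarrow> \<nu> \<noteq> l \<Longrightarrow>
      eval_mpoly (gen_point n r \<nu>) p = 0"
    unfolding is_R_def gen_point_lambda deg_le_total_degree[symmetric] by auto
  \<comment> \<open>Chosen to cancel the value at the point of \<open>l\<close>, the only point in
    range where \<open>p\<close> need not vanish. Comparing the normalised coefficients then gives c
    = 1.\<close>
  define c where "c = eval_mpoly (gen_point n r l) p / hook n r l"
  have "p - mconst c * Rg l = 0"
  proof (rule vanishing_imp_zero)
    show "p - mconst c * Rg l \<in> semisymmetric n"
      using p1(1) RgD(1)[OF l] by (intro semisymmetric_diff semisymmetric_mconst_mult)
    show "deg_le (odd_size n l) (p - mconst c * Rg l)"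
      using p1(2) RgD(3)[OF l] by (intro deg_le_diff deg_le_mconst_mult)
    show "eval_mpoly (gen_point n r \<nu>) (p - mconst c * Rg l) = 0"
      if "\<nu> \<in> Lam n" "odd_size n \<nu> \<le> odd_size n l" for \<nu>
      using p2[OF that] RgD(4)[OF l that] hook_nonzero[OF nn, of n l]
      by (auto simp: eval_hom.map_diff eval_hom.map_mult c_def)
  qed
  then have eq: "p = mconst c * Rg l" by simp
  have "1 = c * lookup (Rg l) (alt_mono n l)"
    using p1(3) unfolding eq lookup_mconst_mult ..
  then have "c = 1" using RgD(2)[OF l] by (simp add: lead_def)
  then show "p = Rg l" using eq by simp
qed

lemma R_like_unique: "l \<in> Lam n \<Longrightarrow> R_like l g \<Longrightarrow> g = Rg l"
proof -
  assume l: "l \<in> Lam n" and g: "R_like l g"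
  have "g - Rg l = 0"
  proof (rule vanishing_imp_zero)
    show "g - Rg l \<in> semisymmetric n"
      using g RgD(1)[OF l] by (auto simp: R_like_def intro: semisymmetric_diff)
    have "deg_le (odd_size n l) g"
      using g lead_deg_le[of g "alt_mono n l" 1] mono_degree_alt_mono[OF l] by (auto simp: R_like_def)
    then show "deg_le (odd_size n l) (g - Rg l)"
      using RgD(3)[OF l] by (rule deg_le_diff)
    show "eval_mpoly (gen_point n r \<nu>) (g - Rg l) = 0"
      if "\<nu> \<in> Lam n" "odd_size n \<nu> \<le> odd_size n l" for \<nu>
      using g RgD(4)[OF l that] that by (simp add: eval_hom.map_diff R_like_def)
  qed
  then show "g = Rg l" by simp
qed

text \<open>An inhomogeneous Pieri rule. By \<open>eval_pieri_op_R_like\<close> both sides have the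
  same values at all points up to their common degree bound, so \<open>vanishing_imp_zero\<close>
  applies to the difference.\<close>

lemma pieri_op_Rg:
  assumes \<mu>: "\<mu> \<in> Lam n"
  shows "pieri_op n r m (Rg \<mu>) =
    (\<Sum>I\<in>pieri_sets n \<mu> m. mconst (psi_even n r \<mu> I) * Rg (add_eps \<mu> I))"
proof -
  let ?G = "pieri_op n r m (Rg \<mu>)"
  let ?S = "\<Sum>I\<in>pieri_sets n \<mu> m. mconst (psi_even n r \<mu> I) * Rg (add_eps \<mu> I)"
  let ?d = "(m + 1) div 2 + odd_size n \<mu>"
  have P: "add_eps \<mu> I \<in> Lam n" "odd_size n (add_eps \<mu> I) = ?d" if "I \<in> pieri_sets n \<mu> m" for I
    using that odd_size_add_eps[of I n m \<mu>] by (auto simp: pieri_sets_iff)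
  have "?G - ?S = 0"
  proof (rule vanishing_imp_zero)
    show "?G - ?S \<in> semisymmetric n"
      by (intro semisymmetric_diff semisymmetric_sum semisymmetric_mconst_mult pieri_op_semisymmetric
          RgD(1) \<mu> P(1))
    have "deg_le ?d ?G" by (rule top_pieri_op(1)[OF RgD(1)[OF \<mu>] RgD(3)[OF \<mu>]])
    moreover have "deg_le ?d (Rg (add_eps \<mu> I))" if "I \<in> pieri_sets n \<mu> m" for I
      using RgD(3)[OF P(1)[OF that]] P(2)[OF that] by simp
    ultimately show "deg_le ?d (?G - ?S)"
      by (intro deg_le_diff deg_le_sum deg_le_mconst_mult)
    fix \<nu> assume \<nu>: "\<nu> \<in> Lam n" "odd_size n \<nu> \<le> ?d"
    have "eval_mpoly (gen_point n r \<nu>) ?S =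
        (\<Sum>I\<in>pieri_sets n \<mu> m. if add_eps \<mu> I = \<nu> then psi_even n r \<mu> I * hook n r \<nu> else 0)"
      unfolding eval_hom.map_sum
      by (rule sum.cong[OF refl])
        (use RgD(4)[OF P(1) \<nu>(1)] P(2) \<nu>(2) in \<open>auto simp: eval_hom.map_mult\<close>)
    moreover have "eval_mpoly (gen_point n r \<nu>) ?G =
        (\<Sum>I\<in>pieri_sets n \<mu> m. if add_eps \<mu> I = \<nu> then psi_even n r \<mu> I * hook n r \<nu> else 0)"
      by (rule eval_pieri_op_R_like[OF \<mu> Rg[OF \<mu>] \<nu>(1)]) (use \<nu>(2) in simp)
    ultimately show "eval_mpoly (gen_point n r \<nu>) (?G - ?S) = 0"
      by (simp add: eval_hom.map_diff)
  qed
  then show ?thesis by simp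
qed

lemma pieri_op_one:
  assumes m: "m \<le> n"
  shows "pieri_op n r m 1 = Rg (column m)" and "column m \<in> Lam n"
proof -
  have z: "(\<lambda>_. 0) \<in> Lam n" by (simp add: Lam_def)
  have c: "add_eps (\<lambda>_. 0) {1..m} = column m" by (auto simp: add_eps_def column_def)
  show cl: "column m \<in> Lam n" using m by (auto simp: Lam_def column_def)
  \<comment> \<open>A decreasing indicator function that is 0 at k \<le> m is 0 from k on, and then
    \<open>I\<close> has fewer than \<open>m\<close> elements.\<close>
  have I0: "I = {1..m}" if "I \<in> pieri_sets n (\<lambda>_. 0) m" for I
  proof (rule ccontr)
    assume ne: "I \<noteq> {1..m}"
    have I: "I \<in> shift_sets n m" "add_eps (\<lambda>_. 0) I \<in> Lam n" using that by (auto simp: pieri_sets_iff)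
    obtain k where k: "k \<in> {1..m}" "k \<notin> I"
      using first_missing[OF I(1) ne m] by auto
    have "I \<subseteq> {1..<k}"
    proof
      fix j assume j: "j \<in> I"
      then have jn: "j \<in> {1..n}" using shift_setsD(1)[OF I(1)] by blast
      have "\<not> k \<le> j"
        using Lam_antimono[OF I(2), of k j] j jn k by (auto simp: add_eps_def)
      then show "j \<in> {1..<k}" using jn by simp
    qed
    then have "card I \<le> card {1..<k}" by (intro card_mono) auto
    then show False using shift_setsD(3)[OF I(1)] k by auto
  qed
  have "{1..m} \<in> pieri_sets n (\<lambda>_. 0) m"
    unfolding pieri_sets_iff c using initial_in_shift_sets[OF m] cl by blast
  then have P: "pieri_sets n (\<lambda>_. 0) m = {{1..m}}" using I0 by blast
  have psi: "psi_even n r (\<lambda>_. 0) {1..m} = 1"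
    by (rule psi_even_initial[OF z]) (unfold c, rule cl)
  define J where "J = {1..m}"
  show "pieri_op n r m 1 = Rg (column m)"
    using pieri_op_Rg[OF z, of m]
    unfolding R_like_unique[OF z R_like_zero, symmetric] P J_def[symmetric]
    by (simp add: psi[folded J_def] c[folded J_def])
qed

lemma Rbar_eq: "l \<in> Lam n \<Longrightarrow> Rbar n r l = hom_component (odd_size n l) (Rg l)"
  by (simp add: Rbar_def R_poly_eq)

lemma pieri:
  assumes m: "m \<le> n" and \<mu>: "\<mu> \<in> Lam n"
  shows "e_poly n r m * Rbar n r \<mu> =
    (\<Sum>I\<in>pieri_sets n \<mu> m. mconst (psi_even n r \<mu> I) * Rbar n r (add_eps \<mu> I))"
proof -
  let ?p = "(m + 1) div 2"
  have "odd_size n (column m) = ?p"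
    using mono_degree_alt_mono[OF pieri_op_one(2)[OF m]] mono_degree_alt_mono_column[OF m] by simp
  then have "e_poly n r m = hom_component ?p (pieri_op n r m 1)"
    by (simp add: e_poly_def Rbar_eq pieri_op_one[OF m])
  then have "e_poly n r m * Rbar n r \<mu> = hom_component (?p + odd_size n \<mu>) (pieri_op n r m (Rg \<mu>))"
    using top_pieri_op(2)[OF RgD(1)[OF \<mu>] RgD(3)[OF \<mu>]] by (simp only: Rbar_eq[OF \<mu>])
  also have "\<dots> = (\<Sum>I\<in>pieri_sets n \<mu> m. mconst (psi_even n r \<mu> I) * Rbar n r (add_eps \<mu> I))"
    unfolding pieri_op_Rg[OF \<mu>] hom_component_sum hom_component_mconst_mult
  proof (rule sum.cong[OF refl])
    fix I assume "I \<in> pieri_sets n \<mu> m"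
    then have I: "I \<in> shift_sets n m" "add_eps \<mu> I \<in> Lam n" by (auto simp: pieri_sets_iff)
    show "mconst (psi_even n r \<mu> I) * hom_component (?p + odd_size n \<mu>) (Rg (add_eps \<mu> I)) =
        mconst (psi_even n r \<mu> I) * Rbar n r (add_eps \<mu> I)"
      by (simp only: Rbar_eq[OF I(2)] odd_size_add_eps[OF I(1)] add.commute)
  qed
  finally show ?thesis .
qed

end

theorem corollary9p4:
  fixes r :: "'a::field_char_0" and n m :: nat and \<mu> :: "nat \<Rightarrow> nat"
  assumes "n \<ge> 1"
    and "\<not> (\<exists>q::rat. q < 0 \<and> r = of_rat q)"
    and "\<mu> \<in> Lam n"
    and "m \<in> {1..n}"
  shows "e_poly n r m * Rbar n r \<mu> =
    (\<Sum>I\<in>pieri_sets n \<mu> m.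
       Poly_Mapping.single 0 (psi_even n r \<mu> I) * Rbar n r (add_eps \<mu> I))"
proof -
  have "of_nat a + of_nat b * r \<noteq> 0" if "a > 0" for a b
  proof
    assume eq: "of_nat a + of_nat b * r = 0"
    then have b: "b > 0" using that by (cases "b = 0") auto
    have "r = - (of_nat a / of_nat b)"
      using eq b by (simp add: field_simps eq_neg_iff_add_eq_0)
    also have "\<dots> = of_rat (- (of_nat a / of_nat b))"
      by (simp add: of_rat_minus of_rat_divide)
    finally have "r = of_rat (- (of_nat a / of_nat b))" .
    moreover have "- (of_nat a / of_nat b) < (0 :: rat)" using that b by simp
    ultimately show False using assms(2) by blast
  qed
  then interpret generic_parameter n r by unfold_locales
  show ?thesis using pieri assms(3,4) by simp
qed

end
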